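(* Let $g=2k$ with $k\ge 3$ an integer, and let $\mathcal{G}$ be the property that a graph contains a spanning maximal planar subgraph of girth $g$. Then the threshold for $G_{\frac{g-2}{2}n+2,\,p}\in\mathcal{G}$ is contained in the interval $\left(\left(\frac{c_1}{n}\right)^{(g-2)/g},\ \frac{c_2(\log n)^{(g+2)/g}}{n^{(g-2)/g}}\right)$ for some constants $c_1,c_2>0$. That is, there are constants $c_1,c_2>0$ such that if $p\le (c_1/n)^{(g-2)/g}$ then $\Pr[G_{\frac{g-2}{2}n+2,p}\in\mathcal{G}]\to 0$ as $n\to\infty$, and if $p\ge c_2(\log n)^{(g+2)/g}n^{-(g-2)/g}$ then $\Pr[G_{\frac{g-2}{2}n+2,p}\in\mathcal{G}]\to 1$ as $n\to\infty$.
   Context: $G_{N,p}$ is the Erdős–Rényi random graph on $N$ vertices, each edge present independently with probability $p$; here $N=\frac{g-2}{2}n+2$ with $n$ the asymptotic parameter. A subgraph is spanning if it contains all vertices. A planar graph of girth $g$ on $N$ vertices has at most $\frac{g}{g-2}(N-2)$ edges; it is called a maximal planar graph of girth $g$ when it has girth $g$ and exactly $\frac{g}{g-2}(N-2)$ edges. A threshold for a property $\mathcal{G}$ is a function $f(n)$ such that $p=o(f(n))$ implies non-membership with probability tending to $1$ and $f(n)=o(p)$ implies membership with probability tending to $1$. *)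

theory Defs
  imports "HOL-Analysis.Analysis" "HOL-Library.Extended_Nat"
begin

definition all_edges :: "nat \<Rightarrow> nat set set" where
  "all_edges N = {e. \<exists>u v. u < N \<and> v < N \<and> u \<noteq> v \<and> e = {u, v}}"

definition planar :: "nat set \<Rightarrow> nat set set \<Rightarrow> bool" where
  "planar V E \<longleftrightarrow> (\<exists>(pos :: nat \<Rightarrow> complex) (\<gamma> :: nat set \<Rightarrow> real \<Rightarrow> complex).
     inj_on pos V \<and>
     (\<forall>e\<in>E. arc (\<gamma> e) \<and> {pathstart (\<gamma> e), pathfinish (\<gamma> e)} = pos ` e) \<and>
     (\<forall>e\<in>E. \<forall>v\<in>V. pos v \<in> path_image (\<gamma> e) \<longrightarrow> v \<in> e) \<and>
     (\<forall>e\<in>E. \<forall>e'\<in>E. e \<noteq> e' \<longrightarrow> path_image (\<gamma> e) \<inter> path_image (\<gamma> e') \<subseteq> pos ` (e \<inter> e')))"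

definition has_cycle_of_length :: "nat set set \<Rightarrow> nat \<Rightarrow> bool" where
  "has_cycle_of_length E L \<longleftrightarrow> L \<ge> 3 \<and> (\<exists>vs. length vs = L \<and> distinct vs \<and>
      (\<forall>i<L. {vs ! i, vs ! ((i + 1) mod L)} \<in> E))"

text \<open>Girth: length of a shortest cycle (infinity if acyclic).\<close>

definition girth :: "nat set set \<Rightarrow> enat" where
  "girth E = Inf (enat ` {L. has_cycle_of_length E L})"

definition maximal_planar_girth :: "nat \<Rightarrow> nat set \<Rightarrow> nat set set \<Rightarrow> bool" where
  "maximal_planar_girth g V E \<longleftrightarrow> planar V E \<and> girth E = enat g \<and>
     real (card E) = real g / (real g - 2) * (real (card V) - 2)"

definition has_spanning_mpg :: "nat \<Rightarrow> nat \<Rightarrow> nat set set \<Rightarrow> bool" where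
  "has_spanning_mpg g N E \<longleftrightarrow> (\<exists>H \<subseteq> E. maximal_planar_girth g {0..<N} H)"

definition prob_Gnp :: "nat \<Rightarrow> real \<Rightarrow> (nat set set \<Rightarrow> bool) \<Rightarrow> real" where
  "prob_Gnp N p P = (\<Sum>E\<in>{E. E \<subseteq> all_edges N \<and> P E}.
      p ^ card E * (1 - p) ^ (card (all_edges N) - card E))"

end

(*
Lower bound.  Planar drawings are relaxed by letting vertices and edges be path-connected compacta.
This notion survives contractions and, by the Jordan curve theorem, excludes K(3,3).  A dense graph
contracts to one in which every edge lies in many triangles, and two such steps produce K(3,3); so
the relaxed planar graphs have fewer than 6 |V| edges.  Each of them loses a constant fraction of
its vertices when a matching is contracted or when twins are deleted, and when m of n vertices are
lost the graph is recovered from the smaller one in at most n^m 2^O(n) ways.  By induction there are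
at most (C N)^N planar graphs on N labelled vertices.  As the graphs sought have k n edges, the
expected number of copies in the random graph tends to 0.

Upper bound.  A spiral with ears is a planar graph of girth 2 k with k n edges whose edges can be
coloured with k colours so that deleting any colour class leaves a forest.  Hence every set S of its
edges contains a forest with (k-1)/k |S| edges, and a random copy of the spiral graph contains S with
probability at most (C/N)^((k-1) |S| / k).  The minimum-fragment argument of Park and Pham turns this
spread into a bound for the threshold.
*)

theory Submission
  imports Defs "HOL-Real_Asymp.Real_Asymp" "HOL-Combinatorics.Permutations"
begin

section \<open>Nonplanarity of the complete bipartite graph on 3 + 3 vertices\<close>

text \<open>Why the exponents fit: a copy has k n edges on N = (k - 1) n + 2 vertices, and at p = (c
  / n)^((k-1)/k) its probability is (c / n)^((k-1) n). A count of the form (C N)^N exceeds the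
  reciprocal only by a quadratic and an exponential factor, and a small c beats both; any larger
  power of N would be fatal. This is why every step of the induction has to remove a constant
  fraction of the vertices: the factor 2^O(n) of a step is then absorbed into C^m. On the other
  side, the spiral has spanning forests of (k - 1) n + 1 among its k n edges, so a share of about
  (k-1)/k is the most that can be asked of every edge set S, and the spiral attains it. That share
  becomes the exponent of the threshold. The argument of Park and Pham costs one logarithm, the
  number of its rounds; the remaining (log n)^(1/k) drives the failure probability to 0.\<close>

definition arc_set :: "complex set \<Rightarrow> complex \<Rightarrow> complex \<Rightarrow> bool" where
  "arc_set S a b \<longleftrightarrow> (\<exists>g. arc g \<and> path_image g = S \<and> pathstart g = a \<and> pathfinish g = b)"

lemma arc_set_sym: "arc_set S a b \<Longrightarrow> arc_set S b a"
  unfolding arc_set_def by (metis arc_reversepath path_image_reversepath pathfinish_reversepath pathstart_reversepath)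

lemma arc_set_join:
  assumes "arc_set S a b" "arc_set T b c" "S \<inter> T = {b}"
  shows "arc_set (S \<union> T) a c"
proof -
  obtain g h where "arc g" "path_image g = S" "pathstart g = a" "pathfinish g = b"
    "arc h" "path_image h = T" "pathstart h = b" "pathfinish h = c"
    using assms unfolding arc_set_def by blast
  then show ?thesis
    unfolding arc_set_def using assms(3)
    by (intro exI[of _ "g +++ h"]) (auto simp: arc_join path_image_join)
qed

lemma arc_set_ends: "arc_set S a b \<Longrightarrow> a \<in> S \<and> b \<in> S \<and> a \<noteq> b"
  unfolding arc_set_def by (metis arc_distinct_ends pathfinish_in_path_image pathstart_in_path_image)

lemma arc_set_compact: "arc_set S a b \<Longrightarrow> compact S"
  unfolding arc_set_def using compact_arc_image by blast

lemma arc_set_path_connected: "arc_set S a b \<Longrightarrow> path_connected S"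
  unfolding arc_set_def using path_connected_path_image arc_imp_path by blast

text \<open>An arc that meets a closed curve only at its ends has its interior on one side of the
  curve by connectedness, while its ends stay in the closure of that side. The chord arguments play
  these two facts against each other.\<close>

lemma arc_set_open:
  assumes "arc_set S a b"
  shows "connected (S - {a, b})" "S - {a, b} \<noteq> {}" "b \<in> closure (S - {a, b})"
proof -
  obtain g where g: "arc g" "path_image g = S" "pathstart g = a" "pathfinish g = b"
    using assms unfolding arc_set_def by blast
  then have sp: "simple_path g" by (simp add: arc_imp_simple_path)
  show "connected (S - {a, b})" using connected_simple_path_endless[OF sp] g by simp
  show "S - {a, b} \<noteq> {}" using nonempty_simple_path_endless[OF sp] g by simp
  have ab: "a \<in> S" "b \<in> S" "a \<noteq> b" using arc_set_ends[OF assms] by auto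
  have "connected S" using arc_set_path_connected[OF assms] path_connected_imp_connected by blast
  then have "b islimpt S" using connected_imp_perfect[of S b] ab by blast
  then have "b islimpt (insert a (insert b (S - {a,b})))"
    by (rule islimpt_subset) auto
  then show "b \<in> closure (S - {a, b})"
    by (simp add: islimpt_insert closure_def)
qed

lemma arc_set_image:
  assumes "arc_set S a b" "continuous_on S f" "inj_on f S"
  shows "arc_set (f ` S) (f a) (f b)"
proof -
  obtain g where g: "arc g" "path_image g = S" "pathstart g = a" "pathfinish g = b"
    using assms unfolding arc_set_def by blast
  have "arc (f \<circ> g)"
    using g assms unfolding arc_def path_def path_image_def
    by (metis comp_inj_on continuous_on_compose)
  then show ?thesis
    unfolding arc_set_def using g
    by (intro exI[of _ "f \<circ> g"]) (auto simp: path_image_compose pathstart_compose pathfinish_compose)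
qed

text \<open>A theta graph: \<open>S\<close> and \<open>T\<close> make up a closed curve and
  \<open>C\<close> is a chord of it, with no side prescribed.\<close>

definition theta :: "complex set \<Rightarrow> complex set \<Rightarrow> complex set \<Rightarrow> complex \<Rightarrow> complex \<Rightarrow> bool" where
  "theta S T C a b \<longleftrightarrow> arc_set S a b \<and> arc_set T a b \<and> arc_set C a b \<and>
     S \<inter> T = {a,b} \<and> S \<inter> C = {a,b} \<and> T \<inter> C = {a,b}"

lemma arc_sets_Jordan:
  assumes "arc_set S a b" "arc_set T a b" "S \<inter> T = {a,b}"
  obtains c where "simple_path c" "path_image c = S \<union> T" "pathfinish c = pathstart c"
proof -
  obtain g h where g: "arc g" "path_image g = S" "pathstart g = a" "pathfinish g = b"
    "arc h" "path_image h = T" "pathstart h = a" "pathfinish h = b"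
    using assms unfolding arc_set_def by blast
  show ?thesis
    using g assms(3)
    by (intro that[of "g +++ reversepath h"])
       (auto simp: simple_path_join_loop_eq path_image_join arc_reversepath)
qed

lemma connected_subset_inside_or_outside:
  fixes J :: "complex set"
  assumes "closed J" "connected D" "D \<inter> J = {}"
  shows "D \<subseteq> inside J \<or> D \<subseteq> outside J"
proof -
  have "open (inside J)" "open (outside J)"
    using assms(1) open_inside open_outside by blast+
  moreover have "D \<subseteq> inside J \<union> outside J" using assms by auto
  moreover have "inside J \<inter> outside J \<inter> D = {}" by auto
  ultimately have "inside J \<inter> D = {} \<or> outside J \<inter> D = {}"
    using connectedD[OF assms(2)] by blast
  then show ?thesis using \<open>D \<subseteq> inside J \<union> outside J\<close> by blast
qed

text \<open>The chord \<open>C\<close> cuts the inside of the closed curve into the insides of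
  \<open>S \<union> C\<close> and \<open>T \<union> C\<close>. The open arc of \<open>D\<close>
  avoids \<open>C\<close>, so it stays in one of them; but the end of \<open>D\<close> on the half
  that does not bound this region is not in its closure.\<close>

lemma no_crossing_chords_inside:
  assumes th: "theta S T C a b" and xz: "x \<in> S - {a,b}" "z \<in> T - {a,b}"
    and D: "arc_set D x z" "D \<inter> (S \<union> T) = {x,z}" "C \<inter> D = {}"
    and C: "C \<inter> inside (S \<union> T) \<noteq> {}"
  shows "D \<inter> inside (S \<union> T) = {}"
proof (rule ccontr)
  assume nz: "D \<inter> inside (S \<union> T) \<noteq> {}"
  obtain c1 c2 c where
    c: "arc c1" "path_image c1 = S" "pathstart c1 = a" "pathfinish c1 = b"
    "arc c2" "path_image c2 = T" "pathstart c2 = a" "pathfinish c2 = b"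
    "arc c" "path_image c = C" "pathstart c = a" "pathfinish c = b"
    using th unfolding theta_def arc_set_def by metis
  have ab: "a \<noteq> b" using th arc_set_ends theta_def by blast
  have int: "S \<inter> T = {a,b}" "S \<inter> C = {a,b}" "T \<inter> C = {a,b}" using th theta_def by auto
  have I: "inside (S \<union> C) \<inter> inside (T \<union> C) = {}"
     "inside (S \<union> C) \<union> inside (T \<union> C) \<union> (C - {a,b}) = inside (S \<union> T)"
    using split_inside_simple_closed_curve[of c1 a b c2 c] c ab int C
    by (auto simp: arc_imp_simple_path)
  have cl: "closed S" "closed T" "closed C"
    using th theta_def arc_set_compact compact_imp_closed by metis+
  define D' where "D' = D - {x,z}"
  have D': "connected D'" "z \<in> closure D'" "x \<in> closure D'"
    using arc_set_open[OF D(1)] arc_set_open(3)[OF arc_set_sym[OF D(1)]]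
    by (auto simp: D'_def insert_commute)
  have "D' \<inter> (S \<union> T) = {}" using D by (auto simp: D'_def)
  then have "D' \<subseteq> inside (S \<union> T) \<or> D' \<subseteq> outside (S \<union> T)"
    by (intro connected_subset_inside_or_outside D'(1) closed_Un cl)
  moreover have "D' \<inter> inside (S \<union> T) \<noteq> {}"
    using nz D(2) inside_no_overlap[of "S \<union> T"] unfolding D'_def by blast
  ultimately have "D' \<subseteq> inside (S \<union> T)"
    using inside_Int_outside[of "S \<union> T"] by blast
  then have sub: "D' \<subseteq> inside (S \<union> C) \<union> inside (T \<union> C)"
    using I(2) D(3) by (auto simp: D'_def)
  have op: "open (inside (S \<union> C))" "open (inside (T \<union> C))"
    by (intro open_inside closed_Un cl)+
  have "inside (S \<union> C) \<inter> D' = {} \<or> inside (T \<union> C) \<inter> D' = {}"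
    using connectedD[OF D'(1) op] I(1) sub by blast
  then consider "D' \<subseteq> inside (S \<union> C)" | "D' \<subseteq> inside (T \<union> C)" using sub by blast
  then show False
  proof cases
    case 1
    then have "z \<in> closure (inside (S \<union> C))" using D'(2) closure_mono by blast
    then have "z \<in> S \<union> C \<union> inside (S \<union> C)"
      using closure_inside_subset[OF closed_Un[OF cl(1,3)]] by blast
    moreover have "z \<notin> inside (S \<union> C)"
      using I(2) xz(2) inside_no_overlap[of "S \<union> T"] by blast
    ultimately show False using xz(2) int by blast
  next
    case 2
    then have "x \<in> closure (inside (T \<union> C))" using D'(3) closure_mono by blast
    then have "x \<in> T \<union> C \<union> inside (T \<union> C)"
      using closure_inside_subset[OF closed_Un[OF cl(2,3)]] by blast
    moreover have "x \<notin> inside (T \<union> C)"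
      using I(2) xz(1) inside_no_overlap[of "S \<union> T"] by blast
    ultimately show False using xz(1) int by blast
  qed
qed

text \<open>Points near \<open>z0\<close> are sent far away, hence outside the image curve. If the
  image of \<open>p\<close> were outside too, the connected outside of the image curve would pull
  back to a connected set that avoids \<open>J\<close> and contains both \<open>p\<close> and a
  point near \<open>z0\<close>.\<close>

lemma inversion_outside_to_inside:
  fixes c :: "real \<Rightarrow> complex"
  assumes c: "simple_path c" "pathfinish c = pathstart c" "path_image c = J"
    and z0: "z0 \<in> inside J" and p: "p \<in> outside J"
  shows "1 / (p - z0) \<in> inside ((\<lambda>z. 1 / (z - z0)) ` J)"
proof (rule ccontr)
  define f where "f = (\<lambda>z. 1 / (z - z0))"
  define h where "h = (\<lambda>w. z0 + 1 / w)"
  have hf: "h (f z) = z" if "z \<noteq> z0" for z using that by (simp add: f_def h_def)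
  have z0J: "z0 \<notin> J" using z0 inside_no_overlap by blast
  have pz: "p \<noteq> z0" "p \<notin> J" using p z0 inside_Int_outside[of J] outside_no_overlap[of J] by blast+
  have fh: "f (h w) = w" if "w \<noteq> 0" for w using that by (simp add: f_def h_def)
  have cJ: "compact J" "closed J" using c compact_simple_path_image closed_simple_path_image by blast+
  have contf: "continuous_on J f"
    unfolding f_def using z0J by (intro continuous_intros) auto
  have injf: "inj_on f J" by (rule inj_on_inverseI[of _ h]) (use hf z0J in metis)
  define K where "K = f ` J"
  assume "1 / (p - z0) \<notin> inside ((\<lambda>z. 1 / (z - z0)) ` J)"
  then have "f p \<notin> inside K" by (simp add: f_def K_def)
  moreover have "f p \<notin> K" using hf pz z0J by (metis K_def imageE)
  ultimately have fp: "f p \<in> outside K" using inside_Un_outside[of K] by blast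
  have "simple_path (f \<circ> c)" using simple_path_continuous_image[of c f] c contf injf by auto
  moreover have "pathfinish (f \<circ> c) = pathstart (f \<circ> c)"
    using c by (simp add: pathfinish_compose pathstart_compose)
  moreover have "path_image (f \<circ> c) = K" using c by (simp add: path_image_compose K_def)
  ultimately have JK: "connected (outside K)" "open (outside K)"
    using Jordan_inside_outside[of "f \<circ> c"] by auto
  have "compact K" using contf cJ K_def compact_continuous_image by blast
  then have "bounded (- outside K)" by (simp add: cobounded_outside compact_imp_bounded)
  then obtain B where B: "\<And>w. w \<notin> outside K \<Longrightarrow> norm w \<le> B" unfolding bounded_iff by blast
  have "open (inside J)" using cJ by (simp add: open_inside)
  then obtain e where e: "e > 0" "ball z0 e \<subseteq> inside J" using z0 open_contains_ball by blast
  define r where "r = min (e/2) (1 / (\<bar>B\<bar> + 1))"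
  have r: "r > 0" "r < e" "1/r > B"
  proof -
    show "r > 0" "r < e" using e by (auto simp: r_def min_def)
    have "r \<le> 1 / (\<bar>B\<bar> + 1)" by (simp add: r_def)
    then have "\<bar>B\<bar> + 1 \<le> 1 / r" using \<open>r > 0\<close> by (simp add: field_simps)
    then show "1/r > B" by linarith
  qed
  define z where "z = z0 + of_real r"
  have zin: "z \<in> inside J" using e r by (auto simp: z_def dist_norm)
  have zz: "z \<noteq> z0" using r by (simp add: z_def)
  have "norm (f z) = 1 / r" using r by (simp add: f_def z_def norm_divide)
  then have fz: "f z \<in> outside K" using B r(3) by force
  \<comment> \<open>0 is the image of infinity, so it must be deleted before pulling back; an open
    connected plane set stays connected without one point.\<close>
  define X where "X = h ` (outside K - {0})"
  have "connected (outside K - {0})" using JK by (intro connected_open_delete) auto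
  moreover have "continuous_on (outside K - {0}) h"
    unfolding h_def by (intro continuous_intros) auto
  ultimately have cX: "connected X" unfolding X_def using connected_continuous_image by blast
  have "X \<inter> J = {}"
  proof -
    { fix w assume w: "w \<in> outside K" "w \<noteq> 0" "h w \<in> J"
      then have "w \<in> K" using fh unfolding K_def by (metis imageI)
      then have False using w outside_no_overlap[of K] by blast }
    then show ?thesis unfolding X_def by blast
  qed
  then have "X \<subseteq> inside J \<or> X \<subseteq> outside J"
    using connected_subset_inside_or_outside cJ cX by blast
  moreover have "p \<in> X" "z \<in> X"
  proof -
    have "f p \<noteq> 0" "f z \<noteq> 0" using pz zz by (auto simp: f_def)
    then show "p \<in> X" "z \<in> X" unfolding X_def using fp fz hf pz zz
      by (metis Diff_iff imageI singletonD)+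
  qed
  ultimately show False using p zin inside_Int_outside[of J] by blast
qed

text \<open>Reduces to the inside case by inversion at a point \<open>z0\<close> inside the curve.
  Both chords lie on the curve or outside it, so they miss \<open>z0\<close> and the inversion is
  continuous and injective on the whole figure.\<close>

lemma no_crossing_chords_outside:
  assumes th: "theta S T C a b" and xz: "x \<in> S - {a,b}" "z \<in> T - {a,b}"
    and D: "arc_set D x z" "D \<inter> (S \<union> T) = {x,z}" "C \<inter> D = {}"
    and C: "C \<inter> outside (S \<union> T) \<noteq> {}"
  shows "D \<inter> outside (S \<union> T) = {}"
proof (rule ccontr)
  assume nz: "D \<inter> outside (S \<union> T) \<noteq> {}"
  let ?J = "S \<union> T"
  have as: "arc_set S a b" "arc_set T a b" "arc_set C a b"
     "S \<inter> T = {a,b}" "S \<inter> C = {a,b}" "T \<inter> C = {a,b}" using th theta_def by auto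
  obtain c where c: "simple_path c" "path_image c = ?J" "pathfinish c = pathstart c"
    using arc_sets_Jordan as by blast
  then obtain z0 where z0: "z0 \<in> inside ?J" using Jordan_inside_outside[of c] by auto
  have cl: "closed ?J" using c closed_simple_path_image by metis
  have side: "A \<subseteq> outside ?J \<union> ?J"
    if "arc_set A u v" "A \<inter> ?J = {u, v}" "A \<inter> outside ?J \<noteq> {}" for A u v
  proof -
    have "A - {u,v} \<subseteq> inside ?J \<or> A - {u,v} \<subseteq> outside ?J"
      using connected_subset_inside_or_outside[OF cl arc_set_open(1)[OF that(1)]] that(2) by blast
    moreover have "(A - {u,v}) \<inter> outside ?J \<noteq> {}"
      using that(2,3) outside_no_overlap[of ?J] by blast
    ultimately have "A - {u,v} \<subseteq> outside ?J" using inside_Int_outside[of ?J] by blast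
    then show ?thesis using that(2) by blast
  qed
  have CJ: "C \<inter> ?J = {a,b}" using as by blast
  have Cs: "C \<subseteq> outside ?J \<union> ?J" using side[OF as(3) CJ C] .
  have Ds: "D \<subseteq> outside ?J \<union> ?J" using side[OF D(1,2) nz] .
  have z0n: "z0 \<notin> ?J \<union> C \<union> D"
    using z0 Cs Ds inside_Int_outside[of ?J] inside_no_overlap[of ?J] by blast
  define f where "f = (\<lambda>z. 1 / (z - z0))"
  define U where "U = ?J \<union> C \<union> D"
  have contf: "continuous_on U f"
    unfolding f_def using z0n by (intro continuous_intros) (auto simp: U_def)
  have injf: "inj_on f U"
    by (rule inj_on_inverseI[of _ "\<lambda>w. z0 + 1/w"]) (use z0n in \<open>auto simp: f_def U_def\<close>)
  have sub: "S \<subseteq> U" "T \<subseteq> U" "C \<subseteq> U" "D \<subseteq> U" by (auto simp: U_def)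
  have img: "arc_set (f ` A) (f u) (f v)" if "arc_set A u v" "A \<subseteq> U" for A u v
    using that arc_set_image contf injf continuous_on_subset inj_on_subset by metis
  have int: "f ` A \<inter> f ` B = f ` (A \<inter> B)" if "A \<subseteq> U" "B \<subseteq> U" for A B
    using inj_on_image_Int[OF injf that] by simp
  have "theta (f ` S) (f ` T) (f ` C) (f a) (f b)"
    unfolding theta_def using img[OF as(1)] img[OF as(2)] img[OF as(3)] int sub as by simp
  moreover have U: "a \<in> U" "b \<in> U" "x \<in> U" "z \<in> U"
    using as xz by (auto simp: U_def)
  have "f x \<in> f ` S - {f a, f b}" "f z \<in> f ` T - {f a, f b}"
    using xz U injf by (auto dest: inj_onD)
  moreover have "arc_set (f ` D) (f x) (f z)" using img D sub by blast
  moreover have "f ` D \<inter> (f ` S \<union> f ` T) = {f x, f z}"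
    using int[of D "S \<union> T"] sub D(2) by (simp add: image_Un)
  moreover have "f ` C \<inter> f ` D = {}" using int sub D(3) by simp
  moreover have J: "f ` S \<union> f ` T = f ` ?J" by auto
  have "f ` C \<inter> inside (f ` S \<union> f ` T) \<noteq> {}" "f ` D \<inter> inside (f ` S \<union> f ` T) \<noteq> {}"
  proof -
    have *: "f p \<in> inside (f ` ?J)" if "p \<in> outside ?J" for p
      using inversion_outside_to_inside[OF c(1,3,2) z0 that] by (simp add: f_def)
    show "f ` C \<inter> inside (f ` S \<union> f ` T) \<noteq> {}" "f ` D \<inter> inside (f ` S \<union> f ` T) \<noteq> {}"
      unfolding J using * C nz by blast+
  qed
  ultimately show False
    using no_crossing_chords_inside[of "f ` S" "f ` T" "f ` C" "f a" "f b" "f x" "f z" "f ` D"] by simp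
qed

text \<open>Six of the nine edges form a hexagon \<open>J\<close> and the other three join opposite
  vertices of it. Each of these three lies on one side of \<open>J\<close>, so two of them share a
  side, where disjoint chords with interleaved ends cannot both fit.\<close>

lemma K33_not_in_plane:
  fixes a b :: "nat \<Rightarrow> complex" and S :: "nat \<Rightarrow> nat \<Rightarrow> complex set"
  assumes arc: "\<And>i j. i < 3 \<Longrightarrow> j < 3 \<Longrightarrow> arc_set (S i j) (a i) (b j)"
    and int: "\<And>i j i' j'. i < 3 \<Longrightarrow> j < 3 \<Longrightarrow> i' < 3 \<Longrightarrow> j' < 3 \<Longrightarrow> (i, j) \<noteq> (i', j') \<Longrightarrow>
      S i j \<inter> S i' j' \<subseteq> {x. i = i' \<and> x = a i \<or> j = j' \<and> x = b j}"
    and inj: "inj_on a {..<3}" "inj_on b {..<3}" "a ` {..<3} \<inter> b ` {..<3} = {}"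
  shows False
proof -
  have lt: "0 < (3::nat)" "1 < (3::nat)" "2 < (3::nat)" by auto
  have da: "a 0 \<noteq> a 1" "a 0 \<noteq> a 2" "a 1 \<noteq> a 2" "b 0 \<noteq> b 1" "b 0 \<noteq> b 2" "b 1 \<noteq> b 2"
    using inj(1,2) lt by (metis inj_onD lessThan_iff zero_neq_one zero_neq_numeral one_eq_numeral_iff num.distinct(1))+
  have dab: "a i \<noteq> b j" if "i < 3" "j < 3" for i j using inj(3) that by blast
  have ends: "a i \<in> S i j" "b j \<in> S i j" if "i < 3" "j < 3" for i j
    using arc_set_ends[OF arc[OF that]] by auto
  have ia: "S i j \<inter> S i j' = {a i}" if "i < 3" "j < 3" "j' < 3" "j \<noteq> j'" for i j j'
    using int[of i j i j'] that ends by blast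
  have ib: "S i j \<inter> S i' j = {b j}" if "i < 3" "i' < 3" "j < 3" "i \<noteq> i'" for i i' j
    using int[of i j i' j] that ends by blast
  have i0: "S i j \<inter> S i' j' = {}" if "i < 3" "i' < 3" "j < 3" "j' < 3" "i \<noteq> i'" "j \<noteq> j'" for i i' j j'
    using int[of i j i' j'] that by auto
  define J where "J = S 0 0 \<union> S 1 0 \<union> S 1 1 \<union> S 2 1 \<union> S 2 2 \<union> S 0 2"
  have join3: "arc_set (S i j \<union> S i' j \<union> S i' j') (a i) (b j')"
    if "i < 3" "i' < 3" "j < 3" "j' < 3" "i \<noteq> i'" "j \<noteq> j'" for i i' j j'
  proof -
    have "arc_set (S i j \<union> S i' j) (a i) (a i')"
      using arc_set_join[OF arc[of i j] arc_set_sym[OF arc[of i' j]]] ib that by auto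
    moreover have "(S i j \<union> S i' j) \<inter> S i' j' = {a i'}"
      using ia[of i' j j'] i0[of i i' j j'] that by auto
    ultimately show ?thesis using arc_set_join arc that by blast
  qed
  text \<open>The chord \<open>S i j'\<close> joins opposite vertices of the hexagon
    a i, b j, a i', b j', a i'', b j''.\<close>
  have hex: "\<not> (S i j' \<inter> inside J \<noteq> {} \<and> S i' j'' \<inter> inside J \<noteq> {})"
       "\<not> (S i j' \<inter> outside J \<noteq> {} \<and> S i' j'' \<inter> outside J \<noteq> {})"
       "S i j' \<inter> J = {a i, b j'}"
    if lt: "i < 3" "i' < 3" "i'' < 3" "j < 3" "j' < 3" "j'' < 3"
      and ne: "i \<noteq> i'" "i' \<noteq> i''" "i \<noteq> i''" "j \<noteq> j'" "j' \<noteq> j''" "j \<noteq> j''"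
      and J: "J = (S i j \<union> S i' j \<union> S i' j') \<union> (S i j'' \<union> S i'' j'' \<union> S i'' j')"
    for i i' i'' j j' j''
  proof -
    let ?P = "S i j \<union> S i' j \<union> S i' j'" and ?Q = "S i j'' \<union> S i'' j'' \<union> S i'' j'"
    have PQ: "?P \<inter> ?Q = {a i, b j'}"
    proof -
      have e: "S i j \<inter> S i j'' = {a i}" "S i j \<inter> S i'' j'' = {}" "S i j \<inter> S i'' j' = {}"
        "S i' j \<inter> S i j'' = {}" "S i' j \<inter> S i'' j'' = {}" "S i' j \<inter> S i'' j' = {}"
        "S i' j' \<inter> S i j'' = {}" "S i' j' \<inter> S i'' j'' = {}" "S i' j' \<inter> S i'' j' = {b j'}"
        by (rule ia ib i0; use lt ne in simp)+
      show ?thesis unfolding Int_Un_distrib Int_Un_distrib2 e by auto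
    qed
    have PC: "?P \<inter> S i j' = {a i, b j'}"
    proof -
      have e: "S i j \<inter> S i j' = {a i}" "S i' j \<inter> S i j' = {}" "S i' j' \<inter> S i j' = {b j'}"
        by (rule ia ib i0; use lt ne in simp)+
      show ?thesis unfolding Int_Un_distrib Int_Un_distrib2 e by auto
    qed
    have QC: "?Q \<inter> S i j' = {a i, b j'}"
    proof -
      have e: "S i j'' \<inter> S i j' = {a i}" "S i'' j'' \<inter> S i j' = {}" "S i'' j' \<inter> S i j' = {b j'}"
        by (rule ia ib i0; use lt ne in simp)+
      show ?thesis unfolding Int_Un_distrib Int_Un_distrib2 e by auto
    qed
    have th: "theta ?P ?Q (S i j') (a i) (b j')"
      unfolding theta_def using join3[of i i' j j'] join3[of i i'' j'' j'] arc[of i j'] PQ PC QC lt ne by simp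
    have aeq: "a i = a i' \<longleftrightarrow> i = i'" "b j'' = b j' \<longleftrightarrow> j'' = j'"
      using inj lt by (auto simp: inj_on_def)
    have x: "a i' \<in> ?P - {a i, b j'}" "b j'' \<in> ?Q - {a i, b j'}"
      using ends[of i' j] ends[of i j''] lt dab[of i' j'] aeq ne dab[of i j''] by simp_all
    have DJ: "S i' j'' \<inter> (?P \<union> ?Q) = {a i', b j''}"
    proof -
      have e: "S i' j'' \<inter> S i j = {}" "S i' j'' \<inter> S i' j = {a i'}" "S i' j'' \<inter> S i' j' = {a i'}"
        "S i' j'' \<inter> S i j'' = {b j''}" "S i' j'' \<inter> S i'' j'' = {b j''}" "S i' j'' \<inter> S i'' j' = {}"
        by (rule ia ib i0; use lt ne in simp)+
      show ?thesis unfolding Int_Un_distrib e by auto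
    qed
    have CD: "S i j' \<inter> S i' j'' = {}" using i0 lt ne by blast
    show "\<not> (S i j' \<inter> inside J \<noteq> {} \<and> S i' j'' \<inter> inside J \<noteq> {})"
      using no_crossing_chords_inside[OF th x arc[OF lt(2,6)] DJ CD] J by blast
    show "\<not> (S i j' \<inter> outside J \<noteq> {} \<and> S i' j'' \<inter> outside J \<noteq> {})"
      using no_crossing_chords_outside[OF th x arc[OF lt(2,6)] DJ CD] J by blast
    show "S i j' \<inter> J = {a i, b j'}" using PC QC J by blast
  qed
  \<comment> \<open>The hexagon is invariant under a cyclic shift of the indices, so the three pairs
    of chords are three instances of \<open>hex\<close>.\<close>
  have h1: "\<not> (S 0 1 \<inter> inside J \<noteq> {} \<and> S 1 2 \<inter> inside J \<noteq> {})"
       "\<not> (S 0 1 \<inter> outside J \<noteq> {} \<and> S 1 2 \<inter> outside J \<noteq> {})" "S 0 1 \<inter> J = {a 0, b 1}"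
    by (rule hex[of 0 1 2 0 1 2]; auto simp: J_def)+
  have h2: "\<not> (S 1 2 \<inter> inside J \<noteq> {} \<and> S 2 0 \<inter> inside J \<noteq> {})"
       "\<not> (S 1 2 \<inter> outside J \<noteq> {} \<and> S 2 0 \<inter> outside J \<noteq> {})" "S 1 2 \<inter> J = {a 1, b 2}"
    by (rule hex[of 1 2 0 1 2 0]; auto simp: J_def)+
  have h3: "\<not> (S 2 0 \<inter> inside J \<noteq> {} \<and> S 0 1 \<inter> inside J \<noteq> {})"
       "\<not> (S 2 0 \<inter> outside J \<noteq> {} \<and> S 0 1 \<inter> outside J \<noteq> {})" "S 2 0 \<inter> J = {a 2, b 0}"
    by (rule hex[of 2 0 1 2 0 1]; auto simp: J_def)+
  have sides: "S i j \<inter> inside J \<noteq> {} \<or> S i j \<inter> outside J \<noteq> {}"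
    if "i < 3" "j < 3" "S i j \<inter> J = {a i, b j}" for i j
    using arc_set_open(2)[OF arc[OF that(1,2)]] that(3) inside_Un_outside[of J] by blast
  show False
    using h1 h2 h3 sides[of 0 1] sides[of 1 2] sides[of 2 0] by auto
qed

section \<open>Drawings with thick vertices and edges\<close>

lemma arc_set_first_hit:
  assumes "arc_set S a b" "closed B" "a \<notin> B" "b \<in> B"
  obtains T q where "T \<subseteq> S" "arc_set T a q" "T \<inter> B = {q}"
proof -
  obtain g where g: "arc g" "path_image g = S" "pathstart g = a" "pathfinish g = b"
    using assms unfolding arc_set_def by blast
  obtain u where u: "0 \<le> u" "u \<le> 1" "\<And>x. 0 \<le> x \<and> x < u \<Longrightarrow> g x \<in> interior (- B)"
    "g u \<notin> interior (- B)"
    using subpath_to_frontier_explicit[of g "- B"] g assms(4) by (metis ComplD arc_imp_path)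
  have op: "interior (- B) = - B" using assms(2) by (simp add: interior_open open_Compl)
  have gu: "g u \<in> B" using u(4) op by auto
  have "u \<noteq> 0" using gu assms(3) g(3) by (auto simp: pathstart_def)
  then have u0: "0 < u" using u by simp
  have "arc (subpath 0 u g)" using g u u0 by (intro arc_subpath_arc) auto
  moreover have im: "path_image (subpath 0 u g) = g ` {0..u}" using u0 by (simp add: path_image_subpath)
  ultimately have "arc_set (g ` {0..u}) a (g u)"
    unfolding arc_set_def using g(3)
    by (intro exI[of _ "subpath 0 u g"]) (auto simp: pathstart_def[of g])
  moreover have "g ` {0..u} \<subseteq> S" using g(2) u unfolding path_image_def by auto
  moreover have "g ` {0..u} \<inter> B = {g u}"
  proof
    show "g ` {0..u} \<inter> B \<subseteq> {g u}"
    proof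
      fix y assume "y \<in> g ` {0..u} \<inter> B"
      then obtain x where x: "y = g x" "0 \<le> x" "x \<le> u" "g x \<in> B" by auto
      then have "\<not> x < u" using u(3)[of x] op by auto
      then show "y \<in> {g u}" using x by simp
    qed
  qed (use gu u in auto)
  ultimately show ?thesis using that by blast
qed

text \<open>Cutting at the first point of \<open>B\<close> and then, walking back from it, at the
  first point of \<open>A\<close> leaves the end on \<open>B\<close> intact.\<close>

lemma arc_set_between:
  assumes "path_connected Y" "Y \<inter> A \<noteq> {}" "Y \<inter> B \<noteq> {}" "closed A" "closed B" "A \<inter> B = {}"
  obtains Z p q where "Z \<subseteq> Y" "arc_set Z p q" "Z \<inter> A = {p}" "Z \<inter> B = {q}"
proof -
  obtain p0 q0 where pq: "p0 \<in> Y" "p0 \<in> A" "q0 \<in> Y" "q0 \<in> B" using assms by blast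
  then have "p0 \<noteq> q0" using assms(6) by blast
  then obtain g where "arc g" "path_image g \<subseteq> Y" "pathstart g = p0" "pathfinish g = q0"
    using assms(1) pq unfolding path_connected_arcwise by blast
  then obtain S where S: "S \<subseteq> Y" "arc_set S p0 q0" unfolding arc_set_def by blast
  have "p0 \<notin> B" using pq assms(6) by blast
  then obtain T q where T: "T \<subseteq> S" "arc_set T p0 q" "T \<inter> B = {q}"
    using arc_set_first_hit[OF S(2) assms(5)] pq by blast
  have "q \<notin> A" using T(3) assms(6) by blast
  then obtain Z p where Z: "Z \<subseteq> T" "arc_set Z q p" "Z \<inter> A = {p}"
    using arc_set_first_hit[OF arc_set_sym[OF T(2)] assms(4)] pq by blast
  have "q \<in> Z" using arc_set_ends[OF Z(2)] by simp
  then have "Z \<inter> B = {q}" using T(3) Z(1) by blast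
  then show ?thesis using that[of Z p q] Z S(1) T(1) arc_set_sym by blast
qed

lemma arc_set_split:
  assumes "arc_set S a b" "c \<in> S"
  obtains L R where "path_connected L" "path_connected R" "L \<subseteq> S" "R \<subseteq> S"
    "a \<in> L" "c \<in> L" "c \<in> R" "b \<in> R" "L \<inter> R = {c}"
proof -
  obtain g where g: "arc g" "path_image g = S" "pathstart g = a" "pathfinish g = b"
    using assms unfolding arc_set_def by blast
  obtain t where t: "0 \<le> t" "t \<le> 1" "c = g t" using assms(2) g(2) unfolding path_image_def by auto
  have c: "continuous_on {0..1} g" and inj: "inj_on g {0..1}"
    using g(1) by (auto simp: arc_def path_def)
  have pc: "path_connected (g ` {x..y})" if "0 \<le> x" "y \<le> 1" for x y
    using that by (intro path_connected_continuous_image continuous_on_subset[OF c]) auto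
  have "g ` {0..t} \<inter> g ` {t..1} = g ` ({0..t} \<inter> {t..1})"
    using t by (intro inj_on_image_Int[OF inj, symmetric]) auto
  also have "{0..t} \<inter> {t..1} = {t}" using t by auto
  finally have "g ` {0..t} \<inter> g ` {t..1} = {c}" using t by simp
  then show ?thesis
    using g t by (intro that[of "g ` {0..t}" "g ` {t..1}"] pc)
      (auto simp: path_image_def pathstart_def pathfinish_def)
qed

lemma path_connected_arc_set:
  assumes "path_connected X" "x \<in> X" "y \<in> X" "x \<noteq> y"
  obtains A where "A \<subseteq> X" "arc_set A x y"
proof -
  obtain g where "arc g" "path_image g \<subseteq> X" "pathstart g = x" "pathfinish g = y"
    using assms unfolding path_connected_arcwise by blast
  then show ?thesis using that[of "path_image g"] unfolding arc_set_def by blast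
qed

text \<open>Join \<open>p 0\<close> to \<open>p 1\<close> by an arc, walk from \<open>p 2\<close> to
  the first point \<open>c\<close> on it and split the arc at \<open>c\<close>. The legs are only
  required to be path-connected sets, so that they may shrink to a point when \<open>p 0\<close> and
  \<open>p 1\<close> coincide or \<open>p 2\<close> is already on the arc.\<close>

lemma tripod:
  fixes X :: "complex set" and p :: "nat \<Rightarrow> complex"
  assumes X: "path_connected X" and p: "\<And>i. i < 3 \<Longrightarrow> p i \<in> X"
  obtains c L where "\<And>i. i < (3::nat) \<Longrightarrow> path_connected (L i) \<and> L i \<subseteq> X \<and> c \<in> L i \<and> p i \<in> L i"
    "\<And>i j. i < 3 \<Longrightarrow> j < 3 \<Longrightarrow> i \<noteq> j \<Longrightarrow> L i \<inter> L j \<subseteq> {c}"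
proof -
  note concl = that
  have three: "i = 2" if "i < (3::nat)" "0 < i" "i \<noteq> Suc 0" for i using that by linarith
  have key: thesis
    if that': "path_connected L0" "path_connected L1" "path_connected L2" "L0 \<subseteq> X" "L1 \<subseteq> X" "L2 \<subseteq> X"
      "c \<in> L0" "c \<in> L1" "c \<in> L2" "p 0 \<in> L0" "p 1 \<in> L1" "p 2 \<in> L2"
      "L0 \<inter> L1 \<subseteq> {c}" "L0 \<inter> L2 \<subseteq> {c}" "L1 \<inter> L2 \<subseteq> {c}" for c L0 L1 L2
    by (rule concl[of "\<lambda>i. if i = 0 then L0 else if i = 1 then L1 else L2" c]) (use that' three in \<open>auto dest!: three\<close>)
  show thesis
  proof (cases "p 0 = p 1")
    case True
    show thesis by (rule key[of "{p 0}" "{p 0}" X "p 0"]) (use True X p in auto)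
  next
    case False
    obtain A where A: "A \<subseteq> X" "arc_set A (p 0) (p 1)"
      using path_connected_arc_set[OF X p[of 0] p[of 1] False] by auto
    have cA: "closed A" using arc_set_compact[OF A(2)] compact_imp_closed by blast
    obtain T c where T: "T \<subseteq> X" "path_connected T" "p 2 \<in> T" "T \<inter> A = {c}"
    proof (cases "p 2 \<in> A")
      case True
      show thesis by (rule that[of "{p 2}" "p 2"]) (use True p in auto)
    next
      case False
      have p0: "p 0 \<in> A" using arc_set_ends[OF A(2)] by simp
      then have ne: "p 2 \<noteq> p 0" using False by auto
      obtain B where B: "B \<subseteq> X" "arc_set B (p 2) (p 0)"
        using path_connected_arc_set[OF X p[of 2] p[of 0] ne] by auto
      obtain T q where "T \<subseteq> B" "arc_set T (p 2) q" "T \<inter> A = {q}"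
        using arc_set_first_hit[OF B(2) cA False p0] by blast
      then show thesis using that[of T q] B(1) arc_set_path_connected arc_set_ends by blast
    qed
    obtain L R where "path_connected L" "path_connected R" "L \<subseteq> A" "R \<subseteq> A"
      "p 0 \<in> L" "c \<in> L" "c \<in> R" "p 1 \<in> R" "L \<inter> R = {c}"
      using arc_set_split[OF A(2), of c] T(4) by blast
    then show thesis using T A(1) by (intro key[of L R T c]) blast+
  qed
qed

section \<open>Loose representations of graphs\<close>

definition edges_on :: "'a set \<Rightarrow> 'a set set \<Rightarrow> bool" where
  "edges_on V E \<longleftrightarrow> (\<forall>e\<in>E. \<exists>u v. u \<in> V \<and> v \<in> V \<and> u \<noteq> v \<and> e = {u, v})"

text \<open>A relaxation of planarity that is visibly stable under contraction: vertices may be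
  arbitrary disjoint path-connected compacta.\<close>

lemma edges_onE:
  assumes "edges_on V E" "e \<in> E"
  obtains u v where "u \<in> V" "v \<in> V" "u \<noteq> v" "e = {u, v}"
  using assms(1)[unfolded edges_on_def, rule_format, OF assms(2)] by auto

lemma edges_on_subset: "edges_on V E \<Longrightarrow> e \<in> E \<Longrightarrow> e \<subseteq> V"
  by (erule (1) edges_onE) simp

lemma edges_on_nonempty: "edges_on V E \<Longrightarrow> e \<in> E \<Longrightarrow> e \<noteq> {}"
  by (erule (1) edges_onE) simp

text \<open>Nothing is required of two edge sets inside the vertex set of a common end, nor of how
  an edge set runs inside the sets of its ends. This slack lets a contracted edge become part of a
  vertex set.\<close>

definition loose_rep ::
  "'a set \<Rightarrow> 'a set set \<Rightarrow> ('a \<Rightarrow> complex set) \<Rightarrow> ('a set \<Rightarrow> complex set) \<Rightarrow> bool" where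
  "loose_rep V E X Y \<longleftrightarrow>
      (\<forall>v\<in>V. compact (X v) \<and> path_connected (X v) \<and> X v \<noteq> {}) \<and>
      (\<forall>v\<in>V. \<forall>w\<in>V. v \<noteq> w \<longrightarrow> X v \<inter> X w = {}) \<and>
      (\<forall>e\<in>E. compact (Y e) \<and> path_connected (Y e)) \<and>
      (\<forall>e\<in>E. \<forall>v\<in>V. v \<in> e \<longleftrightarrow> Y e \<inter> X v \<noteq> {}) \<and>
      (\<forall>e\<in>E. \<forall>e'\<in>E. e \<noteq> e' \<longrightarrow> Y e \<inter> Y e' \<subseteq> \<Union>(X ` (e \<inter> e')))"

definition loose :: "'a set \<Rightarrow> 'a set set \<Rightarrow> bool" where
  "loose V E \<longleftrightarrow> finite V \<and> edges_on V E \<and> (\<exists>X Y. loose_rep V E X Y)"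

lemma loose_repD:
  assumes "loose_rep V E X Y"
  shows "\<And>v. v \<in> V \<Longrightarrow> compact (X v) \<and> path_connected (X v) \<and> X v \<noteq> {}"
    and "\<And>v w. v \<in> V \<Longrightarrow> w \<in> V \<Longrightarrow> v \<noteq> w \<Longrightarrow> X v \<inter> X w = {}"
    and "\<And>e. e \<in> E \<Longrightarrow> compact (Y e) \<and> path_connected (Y e)"
    and "\<And>e v. e \<in> E \<Longrightarrow> v \<in> V \<Longrightarrow> v \<in> e \<longleftrightarrow> Y e \<inter> X v \<noteq> {}"
    and "\<And>e e'. e \<in> E \<Longrightarrow> e' \<in> E \<Longrightarrow> e \<noteq> e' \<Longrightarrow> Y e \<inter> Y e' \<subseteq> \<Union>(X ` (e \<inter> e'))"
proof -
  note A = assms[unfolded loose_rep_def]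
  note 1 = A[THEN conjunct1] and 2 = A[THEN conjunct2, THEN conjunct1]
    and 3 = A[THEN conjunct2, THEN conjunct2, THEN conjunct1]
    and 4 = A[THEN conjunct2, THEN conjunct2, THEN conjunct2, THEN conjunct1]
    and 5 = A[THEN conjunct2, THEN conjunct2, THEN conjunct2, THEN conjunct2]
  show "\<And>v. v \<in> V \<Longrightarrow> compact (X v) \<and> path_connected (X v) \<and> X v \<noteq> {}"
    by (rule bspec[OF 1])
  show "\<And>v w. v \<in> V \<Longrightarrow> w \<in> V \<Longrightarrow> v \<noteq> w \<Longrightarrow> X v \<inter> X w = {}"
    by (rule 2[rule_format])
  show "\<And>e. e \<in> E \<Longrightarrow> compact (Y e) \<and> path_connected (Y e)"
    by (rule bspec[OF 3])
  show "\<And>e v. e \<in> E \<Longrightarrow> v \<in> V \<Longrightarrow> v \<in> e \<longleftrightarrow> Y e \<inter> X v \<noteq> {}"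
    by (rule 4[rule_format])
  show "\<And>e e'. e \<in> E \<Longrightarrow> e' \<in> E \<Longrightarrow> e \<noteq> e' \<Longrightarrow> Y e \<inter> Y e' \<subseteq> \<Union>(X ` (e \<inter> e'))"
    by (rule 5[THEN bspec, THEN bspec, THEN mp])
qed

lemma planar_imp_loose:
  assumes "planar V E" "finite V" "edges_on V E"
  shows "loose V E"
proof -
  obtain pos :: "nat \<Rightarrow> complex" and \<gamma> where H: "inj_on pos V \<and>
     (\<forall>e\<in>E. arc (\<gamma> e) \<and> {pathstart (\<gamma> e), pathfinish (\<gamma> e)} = pos ` e) \<and>
     (\<forall>e\<in>E. \<forall>v\<in>V. pos v \<in> path_image (\<gamma> e) \<longrightarrow> v \<in> e) \<and>
     (\<forall>e\<in>E. \<forall>e'\<in>E. e \<noteq> e' \<longrightarrow> path_image (\<gamma> e) \<inter> path_image (\<gamma> e') \<subseteq> pos ` (e \<inter> e'))"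
    using assms(1)[unfolded planar_def] by (elim exE) (rule that)
  note inj = H[THEN conjunct1] and ar = H[THEN conjunct2, THEN conjunct1]
    and v = H[THEN conjunct2, THEN conjunct2, THEN conjunct1]
    and i = H[THEN conjunct2, THEN conjunct2, THEN conjunct2]
  have iff: "v \<in> e \<longleftrightarrow> path_image (\<gamma> e) \<inter> {pos v} \<noteq> {}" if "e \<in> E" "v \<in> V" for e v
  proof -
    have "pos ` e \<subseteq> path_image (\<gamma> e)"
      using ar[rule_format, OF that(1)] pathstart_in_path_image[of "\<gamma> e"] pathfinish_in_path_image[of "\<gamma> e"]
      by (metis empty_subsetI insert_subset)
    then have "pos v \<in> path_image (\<gamma> e)" if "v \<in> e" using that by blast
    then show ?thesis using v that by blast
  qed
  show ?thesis unfolding loose_def loose_rep_def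
  proof (intro conjI exI[of _ "\<lambda>v. {pos v}"] exI[of _ "\<lambda>e. path_image (\<gamma> e)"] ballI impI)
    fix e e' assume "e \<in> E" "e' \<in> E" "e \<noteq> e'"
    then show "path_image (\<gamma> e) \<inter> path_image (\<gamma> e') \<subseteq> (\<Union>v\<in>e \<inter> e'. {pos v})" using i by blast
  next
    fix e assume "e \<in> E"
    then show "compact (path_image (\<gamma> e))" "path_connected (path_image (\<gamma> e))"
      using ar compact_arc_image arc_imp_path path_connected_path_image by blast+
  next
    fix e v assume "e \<in> E" "v \<in> V"
    then show "v \<in> e \<longleftrightarrow> path_image (\<gamma> e) \<inter> {pos v} \<noteq> {}" by (rule iff)
  qed (use assms inj in \<open>auto dest: inj_onD\<close>)
qed

lemma loose_subgraph:
  assumes "loose V E" "V' \<subseteq> V" "E' \<subseteq> E" "edges_on V' E'"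
  shows "loose V' E'"
proof -
  obtain X Y where *: "loose_rep V E X Y"
    using assms(1) unfolding loose_def by blast
  have "loose_rep V' E' X Y" using assms(2,3) * unfolding loose_rep_def by (meson subset_iff)
  moreover have "finite V'" using assms(1,2) finite_subset unfolding loose_def by auto
  ultimately show ?thesis using assms(4) unfolding loose_def by blast
qed

text \<open>Each edge set is trimmed to an arc that meets the two vertex sets only in its ends; inside a
  vertex set the three ends are joined to a common centre.\<close>

lemma no_loose_K33:
  fixes a b :: "nat \<Rightarrow> 'a"
  assumes loose: "loose V E" and E: "\<And>i j. i < 3 \<Longrightarrow> j < 3 \<Longrightarrow> {a i, b j} \<in> E"
    and inj: "inj_on a {..<3}" "inj_on b {..<3}" "a ` {..<3} \<inter> b ` {..<3} = {}"
  shows False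
proof -
  obtain X Y where "loose_rep V E X Y" using loose unfolding loose_def by blast
  note X = loose_repD(1)[OF this] and disj = loose_repD(2)[OF this] and Y = loose_repD(3)[OF this]
    and XY = loose_repD(4)[OF this] and YY = loose_repD(5)[OF this]
  have eo: "edges_on V E" using loose unfolding loose_def by auto
  have aV: "a i \<in> V" if "i < 3" for i using edges_on_subset[OF eo E[OF that that]] by simp
  have bV: "b i \<in> V" if "i < 3" for i using edges_on_subset[OF eo E[OF that that]] by simp
  have ab: "a i \<noteq> b j" if "i < 3" "j < 3" for i j using inj(3) that by blast
  have aa: "a i = a i' \<longleftrightarrow> i = i'" "b i = b i' \<longleftrightarrow> i = i'" if "i < 3" "i' < 3" for i i'
    using inj_onD[OF inj(1), of i i'] inj_onD[OF inj(2), of i i'] that by auto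
  have "\<exists>Z p q. Z \<subseteq> Y {a i, b j} \<and> arc_set Z p q \<and> Z \<inter> X (a i) = {p} \<and> Z \<inter> X (b j) = {q}"
    if ij: "i < 3" "j < 3" for i j
  proof -
    note e = E[OF ij]
    have "Y {a i, b j} \<inter> X (a i) \<noteq> {}" "Y {a i, b j} \<inter> X (b j) \<noteq> {}"
      using XY[OF e aV[OF ij(1)]] XY[OF e bV[OF ij(2)]] by blast+
    moreover have "closed (X (a i))" "closed (X (b j))"
      using X[OF aV[OF ij(1)]] X[OF bV[OF ij(2)]] compact_imp_closed by blast+
    moreover have "X (a i) \<inter> X (b j) = {}"
      using disj[OF aV[OF ij(1)] bV[OF ij(2)] ab[OF ij]] .
    ultimately show ?thesis
      using arc_set_between[OF conjunct2[OF Y[OF e]], of "X (a i)" "X (b j)"] by metis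
  qed
  then obtain Z p q where
    Z: "\<And>i j. i < 3 \<Longrightarrow> j < 3 \<Longrightarrow> Z i j \<subseteq> Y {a i, b j} \<and> arc_set (Z i j) (p i j) (q i j) \<and>
      Z i j \<inter> X (a i) = {p i j} \<and> Z i j \<inter> X (b j) = {q i j}"
    by metis
  have "\<exists>c L. (\<forall>j<3. path_connected (L j) \<and> L j \<subseteq> X (a i) \<and> c \<in> L j \<and> p i j \<in> L j) \<and>
    (\<forall>j<3. \<forall>j'<3. j \<noteq> j' \<longrightarrow> L j \<inter> L j' \<subseteq> {c})" if "i < 3" for i
  proof -
    have "p i j \<in> X (a i)" if "j < 3" for j using Z[OF \<open>i < 3\<close> that] by blast
    then show ?thesis using tripod[of "X (a i)" "p i"] X[OF aV[OF that]] by metis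
  qed
  then obtain c L where
    L: "\<And>i j. i < 3 \<Longrightarrow> j < 3 \<Longrightarrow> path_connected (L i j) \<and> L i j \<subseteq> X (a i) \<and> c i \<in> L i j \<and> p i j \<in> L i j"
    and LL: "\<And>i j j'. i < 3 \<Longrightarrow> j < 3 \<Longrightarrow> j' < 3 \<Longrightarrow> j \<noteq> j' \<Longrightarrow> L i j \<inter> L i j' \<subseteq> {c i}"
    by metis
  have "\<exists>d M. (\<forall>i<3. path_connected (M i) \<and> M i \<subseteq> X (b j) \<and> d \<in> M i \<and> q i j \<in> M i) \<and>
    (\<forall>i<3. \<forall>i'<3. i \<noteq> i' \<longrightarrow> M i \<inter> M i' \<subseteq> {d})" if "j < 3" for j
  proof -
    have "q i j \<in> X (b j)" if "i < 3" for i using Z[OF that \<open>j < 3\<close>] by blast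
    then show ?thesis using tripod[of "X (b j)" "\<lambda>i. q i j"] X[OF bV[OF that]] by metis
  qed
  then obtain d M' where M':
    "\<And>j. j < 3 \<Longrightarrow> (\<forall>i<3. path_connected (M' j i) \<and> M' j i \<subseteq> X (b j) \<and> d j \<in> M' j i \<and> q i j \<in> M' j i) \<and>
      (\<forall>i<3. \<forall>i'<3. i \<noteq> i' \<longrightarrow> M' j i \<inter> M' j i' \<subseteq> {d j})"
    by metis
  define M where "M = (\<lambda>i j. M' j i)"
  have
    M: "\<And>i j. i < 3 \<Longrightarrow> j < 3 \<Longrightarrow> path_connected (M i j) \<and> M i j \<subseteq> X (b j) \<and> d j \<in> M i j \<and> q i j \<in> M i j"
    and MM: "\<And>i i' j. i < 3 \<Longrightarrow> j < 3 \<Longrightarrow> i' < 3 \<Longrightarrow> i \<noteq> i' \<Longrightarrow> M i j \<inter> M i' j \<subseteq> {d j}"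
    unfolding M_def using M' by meson+
  \<comment> \<open>Each edge of the drawing will be an arc inside the union of a leg, a trimmed
    edge and another leg. It is therefore enough that distinct sets \<open>W\<close> meet only in
    common centres, which is checked below for each pair of pieces.\<close>
  define W where "W = (\<lambda>i j. L i j \<union> Z i j \<union> M i j)"
  have cX: "c i \<in> X (a i)" "d i \<in> X (b i)" if "i < 3" for i using L[OF that that] M[OF that that] by blast+
  have cd: "c i \<noteq> d j" if "i < 3" "j < 3" for i j
  proof
    assume "c i = d j"
    then have "c i \<in> X (a i) \<inter> X (b j)" using cX(1)[OF that(1)] cX(2)[OF that(2)] by simp
    then show False using disj[OF aV[OF that(1)] bV[OF that(2)] ab[OF that]] by simp
  qed
  have "\<exists>S \<subseteq> W i j. arc_set S (c i) (d j)" if ij: "i < 3" "j < 3" for i j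
  proof -
    have pq: "p i j \<in> Z i j" "q i j \<in> Z i j" using Z[OF ij] by auto
    have "path_connected (L i j \<union> Z i j)"
      using L[OF ij] Z[OF ij] pq by (intro path_connected_Un) (auto intro: arc_set_path_connected)
    then have W1: "path_connected (W i j)"
      unfolding W_def using M[OF ij] pq by (intro path_connected_Un[of "L i j \<union> Z i j"]) auto
    have W2: "c i \<in> W i j" "d j \<in> W i j" using L[OF ij] M[OF ij] by (auto simp: W_def)
    obtain A where "A \<subseteq> W i j" "arc_set A (c i) (d j)"
      by (rule path_connected_arc_set[OF W1 W2 cd[OF ij]])
    then show ?thesis by auto
  qed
  then obtain S where S: "\<And>i j. i < 3 \<Longrightarrow> j < 3 \<Longrightarrow> S i j \<subseteq> W i j \<and> arc_set (S i j) (c i) (d j)"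
    by metis
  have ZX: "Z i j \<inter> X v = {}" if "i < 3" "j < 3" "v \<in> V" "v \<noteq> a i" "v \<noteq> b j" for i j v
    using XY[OF E[OF that(1,2)] that(3)] that(4,5) Z[OF that(1,2)] by auto
  have XX: "v = w" if "x \<in> X v" "x \<in> X w" "v \<in> V" "w \<in> V" for v w x
    using disj[OF that(3,4)] that(1,2) by auto
  have LXa: "x \<in> X (a i)" if "x \<in> L i j" "i < 3" "j < 3" for i j x using L[OF that(2,3)] that(1) by auto
  have MXb: "x \<in> X (b j)" if "x \<in> M i j" "i < 3" "j < 3" for i j x using M[OF that(2,3)] that(1) by auto
  have LZ: "x = c i \<and> i = i'" if lt: "i < 3" "j < 3" "i' < 3" "j' < 3" and ne: "(i, j) \<noteq> (i', j')"
    and x: "x \<in> L i j" "x \<in> Z i' j'" for i j i' j' x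
  proof -
    have xa: "x \<in> X (a i)" by (rule LXa[OF x(1) lt(1,2)])
    then have "a i = a i' \<or> a i = b j'" using ZX[OF lt(3,4) aV[OF lt(1)]] x(2) by auto
    then have ii: "i = i'" using aa(1)[OF lt(1,3)] ab[OF lt(1,4)] by simp
    have "x \<in> Z i j' \<inter> X (a i)" using xa x(2) ii by simp
    then have "x = p i j'" using Z[OF lt(1,4)] by simp
    then have "x \<in> L i j'" using L[OF lt(1,4)] by simp
    moreover have "j \<noteq> j'" using ne ii by simp
    ultimately show ?thesis using LL[OF lt(1,2,4)] x(1) ii by auto
  qed
  have MZ: "x = d j \<and> j = j'" if lt: "i < 3" "j < 3" "i' < 3" "j' < 3" and ne: "(i, j) \<noteq> (i', j')"
    and x: "x \<in> M i j" "x \<in> Z i' j'" for i j i' j' x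
  proof -
    have xb: "x \<in> X (b j)" by (rule MXb[OF x(1) lt(1,2)])
    then have "b j = a i' \<or> b j = b j'" using ZX[OF lt(3,4) bV[OF lt(2)]] x(2) by auto
    then have jj: "j = j'" using aa(2)[OF lt(2,4)] ab[OF lt(3,2)] by simp
    have "x \<in> Z i' j \<inter> X (b j)" using xb x(2) jj by simp
    then have "x = q i' j" using Z[OF lt(3,2)] by simp
    then have "x \<in> M i' j" using M[OF lt(3,2)] by simp
    moreover have "i \<noteq> i'" using ne jj by simp
    ultimately show ?thesis using MM[OF lt(1,2,3)] x(1) jj by auto
  qed
  have LL': "x = c i \<and> i = i'" if lt: "i < 3" "j < 3" "i' < 3" "j' < 3" and ne: "(i, j) \<noteq> (i', j')"
    and x: "x \<in> L i j" "x \<in> L i' j'" for i j i' j' x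
  proof -
    have "a i = a i'" using XX[OF LXa[OF x(1) lt(1,2)] LXa[OF x(2) lt(3,4)] aV[OF lt(1)] aV[OF lt(3)]] .
    then have ii: "i = i'" using aa(1)[OF lt(1,3)] by simp
    then show ?thesis using LL[OF lt(1,2,4)] x ne by auto
  qed
  have MM': "x = d j \<and> j = j'" if lt: "i < 3" "j < 3" "i' < 3" "j' < 3" and ne: "(i, j) \<noteq> (i', j')"
    and x: "x \<in> M i j" "x \<in> M i' j'" for i j i' j' x
  proof -
    have "b j = b j'" using XX[OF MXb[OF x(1) lt(1,2)] MXb[OF x(2) lt(3,4)] bV[OF lt(2)] bV[OF lt(4)]] .
    then have jj: "j = j'" using aa(2)[OF lt(2,4)] by simp
    then show ?thesis using MM[OF lt(1,2,3)] x ne by auto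
  qed
  have LM: False if "x \<in> L i j" "x \<in> M i' j'" "i < 3" "j < 3" "i' < 3" "j' < 3" for i j i' j' x
    using XX[OF LXa[OF that(1,3,4)] MXb[OF that(2,5,6)] aV[OF that(3)] bV[OF that(6)]] ab[OF that(3,6)] by simp
  have ZZ: "x = c i \<and> i = i' \<or> x = d j \<and> j = j'"
    if lt: "i < 3" "j < 3" "i' < 3" "j' < 3" and ne: "(i, j) \<noteq> (i', j')"
    and xz: "x \<in> Z i j" "x \<in> Z i' j'" for i j i' j' x
  proof -
    have "{a i, b j} \<noteq> {a i', b j'}"
      using ne aa(1)[OF lt(1,3)] aa(2)[OF lt(2,4)] ab[OF lt(1,4)] by (auto simp: doubleton_eq_iff)
    moreover have "x \<in> Y {a i, b j}" "x \<in> Y {a i', b j'}"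
      using xz Z[OF lt(1,2)] Z[OF lt(3,4)] by auto
    ultimately have "x \<in> \<Union>(X ` ({a i, b j} \<inter> {a i', b j'}))"
      using YY[OF E[OF lt(1,2)] E[OF lt(3,4)]] by blast
    \<comment> \<open>The edge sets can meet only inside the vertex set of a common end, where each
      trimmed arc has a single point. That point lies on the legs of both edges, hence is the
      centre.\<close>
    then obtain v where v: "v \<in> {a i, b j}" "v \<in> {a i', b j'}" "x \<in> X v" by auto
    show ?thesis
    proof (cases "v = a i")
      case True
      then have ii: "i = i'" using v(2) aa(1)[OF lt(1,3)] ab[OF lt(1,4)] by auto
      have "x \<in> Z i j \<inter> X (a i)" "x \<in> Z i j' \<inter> X (a i)" using xz v(3) True ii by auto
      then have "x = p i j" "x = p i j'" using Z[OF lt(1,2)] Z[OF lt(1,4)] by auto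
      then have "x \<in> L i j \<inter> L i j'" using L[OF lt(1,2)] L[OF lt(1,4)] by simp
      then show ?thesis using LL[OF lt(1,2,4)] ii ne by auto
    next
      case False
      then have vb: "v = b j" using v(1) by simp
      then have jj: "j = j'" using v(2) aa(2)[OF lt(2,4)] ab[OF lt(3,2)] by auto
      have "x \<in> Z i j \<inter> X (b j)" "x \<in> Z i' j \<inter> X (b j)" using xz v(3) vb jj by auto
      then have "x = q i j" "x = q i' j" using Z[OF lt(1,2)] Z[OF lt(3,2)] by auto
      then have "x \<in> M i j \<inter> M i' j" using M[OF lt(1,2)] M[OF lt(3,2)] by simp
      then show ?thesis using MM[OF lt(1,2,3)] jj ne by auto
    qed
  qed
  have WW: "x = c i \<and> i = i' \<or> x = d j \<and> j = j'"
    if lt: "i < 3" "j < 3" "i' < 3" "j' < 3" and ne: "(i, j) \<noteq> (i', j')" and x: "x \<in> W i j" "x \<in> W i' j'"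
    for i j i' j' x
  proof -
    have ne': "(i', j') \<noteq> (i, j)" using ne by auto
    consider "x \<in> L i j" | "x \<in> Z i j" | "x \<in> M i j" using x(1) unfolding W_def by auto
    then show ?thesis
    proof cases
      case 1
      then show ?thesis
        using x(2) LL'[OF lt ne 1] LZ[OF lt ne 1] LM[OF 1 _ lt] unfolding W_def by auto
    next
      case 2
      then show ?thesis
        using x(2) ZZ[OF lt ne 2] LZ[OF lt(3,4,1,2) ne' _ 2] MZ[OF lt(3,4,1,2) ne' _ 2] unfolding W_def by auto
    next
      case 3
      then show ?thesis
        using x(2) MM'[OF lt ne 3] MZ[OF lt ne 3] LM[OF _ 3 lt(3,4,1,2)] unfolding W_def by auto
    qed
  qed
  show False
  proof (rule K33_not_in_plane[of S c d])
    show "arc_set (S i j) (c i) (d j)" if "i < 3" "j < 3" for i j using S[OF that] by simp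
    show "S i j \<inter> S i' j' \<subseteq> {x. i = i' \<and> x = c i \<or> j = j' \<and> x = d j}"
      if "i < 3" "j < 3" "i' < 3" "j' < 3" "(i, j) \<noteq> (i', j')" for i j i' j'
    proof
      fix x assume "x \<in> S i j \<inter> S i' j'"
      then have "x \<in> W i j" "x \<in> W i' j'" using S[OF that(1,2)] S[OF that(3,4)] by auto
      from WW[OF that this] show "x \<in> {x. i = i' \<and> x = c i \<or> j = j' \<and> x = d j}" by auto
    qed
    show "inj_on c {..<3}"
    proof (rule inj_onI)
      fix i i' assume "i \<in> {..<3::nat}" "i' \<in> {..<3}" and eq: "c i = c i'"
      then have lt: "i < 3" "i' < 3" by auto
      have "a i = a i'" using XX[OF cX(1)[OF lt(1)] _ aV[OF lt(1)] aV[OF lt(2)]] cX(1)[OF lt(2)] eq by simp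
      then show "i = i'" using aa(1)[OF lt] by simp
    qed
    show "inj_on d {..<3}"
    proof (rule inj_onI)
      fix i i' assume "i \<in> {..<3::nat}" "i' \<in> {..<3}" and eq: "d i = d i'"
      then have lt: "i < 3" "i' < 3" by auto
      have "b i = b i'" using XX[OF cX(2)[OF lt(1)] _ bV[OF lt(1)] bV[OF lt(2)]] cX(2)[OF lt(2)] eq by simp
      then show "i = i'" using aa(2)[OF lt] by simp
    qed
    show "c ` {..<3} \<inter> d ` {..<3} = {}" using cd by auto
  qed
qed

section \<open>Contraction of stars\<close>

definition contract :: "('a \<Rightarrow> 'a) \<Rightarrow> 'a set set \<Rightarrow> 'a set set" where
  "contract f E = {e'. \<exists>e\<in>E. e' = f ` e \<and> card e' = 2}"

lemma edges_on_contract: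
  assumes "edges_on V E"
  shows "edges_on (f ` V) (contract f E)"
  unfolding edges_on_def
proof
  fix e' assume "e' \<in> contract f E"
  then obtain e where e: "e \<in> E" "e' = f ` e" "card e' = 2" unfolding contract_def by blast
  then obtain u v where "u \<in> V" "v \<in> V" "e = {u, v}" using assms edges_onE by metis
  moreover then have "f u \<noteq> f v" using e by auto
  ultimately show "\<exists>u v. u \<in> f ` V \<and> v \<in> f ` V \<and> u \<noteq> v \<and> e' = {u, v}" using e(2) by auto
qed

text \<open>Each vertex moved by the idempotent \<open>f\<close> is adjacent to its image, so the
  fibres are stars. The new set of a centre is the union of the vertex sets of its star and of the
  edges to the centre. With stars a whole matching can be contracted in one step.\<close>

lemma loose_contract:
  assumes loose: "loose V E"
    and f: "\<And>u. u \<in> V \<Longrightarrow> f u \<in> V" "\<And>u. u \<in> V \<Longrightarrow> f (f u) = f u"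
      "\<And>u. u \<in> V \<Longrightarrow> f u \<noteq> u \<Longrightarrow> {u, f u} \<in> E"
  shows "loose (f ` V) (contract f E)"
proof -
  obtain X Y where "loose_rep V E X Y" using loose unfolding loose_def by blast
  note X = loose_repD(1)[OF this] and disj = loose_repD(2)[OF this] and Y = loose_repD(3)[OF this]
    and XY = loose_repD(4)[OF this] and YY = loose_repD(5)[OF this]
  have eo: "edges_on V E" and fin: "finite V" using loose unfolding loose_def by auto
  have eV: "e \<subseteq> V" if "e \<in> E" for e using edges_on_subset[OF eo that] .
  define U where "U = (\<lambda>v. {u \<in> V. f u = v \<and> u \<noteq> v})"
  define X' where "X' = (\<lambda>v. X v \<union> (\<Union>u\<in>U v. X u \<union> Y {u, v}))"
  have fv: "f v = v" if "v \<in> f ` V" for v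
  proof -
    obtain u where "u \<in> V" "v = f u" using \<open>v \<in> f ` V\<close> by (elim imageE)
    then show ?thesis using f(2)[of u] by simp
  qed
  have vV: "v \<in> V" if "v \<in> f ` V" for v
    using that f(1) by (elim imageE) simp
  have UE: "{u, v} \<in> E" if "u \<in> U v" for u v
  proof -
    have "u \<in> V" "f u = v" "u \<noteq> v" using that unfolding U_def by auto
    then show ?thesis using f(3)[of u] by auto
  qed
  have Xsub: "X u \<subseteq> X' (f u)" if "u \<in> V" for u
    using that unfolding X'_def U_def by (cases "f u = u") auto
  \<comment> \<open>Disjointness and incidence of the new sets follow from this: a point of
    \<open>X' v\<close> lies in the set of a vertex or of an edge that \<open>f\<close> sends
    entirely to \<open>v\<close>.\<close>
  have X'cases: "(\<exists>u\<in>V. f u = v \<and> x \<in> X u) \<or> (\<exists>e\<in>E. f ` e = {v} \<and> x \<in> Y e)"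
    if "x \<in> X' v" "v \<in> f ` V" for x v
  proof -
    have "f ` {u, v} = {v}" if "u \<in> U v" for u using that fv[OF \<open>v \<in> f ` V\<close>] by (auto simp: U_def)
    note fuv = this
    consider "x \<in> X v" | u where "u \<in> U v" "x \<in> X u" | u where "u \<in> U v" "x \<in> Y {u, v}"
      using \<open>x \<in> X' v\<close> unfolding X'_def by auto
    then show ?thesis
    proof cases
      case 1
      then show ?thesis using fv[OF that(2)] vV[OF that(2)] by metis
    next
      case 2
      then have "u \<in> V" "f u = v" by (auto simp: U_def)
      then show ?thesis using 2 by metis
    next
      case 3
      then show ?thesis using fuv UE by metis
    qed
  qed
  have YX: "f u \<in> f ` e" if "e \<in> E" "u \<in> V" "x \<in> Y e" "x \<in> X u" for e u x
    using XY[OF that(1,2)] that(3,4) by auto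
  have YYf: "f ` e \<inter> f ` e' \<noteq> {}" if "e \<in> E" "e' \<in> E" "x \<in> Y e" "x \<in> Y e'" for e e' x
  proof (cases "e = e'")
    case True
    then show ?thesis using edges_on_nonempty[OF eo that(2)] by simp
  next
    case False
    then show ?thesis using YY[OF that(1,2)] that by blast
  qed
  \<comment> \<open>Several edges may have the same image; one of them represents it.\<close>
  define g where "g = (\<lambda>e'. SOME e. e \<in> E \<and> e' = f ` e)"
  have g: "g e' \<in> E \<and> e' = f ` g e'" if "e' \<in> contract f E" for e'
    unfolding g_def by (rule someI_ex) (use that in \<open>auto simp: contract_def\<close>)
  have ne: "f ` e \<noteq> {v}" if "f ` e \<in> contract f E" for e v
    using that unfolding contract_def by auto
  have c1: "compact (X' v) \<and> path_connected (X' v) \<and> X' v \<noteq> {}" if v: "v \<in> f ` V" for v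
  proof (intro conjI)
    show "compact (X' v)"
      unfolding X'_def using X Y UE vV[OF v] fin
      by (intro compact_Un compact_UN) (auto simp: U_def)
    show "X' v \<noteq> {}" using X vV[OF v] by (auto simp: X'_def)
    obtain x where x: "x \<in> X v" using X vV[OF v] by blast
    have "path_component (X' v) x y" if yX: "y \<in> X' v" for y
    proof -
      have *: "path_component (X' v) x y"
        if u: "u \<in> U v" and y: "y \<in> X v \<union> Y {u, v} \<union> X u" for u
      proof -
        have "Y {u, v} \<inter> X v \<noteq> {}" "Y {u, v} \<inter> X u \<noteq> {}"
          using XY[OF UE[OF u], of v] XY[OF UE[OF u], of u] vV[OF v] u by (auto simp: U_def)
        moreover have "path_connected (X u)" "path_connected (X v)" "path_connected (Y {u, v})"
          using X[of u] X[of v] Y[OF UE[OF u]] vV[OF v] u by (auto simp: U_def)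
        ultimately have "path_connected (X v \<union> Y {u, v} \<union> X u)"
          by (intro path_connected_Un) auto
        then have "path_component (X v \<union> Y {u, v} \<union> X u) x y"
          using x y unfolding path_connected_component by simp
        then show ?thesis
          by (rule path_component_of_subset[rotated]) (use u in \<open>auto simp: X'_def\<close>)
      qed
      show ?thesis
      proof (cases "y \<in> X v")
        case True
        then have "path_component (X v) x y"
          using x X[OF vV[OF v]] unfolding path_connected_component by simp
        then show ?thesis
          by (rule path_component_of_subset[rotated]) (auto simp: X'_def)
      next
        case False
        then obtain u where "u \<in> U v" "y \<in> X v \<union> Y {u, v} \<union> X u"
          using yX unfolding X'_def by auto
        then show ?thesis by (rule *)
      qed
    qed
    then show "path_connected (X' v)"
      unfolding path_connected_component by (meson path_component_sym path_component_trans)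
  qed
  have c2: "X' v \<inter> X' w = {}" if vw: "v \<in> f ` V" "w \<in> f ` V" "v \<noteq> w" for v w
  proof (rule ccontr)
    assume "X' v \<inter> X' w \<noteq> {}"
    then obtain x where x: "x \<in> X' v" "x \<in> X' w" by auto
    from X'cases[OF x(1) vw(1)] show False
    proof (elim disjE bexE conjE)
      fix u assume u: "u \<in> V" "f u = v" "x \<in> X u"
      from X'cases[OF x(2) vw(2)] show False
      proof (elim disjE bexE conjE)
        fix u' assume u': "u' \<in> V" "f u' = w" "x \<in> X u'"
        then show False using disj[OF u(1) u'(1)] u vw(3) by auto
      next
        fix e assume "e \<in> E" "f ` e = {w}" "x \<in> Y e"
        then show False using YX[OF _ u(1) _ u(3), of e] u(2) vw(3) by simp
      qed
    next
      fix e assume e: "e \<in> E" "f ` e = {v}" "x \<in> Y e"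
      from X'cases[OF x(2) vw(2)] show False
      proof (elim disjE bexE conjE)
        fix u assume "u \<in> V" "f u = w" "x \<in> X u"
        then show False using YX[OF e(1) _ e(3), of u] e(2) vw(3) by simp
      next
        fix e' assume "e' \<in> E" "f ` e' = {w}" "x \<in> Y e'"
        then show False using YYf[OF e(1) _ e(3), of e'] e(2) vw(3) by simp
      qed
    qed
  qed
  have gE: "g e' \<in> E" and gf: "f ` g e' = e'" if "e' \<in> contract f E" for e'
    using g[OF that] by auto
  have c3: "v \<in> e' \<longleftrightarrow> Y (g e') \<inter> X' v \<noteq> {}" if e': "e' \<in> contract f E" and v: "v \<in> f ` V" for e' v
  proof
    assume "v \<in> e'"
    then have "v \<in> f ` g e'" using gf[OF e'] by simp
    then obtain u where u: "u \<in> g e'" "f u = v" by auto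
    then have uV: "u \<in> V" using eV[OF gE[OF e']] by auto
    then show "Y (g e') \<inter> X' v \<noteq> {}"
      using XY[OF gE[OF e'] uV] u Xsub[OF uV] by auto
  next
    assume "Y (g e') \<inter> X' v \<noteq> {}"
    then obtain x where x: "x \<in> Y (g e')" "x \<in> X' v" by auto
    from X'cases[OF x(2) v] show "v \<in> e'"
    proof (elim disjE bexE conjE)
      fix u assume "u \<in> V" "f u = v" "x \<in> X u"
      then show ?thesis using YX[OF gE[OF e'] _ x(1), of u] gf[OF e'] by simp
    next
      fix e assume "e \<in> E" "f ` e = {v}" "x \<in> Y e"
      then show ?thesis using YYf[OF gE[OF e'] _ x(1), of e] gf[OF e'] by simp
    qed
  qed
  have c4: "Y (g e1) \<inter> Y (g e2) \<subseteq> \<Union>(X' ` (e1 \<inter> e2))"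
    if e: "e1 \<in> contract f E" "e2 \<in> contract f E" "e1 \<noteq> e2" for e1 e2
  proof
    fix x assume x: "x \<in> Y (g e1) \<inter> Y (g e2)"
    have "g e1 \<noteq> g e2"
    proof
      assume "g e1 = g e2"
      then have "f ` g e1 = f ` g e2" by (rule arg_cong)
      then show False using e(3) unfolding gf[OF e(1)] gf[OF e(2)] by (rule notE[rotated])
    qed
    from subsetD[OF YY[OF gE[OF e(1)] gE[OF e(2)] this] x]
    obtain u where u: "u \<in> g e1" "u \<in> g e2" "x \<in> X u" by auto
    have uV: "u \<in> V" by (rule subsetD[OF eV[OF gE[OF e(1)]] u(1)])
    have "x \<in> X' (f u)" by (rule subsetD[OF Xsub[OF uV] u(3)])
    moreover have "f u \<in> e1 \<inter> e2"
      using imageI[OF u(1), of f] imageI[OF u(2), of f] gf[OF e(1)] gf[OF e(2)] by simp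
    ultimately show "x \<in> \<Union>(X' ` (e1 \<inter> e2))" by (intro UN_I)
  qed
  have "loose_rep (f ` V) (contract f E) X' (\<lambda>e. Y (g e))"
    unfolding loose_rep_def
    by (intro conjI ballI impI c1 c2 c3 c4 Y gE conjunct1[OF c1] conjunct1[OF Y] conjunct2[OF Y] conjunct1[OF conjunct2[OF c1]] conjunct2[OF conjunct2[OF c1]])
  then show ?thesis
    unfolding loose_def using fin edges_on_contract[OF eo] by auto
qed

section \<open>Number of edges\<close>

definition merge :: "'a \<Rightarrow> 'a \<Rightarrow> 'a \<Rightarrow> 'a" where
  "merge u v x = (if x = u then v else x)"

definition common_nbrs :: "'a set set \<Rightarrow> 'a \<Rightarrow> 'a \<Rightarrow> 'a set" where
  "common_nbrs E u v = {w. {u, w} \<in> E \<and> {v, w} \<in> E}"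

lemma edges_on_finite: "edges_on V E \<Longrightarrow> finite V \<Longrightarrow> finite E"
  by (rule finite_subset[of _ "Pow V"]) (auto dest: edges_on_subset)

lemma edges_on_pair: "edges_on V E \<Longrightarrow> {u, v} \<in> E \<Longrightarrow> u \<in> V \<and> v \<in> V \<and> u \<noteq> v"
  by (erule (1) edges_onE) (auto simp: doubleton_eq_iff)

lemma edges_on_card2: "edges_on V E \<Longrightarrow> e \<in> E \<Longrightarrow> card e = 2"
  by (erule (1) edges_onE) simp

lemma common_nbrs_subset: "edges_on V E \<Longrightarrow> common_nbrs E u v \<subseteq> V - {u, v}"
  unfolding common_nbrs_def using edges_on_pair by fastforce

text \<open>The contraction loses \<open>{u, v}\<close> itself and, for each common neighbour, one
  of two edges that become parallel. \<open>B\<close> collects the lost edges, and the contraction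
  is injective on the others.\<close>

lemma card_contract_merge:
  assumes eo: "edges_on V E" and fin: "finite V" and uv: "{u, v} \<in> E"
  shows "card E \<le> card (contract (merge u v) E) + card (common_nbrs E u v) + 1"
proof -
  let ?f = "merge u v"
  define B where "B = insert {u, v} ((\<lambda>w. {u, w}) ` common_nbrs E u v)"
  have finE: "finite E" by (rule edges_on_finite[OF eo fin])
  have fcn: "finite (common_nbrs E u v)"
    using common_nbrs_subset[OF eo] fin finite_subset by fastforce
  have cB: "card B \<le> card (common_nbrs E u v) + 1"
    unfolding B_def using card_insert_le_m1 card_image_le[OF fcn, of "\<lambda>w. {u, w}"]
    by (simp add: card_insert_if fcn)
  have uv': "u \<noteq> v" using edges_on_pair[OF eo uv] by simp
  have nou: "?f ` e = e" if "u \<notin> e" for e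
    using that by (auto simp: merge_def image_iff)
  have isu: "\<exists>w. e = {u, w} \<and> w \<noteq> u \<and> w \<noteq> v \<and> ?f ` e = {v, w} \<and> {v, w} \<notin> E"
    if e: "e \<in> E - B" "u \<in> e" for e
  proof -
    have "e \<in> E" using e by simp
    then obtain x y where xy: "x \<noteq> y" "e = {x, y}" by (rule edges_onE[OF eo])
    then obtain w where w: "e = {u, w}" "w \<noteq> u" using e(2) by auto
    have "w \<noteq> v" using e(1) w(1) by (auto simp: B_def)
    moreover have "{v, w} \<notin> E" using e(1) w(1) by (auto simp: B_def common_nbrs_def)
    moreover have "?f ` e = {v, w}" using w by (simp add: merge_def insert_commute)
    ultimately show ?thesis using w by auto
  qed
  have "inj_on ((`) ?f) (E - B)"
  proof (rule inj_onI)
    fix e1 e2 assume e: "e1 \<in> E - B" "e2 \<in> E - B" "?f ` e1 = ?f ` e2"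
    show "e1 = e2"
    proof (cases "u \<in> e1")
      case True
      then obtain w where w: "e1 = {u, w}" "w \<noteq> u" "w \<noteq> v" "?f ` e1 = {v, w}" "{v, w} \<notin> E"
        using isu[OF e(1)] by auto
      show ?thesis
      proof (cases "u \<in> e2")
        case True
        then obtain w' where "e2 = {u, w'}" "w' \<noteq> v" "?f ` e2 = {v, w'}" using isu[OF e(2)] by auto
        then show ?thesis using w e(3) by (auto simp: doubleton_eq_iff)
      next
        case False
        then have "{v, w} = e2" using nou[OF False] w(4) e(3) by simp
        then show ?thesis using w(5) e(2) by simp
      qed
    next
      case False
      note F1 = this
      show ?thesis
      proof (cases "u \<in> e2")
        case True
        then obtain w' where "?f ` e2 = {v, w'}" "{v, w'} \<notin> E" using isu[OF e(2)] by auto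
        then show ?thesis using nou[OF F1] e by simp
      next
        case False
        then show ?thesis using e(3) unfolding nou[OF F1] nou[OF False] by simp
      qed
    qed
  qed
  moreover have "(`) ?f ` (E - B) \<subseteq> contract ?f E"
  proof
    fix e' assume "e' \<in> (`) ?f ` (E - B)"
    then obtain e where e: "e \<in> E - B" "e' = ?f ` e" by auto
    have "card e' = 2"
    proof (cases "u \<in> e")
      case True
      then show ?thesis using isu[OF e(1)] e(2) by auto
    next
      case False
      then show ?thesis using nou[OF False] e edges_on_card2[OF eo, of e] by simp
    qed
    then show "e' \<in> contract ?f E" using e unfolding contract_def by (intro CollectI bexI[of _ e] conjI) auto
  qed
  moreover have "finite (contract ?f E)"
    using edges_on_finite[OF edges_on_contract[OF eo]] fin by auto
  ultimately have "card (E - B) \<le> card (contract ?f E)"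
    using card_image[of "(`) ?f" "E - B"] card_mono[of "contract ?f E" "(`) ?f ` (E - B)"] by linarith
  moreover have "card E \<le> card (E - B) + card B"
    using diff_card_le_card_Diff[of B E] fcn by (simp add: B_def)
  ultimately show ?thesis using cB by simp
qed

text \<open>Contracting an edge whose ends have fewer than \<open>c\<close> common neighbours
  removes one vertex and at most \<open>c\<close> edges, so the density \<open>c\<close> is kept; as
  vertices run out, this must stop. The predicate \<open>P\<close> is abstract because the lemma is
  applied to loose graphs and again to neighbourhoods with a fixed apex.\<close>

lemma dense_contains_minor_with_many_triangles:
  fixes P :: "'a set \<Rightarrow> 'a set set \<Rightarrow> bool"
  assumes P: "\<And>V E. P V E \<Longrightarrow> finite V \<and> edges_on V E"
    and contr: "\<And>V E u v. P V E \<Longrightarrow> {u, v} \<in> E \<Longrightarrow> P (V - {u}) (contract (merge u v) E)"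
    and c: "0 < c"
  shows "P V E \<Longrightarrow> V \<noteq> {} \<Longrightarrow> c * card V \<le> card E \<Longrightarrow>
    \<exists>V' E'. P V' E' \<and> E' \<noteq> {} \<and> (\<forall>u v. {u, v} \<in> E' \<longrightarrow> c \<le> card (common_nbrs E' u v))"
proof (induction "card V" arbitrary: V E rule: less_induct)
  case less
  have fin: "finite V" and eo: "edges_on V E" using P[OF less.prems(1)] by auto
  show ?case
  proof (cases "\<forall>u v. {u, v} \<in> E \<longrightarrow> c \<le> card (common_nbrs E u v)")
    case True
    have "0 < card V" using less.prems(2) fin by (simp add: card_gt_0_iff)
    then have "0 < card E" using less.prems(3) c by (metis mult_pos_pos order_less_le_trans)
    then have "E \<noteq> {}" by auto
    then show ?thesis using True less.prems(1) by auto
  next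
    case False
    then obtain u v where uv: "{u, v} \<in> E" "card (common_nbrs E u v) < c" by (auto simp: not_le)
    have m: "u \<in> V" "v \<in> V" "u \<noteq> v" using edges_on_pair[OF eo uv(1)] by auto
    have cd: "card (V - {u}) = card V - 1" "0 < card V" using m fin by (auto simp: card_gt_0_iff)
    have "c * card V = c * card (V - {u}) + c"
      using cd by (cases "card V") (auto simp: algebra_simps)
    then have "c * card (V - {u}) \<le> card (contract (merge u v) E)"
      using card_contract_merge[OF eo fin uv(1)] uv(2) less.prems(3) by linarith
    moreover have "V - {u} \<noteq> {}" using m by auto
    ultimately show ?thesis
      using less.hyps[OF _ contr[OF less.prems(1) uv(1)]] cd by simp
  qed
qed

lemma loose_finite: "loose V E \<Longrightarrow> finite V" and loose_edges_on: "loose V E \<Longrightarrow> edges_on V E"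
  unfolding loose_def by auto

lemma loose_contract_merge:
  assumes "loose V E" "{u, v} \<in> E"
  shows "loose (V - {u}) (contract (merge u v) E)"
proof -
  have uv: "u \<in> V" "v \<in> V" "u \<noteq> v" using edges_on_pair[OF loose_edges_on[OF assms(1)] assms(2)] by auto
  have "merge u v ` V = V - {u}" using uv by (auto simp: merge_def image_iff)
  moreover have "loose (merge u v ` V) (contract (merge u v) E)"
    by (rule loose_contract[OF assms(1)]) (use uv assms(2) in \<open>auto simp: merge_def split: if_splits\<close>)
  ultimately show ?thesis by simp
qed

lemma handshake:
  assumes "edges_on V E" "finite V"
  shows "(\<Sum>x\<in>V. card {e \<in> E. x \<in> e}) = 2 * card E"
proof -
  have finE: "finite E" by (rule edges_on_finite[OF assms])
  have "(\<Sum>x\<in>V. card {e \<in> E. x \<in> e}) = (\<Sum>x\<in>V. \<Sum>e\<in>E. if x \<in> e then 1 else 0)"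
    by (rule sum.cong[OF refl]) (simp only: card_eq_sum sum.inter_filter[OF finE])
  also have "\<dots> = (\<Sum>e\<in>E. \<Sum>x\<in>V. if x \<in> e then 1 else 0)" by (rule sum.swap)
  also have "\<dots> = (\<Sum>e\<in>E. 2)"
  proof (rule sum.cong[OF refl])
    fix e assume e: "e \<in> E"
    have Ve: "{x \<in> V. x \<in> e} = e" using edges_on_subset[OF assms(1) e] by auto
    have "(\<Sum>x\<in>V. if x \<in> e then 1 else 0) = card {x \<in> V. x \<in> e}"
      by (simp only: card_eq_sum sum.inter_filter[OF assms(2)])
    then show "(\<Sum>x\<in>V. if x \<in> e then 1 else 0) = (2::nat)"
      unfolding Ve edges_on_card2[OF assms(1) e] .
  qed
  finally show ?thesis by simp
qed

lemma card_incident: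
  assumes "edges_on V E"
  shows "card {e \<in> E. x \<in> e} = card {y. {x, y} \<in> E}"
proof -
  have "{e \<in> E. x \<in> e} = (\<lambda>y. {x, y}) ` {y. {x, y} \<in> E}"
  proof
    show "{e \<in> E. x \<in> e} \<subseteq> (\<lambda>y. {x, y}) ` {y. {x, y} \<in> E}"
    proof
      fix e assume "e \<in> {e \<in> E. x \<in> e}"
      then have e: "e \<in> E" "x \<in> e" by auto
      obtain u v where "e = {u, v}" by (rule edges_onE[OF assms e(1)])
      then obtain y where "e = {x, y}" using e(2) by auto
      then show "e \<in> (\<lambda>y. {x, y}) ` {y. {x, y} \<in> E}" using e(1) by auto
    qed
  qed auto
  moreover have "inj_on (\<lambda>y. {x, y}) {y. {x, y} \<in> E}" by (auto simp: inj_on_def doubleton_eq_iff)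
  ultimately show ?thesis by (simp add: card_image)
qed

text \<open>Contractions inside the neighbourhood of \<open>v\<close> must not lose the adjacency to
  \<open>v\<close>; the predicate carries the apex along.\<close>

definition cone_loose :: "'a \<Rightarrow> 'a set \<Rightarrow> 'a set set \<Rightarrow> bool" where
  "cone_loose v V E \<longleftrightarrow> edges_on V E \<and> v \<notin> V \<and> loose (insert v V) (E \<union> (\<lambda>x. {v, x}) ` V)"

lemma cone_loose_contract:
  assumes "cone_loose v V E" "{r, a} \<in> E"
  shows "cone_loose v (V - {r}) (contract (merge r a) E)"
proof -
  have eo: "edges_on V E" and v: "v \<notin> V" and l: "loose (insert v V) (E \<union> (\<lambda>x. {v, x}) ` V)"
    using assms(1) unfolding cone_loose_def by auto
  have ra: "r \<in> V" "a \<in> V" "r \<noteq> a" using edges_on_pair[OF eo assms(2)] by auto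
  have im: "merge r a ` V = V - {r}" using ra by (auto simp: merge_def image_iff)
  have eo': "edges_on (V - {r}) (contract (merge r a) E)"
    using edges_on_contract[OF eo, of "merge r a"] im by simp
  have 1: "loose (insert v V - {r}) (contract (merge r a) (E \<union> (\<lambda>x. {v, x}) ` V))"
    by (rule loose_contract_merge[OF l]) (use assms(2) in simp)
  have vr: "v \<noteq> r" using v ra by auto
  have "loose (insert v (V - {r})) (contract (merge r a) E \<union> (\<lambda>x. {v, x}) ` (V - {r}))"
  proof (rule loose_subgraph[OF 1])
    show "insert v (V - {r}) \<subseteq> insert v V - {r}" using vr by auto
    show "contract (merge r a) E \<union> (\<lambda>x. {v, x}) ` (V - {r})
      \<subseteq> contract (merge r a) (E \<union> (\<lambda>x. {v, x}) ` V)"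
    proof
      fix e assume "e \<in> contract (merge r a) E \<union> (\<lambda>x. {v, x}) ` (V - {r})"
      then consider "e \<in> contract (merge r a) E" | x where "x \<in> V - {r}" "e = {v, x}" by auto
      then show "e \<in> contract (merge r a) (E \<union> (\<lambda>x. {v, x}) ` V)"
      proof cases
        case 1
        then show ?thesis unfolding contract_def by auto
      next
        case 2
        moreover have "v \<noteq> x" using 2 v by auto
        ultimately have "e = merge r a ` {v, x}" "card e = 2" using vr by (auto simp: merge_def)
        then show ?thesis
          unfolding contract_def by (intro CollectI bexI[of _ "{v, x}"] conjI) (use 2(1) in auto)
      qed
    qed
    show "edges_on (insert v (V - {r})) (contract (merge r a) E \<union> (\<lambda>x. {v, x}) ` (V - {r}))"
      using eo' v unfolding edges_on_def by fastforce
  qed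
  then show ?thesis unfolding cone_loose_def using eo' v by auto
qed

text \<open>The constant is dictated by the second round of contractions. That round needs density 3
  to end with an edge that has 3 common neighbours, hence minimum degree 6 in the neighbourhood of
  some \<open>v\<close>, hence 6 triangles on each edge at \<open>v\<close> after the first
  round.\<close>

theorem loose_card_edges:
  fixes V :: "'a set"
  assumes l: "loose V E" and ne: "V \<noteq> {}"
  shows "card E < 6 * card V"
proof (rule ccontr)
  assume "\<not> card E < 6 * card V"
  then have le6: "6 * card V \<le> card E" by simp
  have "\<exists>(V' :: 'a set) E'. loose V' E' \<and> E' \<noteq> {} \<and> (\<forall>u v. {u, v} \<in> E' \<longrightarrow> 6 \<le> card (common_nbrs E' u v))"
    by (rule dense_contains_minor_with_many_triangles[where P = loose, OF _ _ _ l ne le6])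
      (auto intro: loose_finite loose_edges_on loose_contract_merge)
  then obtain V1 :: "'a set" and E1 where l1: "loose V1 E1" "E1 \<noteq> {}"
    and t1: "\<And>u v. {u, v} \<in> E1 \<Longrightarrow> 6 \<le> card (common_nbrs E1 u v)"
    by auto
  have eo1: "edges_on V1 E1" and f1: "finite V1" using l1 loose_edges_on loose_finite by auto
  obtain e where e: "e \<in> E1" using l1(2) by auto
  obtain v w where vw: "e = {v, w}" by (rule edges_onE[OF eo1 e])
  define N where "N = {x. {v, x} \<in> E1}"
  define EN where "EN = {e \<in> E1. e \<subseteq> N}"
  have NV: "N \<subseteq> V1" "v \<notin> N" "v \<in> V1"
    using edges_on_pair[OF eo1, of v] edges_on_pair[OF eo1, of v w] edges_on_pair[OF eo1, of v v] e vw
    unfolding N_def by auto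
  have fN: "finite N" using NV(1) f1 finite_subset by auto
  have wN: "w \<in> N" using e vw by (simp add: N_def)
  have eoN: "edges_on N EN"
    unfolding edges_on_def
  proof
    fix e assume e: "e \<in> EN"
    then have "e \<in> E1" by (simp add: EN_def)
    then obtain x y where "x \<noteq> y" "e = {x, y}" using edges_onE[OF eo1] by metis
    then show "\<exists>u v. u \<in> N \<and> v \<in> N \<and> u \<noteq> v \<and> e = {u, v}" using e by (auto simp: EN_def)
  qed
  have cone: "cone_loose v N EN"
  proof -
    have "edges_on (insert v N) (EN \<union> (\<lambda>x. {v, x}) ` N)"
      using eoN NV(2) unfolding edges_on_def by fastforce
    then have "loose (insert v N) (EN \<union> (\<lambda>x. {v, x}) ` N)"
      by (rule loose_subgraph[OF l1(1), rotated 2]) (use NV in \<open>auto simp: EN_def N_def\<close>)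
    then show ?thesis unfolding cone_loose_def using eoN NV by auto
  qed
  \<comment> \<open>The common neighbours of \<open>v\<close> and \<open>x\<close> are the
    neighbours of \<open>x\<close> inside \<open>N\<close>.\<close>
  have "6 \<le> card {e \<in> EN. x \<in> e}" if x: "x \<in> N" for x
  proof -
    have "common_nbrs E1 v x \<subseteq> {y. {x, y} \<in> EN}"
      using x by (auto simp: common_nbrs_def EN_def N_def)
    moreover have "finite {y. {x, y} \<in> EN}"
      by (rule finite_subset[OF _ fN]) (use edges_on_pair[OF eoN] in auto)
    moreover have "6 \<le> card (common_nbrs E1 v x)" using t1[of v x] x by (simp add: N_def)
    ultimately show ?thesis unfolding card_incident[OF eoN] using card_mono le_trans by metis
  qed
  then have "(\<Sum>x\<in>N. 6) \<le> (\<Sum>x\<in>N. card {e \<in> EN. x \<in> e})" by (intro sum_mono)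
  then have le3: "3 * card N \<le> card EN" using handshake[OF eoN fN] by simp
  have "\<exists>V' E'. cone_loose v V' E' \<and> E' \<noteq> {} \<and> (\<forall>u v. {u, v} \<in> E' \<longrightarrow> 3 \<le> card (common_nbrs E' u v))"
  proof (rule dense_contains_minor_with_many_triangles[where P = "cone_loose v", OF _ _ _ cone _ le3])
    show "finite V \<and> edges_on V E" if "cone_loose v V E" for V E
      using that loose_finite[of "insert v V"] unfolding cone_loose_def by auto
  qed (use wN in \<open>auto intro: cone_loose_contract\<close>)
  then obtain V2 E2 where l2: "cone_loose v V2 E2" "E2 \<noteq> {}"
    and t2: "\<And>u v. {u, v} \<in> E2 \<Longrightarrow> 3 \<le> card (common_nbrs E2 u v)"
    by auto
  have eo2: "edges_on V2 E2" and v2: "v \<notin> V2" and ll2: "loose (insert v V2) (E2 \<union> (\<lambda>x. {v, x}) ` V2)"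
    using l2 unfolding cone_loose_def by auto
  obtain e2 where e2: "e2 \<in> E2" using l2(2) by auto
  obtain u x where ux: "e2 = {u, x}" by (rule edges_onE[OF eo2 e2])
  then have uxE: "{u, x} \<in> E2" using e2 by simp
  have ux2: "u \<in> V2" "x \<in> V2" "u \<noteq> x" using edges_on_pair[OF eo2 uxE] by auto
  obtain Y where Y: "Y \<subseteq> common_nbrs E2 u x" "card Y = 3" "finite Y"
    using obtain_subset_with_card_n[OF t2[OF uxE]] by metis
  then obtain b where b: "bij_betw b {..<3::nat} Y" using ex_bij_betw_nat_finite[OF Y(3)] by (auto simp: lessThan_atLeast0)
  have Yv: "Y \<subseteq> V2 - {u, x}" using Y(1) common_nbrs_subset[OF eo2] by blast
  \<comment> \<open>One side consists of the apex and the ends of the edge, the other of three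
    common neighbours of those ends.\<close>
  define a where "a = (\<lambda>i::nat. if i = 0 then v else if i = 1 then u else x)"
  show False
  proof (rule no_loose_K33[OF ll2, of a b])
    fix i j :: nat assume "i < 3" "j < 3"
    then have bj: "b j \<in> Y" using b by (auto simp: bij_betw_def)
    then have "{u, b j} \<in> E2" "{x, b j} \<in> E2" "b j \<in> V2" using Y(1) Yv by (auto simp: common_nbrs_def)
    then show "{a i, b j} \<in> E2 \<union> (\<lambda>x. {v, x}) ` V2" by (auto simp: a_def)
  next
    show "inj_on a {..<3}" using v2 ux2 by (auto simp: inj_on_def a_def split: if_splits)
    show "inj_on b {..<3}" using b by (simp add: bij_betw_def)
    have "b ` {..<3} = Y" using b by (simp add: bij_betw_def)
    then show "a ` {..<3} \<inter> b ` {..<3} = {}" using Yv v2 by (auto simp: a_def split: if_splits)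
  qed
qed

section \<open>Number of graphs\<close>

definition redirect :: "'a set \<Rightarrow> ('a \<Rightarrow> 'a) \<Rightarrow> 'a \<Rightarrow> 'a" where
  "redirect R g v = (if v \<in> R then g v else v)"

definition pullback :: "'a set \<Rightarrow> 'a set \<Rightarrow> ('a \<Rightarrow> 'a) \<Rightarrow> 'a set set \<Rightarrow> 'a set set" where
  "pullback V R g E' = {e. e \<subseteq> V \<and> card e = 2 \<and> redirect R g ` e \<in> E'}"

text \<open>An edge of a graph contracted along a matching either survives and lies in the pullback,
  or joins a vertex to its image. For vertices outside \<open>R\<close> the added set is a
  singleton, which does no harm in an upper bound.\<close>

definition lift_edges :: "'a set \<Rightarrow> 'a set \<Rightarrow> ('a \<Rightarrow> 'a) \<Rightarrow> 'a set set \<Rightarrow> 'a set set" where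
  "lift_edges V R g E' = pullback V R g E' \<union> (\<lambda>v. {v, redirect R g v}) ` V"

text \<open>The graphs that may have been reduced to \<open>E'\<close>: either \<open>R\<close> was contracted along a matching,
  or the vertices in \<open>R\<close> were twins of vertices outside and have been deleted.\<close>

definition rebuilds :: "'a set \<Rightarrow> 'a set \<Rightarrow> ('a \<Rightarrow> 'a) \<Rightarrow> 'a set set \<Rightarrow> 'a set set set" where
  "rebuilds V R g E' = insert (pullback V R g E')
     (if card (lift_edges V R g E') \<le> 25 * card V then Pow (lift_edges V R g E') else {})"

lemma card_2_exists: "card e = 2 \<Longrightarrow> \<exists>x y. x \<noteq> y \<and> e = {x, y}"
  by (meson card_2_iff)

lemma card_fibre_pairs:
  assumes fin: "finite V" and fib: "\<And>y. card {x \<in> V. f x = y} \<le> 2" and e': "card e' = 2"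
  shows "card {e. e \<subseteq> V \<and> card e = 2 \<and> f ` e = e'} \<le> 4"
proof -
  obtain a b where ab: "a \<noteq> b" "e' = {a, b}" using card_2_exists[OF e'] by auto
  let ?A = "{x \<in> V. f x = a}" and ?B = "{x \<in> V. f x = b}"
  have fin2: "finite (?A \<times> ?B)" using fin by auto
  have "{e. e \<subseteq> V \<and> card e = 2 \<and> f ` e = e'} \<subseteq> (\<lambda>(x, y). {x, y}) ` (?A \<times> ?B)"
  proof
    fix e assume e: "e \<in> {e. e \<subseteq> V \<and> card e = 2 \<and> f ` e = e'}"
    then obtain x y where xy: "e = {x, y}" using card_2_exists[of e] by auto
    then have v: "x \<in> V" "y \<in> V" "{f x, f y} = {a, b}" using e ab by auto
    then have "f x = a \<and> f y = b \<or> f x = b \<and> f y = a" by (auto simp: doubleton_eq_iff)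
    then have "(x, y) \<in> ?A \<times> ?B \<or> (y, x) \<in> ?A \<times> ?B" using v by auto
    then show "e \<in> (\<lambda>(x, y). {x, y}) ` (?A \<times> ?B)"
    proof
      assume "(x, y) \<in> ?A \<times> ?B"
      then show ?thesis by (rule image_eqI[rotated]) (simp add: xy)
    next
      assume "(y, x) \<in> ?A \<times> ?B"
      then show ?thesis by (rule image_eqI[rotated]) (simp add: xy insert_commute)
    qed
  qed
  then have "card {e. e \<subseteq> V \<and> card e = 2 \<and> f ` e = e'} \<le> card (?A \<times> ?B)"
    using surj_card_le[OF fin2] by simp
  also have "\<dots> \<le> 2 * 2" unfolding card_cartesian_product by (intro mult_mono fib) auto
  finally show ?thesis by simp
qed

text \<open>The contracted graph has at most 6 |V| edges and the fibres have at most two elements,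
  so each edge has at most 4 preimages. With the |V| pairs of a vertex and its image this gives the
  bound 25 |V| built into \<open>rebuilds\<close>, which keeps the number of possible
  \<open>E\<close> exponential in |V|.\<close>

lemma matching_reduction:
  assumes l: "loose V E" and R: "R \<subseteq> V" and inj: "inj_on g R" and g: "\<And>r. r \<in> R \<Longrightarrow> g r \<in> V - R"
    and gE: "\<And>r. r \<in> R \<Longrightarrow> {r, g r} \<in> E" and ne: "V \<noteq> {}"
  shows "\<exists>E'. loose (V - R) E' \<and> E \<in> rebuilds V R g E'"
proof -
  define f where "f = redirect R g"
  have eo: "edges_on V E" and fin: "finite V" using loose_edges_on[OF l] loose_finite[OF l] by auto
  have fV: "f ` V = V - R"
  proof
    show "f ` V \<subseteq> V - R" using g by (auto simp: f_def redirect_def)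
    show "V - R \<subseteq> f ` V"
    proof
      fix x assume "x \<in> V - R"
      then have "f x = x" "x \<in> V" by (auto simp: f_def redirect_def)
      then show "x \<in> f ` V" by (metis imageI)
    qed
  qed
  have "loose (f ` V) (contract f E)"
  proof (rule loose_contract[OF l])
    fix u assume u: "u \<in> V"
    show "f u \<in> V" using u g by (auto simp: f_def redirect_def)
    show "f (f u) = f u" using g[of u] by (auto simp: f_def redirect_def)
    show "{u, f u} \<in> E" if "f u \<noteq> u" using that gE[of u] by (auto simp: f_def redirect_def split: if_splits)
  qed
  then have l': "loose (V - R) (contract f E)" unfolding fV .
  have VR: "V - R \<noteq> {}" using g ne by auto
  have "card (contract f E) < 6 * card (V - R)" by (rule loose_card_edges[OF l' VR])
  also have "\<dots> \<le> 6 * card V" using fin by (simp add: card_mono)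
  finally have cE': "card (contract f E) \<le> 6 * card V" by simp
  have finE': "finite (contract f E)" using edges_on_finite[OF loose_edges_on[OF l'] loose_finite[OF l']] .
  have fib: "card {x \<in> V. f x = y} \<le> 2" for y
  proof -
    have "card {x \<in> R. g x = y} \<le> card {y}"
      by (rule card_inj_on_le[of g]) (use inj in \<open>auto intro: inj_on_subset\<close>)
    moreover have "{x \<in> V. f x = y} \<subseteq> {x \<in> R. g x = y} \<union> {y}"
      by (auto simp: f_def redirect_def split: if_splits)
    moreover have "finite ({x \<in> R. g x = y} \<union> {y})" using finite_subset[OF R fin] by auto
    ultimately have "card {x \<in> V. f x = y} \<le> card ({x \<in> R. g x = y} \<union> {y})" "card {x \<in> R. g x = y} \<le> 1"
      using card_mono[of "{x \<in> R. g x = y} \<union> {y}" "{x \<in> V. f x = y}"] by auto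
    moreover have "card ({x \<in> R. g x = y} \<union> {y}) \<le> card {x \<in> R. g x = y} + card {y}" by (rule card_Un_le)
    ultimately show ?thesis by simp
  qed
  have "pullback V R g (contract f E) \<subseteq> (\<Union>e'\<in>contract f E. {e. e \<subseteq> V \<and> card e = 2 \<and> f ` e = e'})"
    unfolding pullback_def f_def by auto
  moreover have "finite (\<Union>e'\<in>contract f E. {e. e \<subseteq> V \<and> card e = 2 \<and> f ` e = e'})"
    by (rule finite_subset[of _ "Pow V"]) (use fin in auto)
  ultimately have "card (pullback V R g (contract f E))
      \<le> card (\<Union>e'\<in>contract f E. {e. e \<subseteq> V \<and> card e = 2 \<and> f ` e = e'})"
    by (rule card_mono[rotated])
  also have "\<dots> \<le> (\<Sum>e'\<in>contract f E. card {e. e \<subseteq> V \<and> card e = 2 \<and> f ` e = e'})"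
    by (rule card_UN_le[OF finE'])
  also have "\<dots> \<le> (\<Sum>e'\<in>contract f E. 4)"
    by (intro sum_mono card_fibre_pairs[OF fin fib]) (auto simp: contract_def)
  also have "\<dots> \<le> 24 * card V" using cE' by simp
  finally have "card (pullback V R g (contract f E)) \<le> 24 * card V" .
  moreover have "card ((\<lambda>v. {v, redirect R g v}) ` V) \<le> card V" by (rule card_image_le[OF fin])
  ultimately have "card (lift_edges V R g (contract f E)) \<le> 25 * card V"
    unfolding lift_edges_def
    using card_Un_le[of "pullback V R g (contract f E)" "(\<lambda>v. {v, redirect R g v}) ` V"] by linarith
  moreover have "E \<subseteq> lift_edges V R g (contract f E)"
  proof
    fix e assume e: "e \<in> E"
    obtain u v where uv: "u \<in> V" "v \<in> V" "u \<noteq> v" "e = {u, v}" by (rule edges_onE[OF eo e])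
    show "e \<in> lift_edges V R g (contract f E)"
    proof (cases "f u = f v")
      case False
      then have "f ` e \<in> contract f E" unfolding contract_def
        by (intro CollectI bexI[OF _ e] conjI) (auto simp: uv(4))
      then have "e \<in> pullback V R g (contract f E)" using uv unfolding pullback_def f_def by simp
      then show ?thesis unfolding lift_edges_def by simp
    next
      case True
      have "v = f u \<or> u = f v"
        using True uv(3) inj_onD[OF inj, of u v] by (auto simp: f_def redirect_def split: if_splits)
      then have "e \<in> (\<lambda>v. {v, redirect R g v}) ` V"
      proof
        assume "v = f u"
        then show ?thesis by (intro image_eqI[of _ _ u]) (use uv in \<open>auto simp: f_def\<close>)
      next
        assume "u = f v"
        then show ?thesis by (intro image_eqI[of _ _ v]) (use uv in \<open>auto simp: f_def\<close>)
      qed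
      then show ?thesis unfolding lift_edges_def by simp
    qed
  qed
  ultimately have "E \<in> rebuilds V R g (contract f E)" unfolding rebuilds_def by simp
  then show ?thesis using l' by auto
qed

text \<open>Adjacency is unchanged when either end is replaced by its twin, hence when both are.
  Thus the remaining graph determines \<open>E\<close> outright, and the deletion costs only the
  choice of \<open>R\<close> and \<open>g\<close>.\<close>

lemma twin_reduction:
  assumes eo: "edges_on V E" and g: "\<And>r. r \<in> R \<Longrightarrow> g r \<in> V - R"
    and tw: "\<And>r w. r \<in> R \<Longrightarrow> {r, w} \<in> E \<longleftrightarrow> {g r, w} \<in> E"
  shows "E = pullback V R g {e \<in> E. e \<subseteq> V - R}"
proof -
  define f where "f = redirect R g"
  have 1: "{u, w} \<in> E \<longleftrightarrow> {f u, w} \<in> E" for u w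
    using tw[of u w] by (auto simp: f_def redirect_def)
  have 2: "{u, w} \<in> E \<longleftrightarrow> {f u, f w} \<in> E" for u w
    using 1[of u w] 1[of w "f u"] by (simp add: insert_commute)
  have fV: "f v \<in> V - R" if "v \<in> V" for v using that g by (auto simp: f_def redirect_def)
  show ?thesis
  proof
    show "E \<subseteq> pullback V R g {e \<in> E. e \<subseteq> V - R}"
    proof
      fix e assume e: "e \<in> E"
      obtain u v where uv: "u \<in> V" "v \<in> V" "u \<noteq> v" "e = {u, v}" by (rule edges_onE[OF eo e])
      then have "f ` e \<in> E" "f ` e \<subseteq> V - R" using 2[of u v] e fV by auto
      then show "e \<in> pullback V R g {e \<in> E. e \<subseteq> V - R}" using uv by (simp add: pullback_def f_def)
    qed
    show "pullback V R g {e \<in> E. e \<subseteq> V - R} \<subseteq> E"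
    proof
      fix e assume e: "e \<in> pullback V R g {e \<in> E. e \<subseteq> V - R}"
      then obtain u v where "e = {u, v}" using card_2_exists[of e] by (auto simp: pullback_def)
      then show "e \<in> E" using e 2[of u v] by (simp add: pullback_def f_def)
    qed
  qed
qed

section \<open>Cliques, and a reduction by a constant fraction of the vertices\<close>

definition cliques :: "'a set \<Rightarrow> 'a set set \<Rightarrow> 'a set set" where
  "cliques Q G = {K. K \<subseteq> Q \<and> (\<forall>x\<in>K. \<forall>y\<in>K. x \<noteq> y \<longrightarrow> {x, y} \<in> G)}"

lemma loose_restrict: "loose V E \<Longrightarrow> W \<subseteq> V \<Longrightarrow> loose W {e \<in> E. e \<subseteq> W}"
proof (rule loose_subgraph)
  assume "loose V E"
  then have eo: "edges_on V E" by (rule loose_edges_on)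
  show "edges_on W {e \<in> E. e \<subseteq> W}"
    unfolding edges_on_def
  proof
    fix e assume e: "e \<in> {e \<in> E. e \<subseteq> W}"
    then have "e \<in> E" by simp
    then obtain u v where "u \<noteq> v" "e = {u, v}" by (rule edges_onE[OF eo])
    then show "\<exists>u v. u \<in> W \<and> v \<in> W \<and> u \<noteq> v \<and> e = {u, v}" using e by auto
  qed
qed auto

text \<open>Average degree below 12 yields a vertex with at most 11 neighbours; it is in at most
  2^11 cliques, and induction applies to the rest. The additional 1 is the empty clique.\<close>

lemma card_cliques: "loose Q G \<Longrightarrow> card (cliques Q G) \<le> 2 ^ 11 * card Q + 1"
proof (induction "card Q" arbitrary: Q G rule: less_induct)
  case less
  have fin: "finite Q" and eo: "edges_on Q G" using loose_finite loose_edges_on less.prems by auto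
  show ?case
  proof (cases "Q = {}")
    case True
    then have "cliques Q G \<subseteq> {{}}" by (auto simp: cliques_def)
    then have "card (cliques Q G) \<le> card {{} :: 'a set}" by (intro card_mono) auto
    then show ?thesis by simp
  next
    case False
    have "\<exists>x\<in>Q. card {e \<in> G. x \<in> e} < 12"
    proof (rule ccontr)
      assume "\<not> ?thesis"
      then have "(\<Sum>x\<in>Q. 12) \<le> (\<Sum>x\<in>Q. card {e \<in> G. x \<in> e})" by (intro sum_mono) (auto simp: not_less)
      then show False using handshake[OF eo fin] loose_card_edges[OF less.prems False] by simp
    qed
    then obtain x where x: "x \<in> Q" "card {y. {x, y} \<in> G} \<le> 11"
      unfolding card_incident[OF eo] by auto
    let ?N = "{y. {x, y} \<in> G}" and ?G = "{e \<in> G. e \<subseteq> Q - {x}}"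
    have finN: "finite ?N" by (rule finite_subset[OF _ fin]) (use edges_on_pair[OF eo] in auto)
    have finC: "finite (cliques (Q - {x}) ?G)"
      by (rule finite_subset[of _ "Pow Q"]) (use fin in \<open>auto simp: cliques_def\<close>)
    have sub: "cliques Q G \<subseteq> cliques (Q - {x}) ?G \<union> insert x ` Pow ?N"
    proof
      fix K assume K: "K \<in> cliques Q G"
      show "K \<in> cliques (Q - {x}) ?G \<union> insert x ` Pow ?N"
      proof (cases "x \<in> K")
        case True
        then have "K - {x} \<subseteq> ?N" using K by (auto simp: cliques_def)
        moreover have "K = insert x (K - {x})" using True by auto
        ultimately show ?thesis by (intro UnI2 image_eqI[of _ _ "K - {x}"]) simp_all
      next
        case False
        then show ?thesis using K by (auto simp: cliques_def)
      qed
    qed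
    have c1: "card (cliques (Q - {x}) ?G) \<le> 2 ^ 11 * card (Q - {x}) + 1"
      by (rule less.hyps[OF card_Diff1_less[OF fin x(1)] loose_restrict[OF less.prems]]) auto
    have "card (insert x ` Pow ?N) \<le> card (Pow ?N)" using finN by (intro card_image_le) simp
    also have "\<dots> \<le> 2 ^ 11" using x(2) by (simp add: card_Pow finN power_increasing del: power_numeral)
    finally have c2: "card (insert x ` Pow ?N) \<le> 2 ^ 11" .
    have "card (cliques Q G) \<le> card (cliques (Q - {x}) ?G \<union> insert x ` Pow ?N)"
      by (rule card_mono[OF _ sub]) (use finC finN in auto)
    also have "\<dots> \<le> 2 ^ 11 * card (Q - {x}) + 1 + 2 ^ 11"
      using card_Un_le[of "cliques (Q - {x}) ?G" "insert x ` Pow ?N"] c1 c2 by linarith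
    also have "\<dots> = 2 ^ 11 * card Q + 1"
    proof -
      have "card Q = Suc (card (Q - {x}))" using card.remove[OF fin x(1)] .
      then show ?thesis by simp
    qed
    finally show ?thesis .
  qed
qed

text \<open>If a maximal matching is small, its vertex set \<open>Q\<close> is a small vertex cover.  Choose a maximal
  set \<open>A\<close> of other vertices with distinct pairs of neighbours in \<open>Q\<close> and contract each vertex of \<open>A\<close>
  onto one element of its pair: this gives a sparse graph \<open>G\<close> on \<open>Q\<close>, so \<open>A\<close> is small and \<open>G\<close>
  has few cliques.  The neighbourhoods of all remaining vertices are cliques of \<open>G\<close>, hence most of
  these vertices are twins.\<close>

lemma loose_reduction:
  assumes l: "loose V E" and V2: "2 \<le> card V"
  shows "\<exists>R g E'. R \<subseteq> V \<and> card V \<le> 100000 * card R \<and> g ` R \<subseteq> V \<and> loose (V - R) E' \<and> E \<in> rebuilds V R g E'"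
proof -
  have eo: "edges_on V E" and fin: "finite V" using loose_edges_on[OF l] loose_finite[OF l] by auto
  have ne: "V \<noteq> {}" using V2 by auto
  \<comment> \<open>A matching, given by one end of each edge in \<open>R\<close> and the other end
    as its value under \<open>g\<close>.\<close>
  define M where "M = (\<lambda>(R, g). R \<subseteq> V \<and> inj_on g R \<and> (\<forall>r\<in>R. g r \<in> V - R \<and> {r, g r} \<in> E))"
  have "\<exists>x. M x \<and> (\<forall>y. M y \<longrightarrow> card (fst y) \<le> card (fst x))"
  proof (rule ex_has_greatest_nat)
    show "M ({}, id)" by (simp add: M_def)
    show "\<forall>y. M y \<longrightarrow> card (fst y) < Suc (card V)"
      by (auto simp: M_def less_Suc_eq_le intro: card_mono[OF fin])
  qed
  then obtain R g where Rg: "M (R, g)" and max: "\<And>R' g'. M (R', g') \<Longrightarrow> card R' \<le> card R"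
    by (metis fst_conv surj_pair)
  have R: "R \<subseteq> V" and inj: "inj_on g R" and gV: "\<And>r. r \<in> R \<Longrightarrow> g r \<in> V - R"
    and gE: "\<And>r. r \<in> R \<Longrightarrow> {r, g r} \<in> E" using Rg by (auto simp: M_def)
  have finR: "finite R" using R fin finite_subset by auto
  show ?thesis
  proof (cases "card V \<le> 100000 * card R")
    case True
    then show ?thesis using matching_reduction[OF l R inj gV gE ne] R gV by blast
  next
    case False
    define Q where "Q = R \<union> g ` R"
    have QV: "Q \<subseteq> V" using R gV by (auto simp: Q_def)
    have finQ: "finite Q" using QV fin finite_subset by auto
    have cQ: "card Q \<le> 2 * card R"
      using card_Un_le[of R "g ` R"] card_image_le[OF finR, of g] by (simp add: Q_def)
    define P where "P = V - Q"
    have ind: "{u, v} \<notin> E" if uv: "u \<in> P" "v \<in> P" for u v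
    proof
      assume E: "{u, v} \<in> E"
      then have "u \<noteq> v" using edges_on_pair[OF eo] by auto
      moreover have "u \<notin> R" "v \<notin> R" "u \<notin> g ` R" "v \<notin> g ` R" "u \<in> V" "v \<in> V" using uv by (auto simp: P_def Q_def)
      ultimately have "M (insert u R, g(u := v))"
        unfolding M_def using R inj gV gE E by (auto simp: inj_on_def)
      from max[OF this] show False using \<open>u \<notin> R\<close> finR by simp
    qed
    define pr :: "('a \<Rightarrow> 'a \<times> 'a) \<Rightarrow> 'a \<Rightarrow> 'a set" where "pr = (\<lambda>h a. {fst (h a), snd (h a)})"
    define W where "W = (\<lambda>(A, h). A \<subseteq> P \<and> inj_on (pr h) A \<and>
      (\<forall>a\<in>A. fst (h a) \<in> Q \<and> snd (h a) \<in> Q \<and> fst (h a) \<noteq> snd (h a) \<and> {a, fst (h a)} \<in> E \<and> {a, snd (h a)} \<in> E))"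
    have "\<exists>x. W x \<and> (\<forall>y. W y \<longrightarrow> card (fst y) \<le> card (fst x))"
    proof (rule ex_has_greatest_nat)
      show "W ({}, \<lambda>x. (x, x))" by (simp add: W_def)
      show "\<forall>y. W y \<longrightarrow> card (fst y) < Suc (card V)"
        by (auto simp: W_def P_def less_Suc_eq_le intro!: card_mono[OF fin])
    qed
    then obtain A h where Ah: "W (A, h)" and maxA: "\<And>A' h'. W (A', h') \<Longrightarrow> card A' \<le> card A"
      by (metis fst_conv surj_pair)
    have AP: "A \<subseteq> P" and injA: "inj_on (pr h) A"
      and hQ: "\<And>a. a \<in> A \<Longrightarrow> fst (h a) \<in> Q \<and> snd (h a) \<in> Q \<and> fst (h a) \<noteq> snd (h a)"
      and hE: "\<And>a. a \<in> A \<Longrightarrow> {a, fst (h a)} \<in> E \<and> {a, snd (h a)} \<in> E" using Ah by (auto simp: W_def)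
    have finA: "finite A" using AP fin by (auto simp: P_def intro: finite_subset)
    define G where "G = pr h ` A"
    have lG: "loose Q G"
    proof -
      define f where "f = redirect A (\<lambda>a. fst (h a))"
      have fA: "f a = fst (h a)" if "a \<in> A" for a using that by (simp add: f_def redirect_def)
      have fQ: "f q = q" if "q \<in> Q" for q using that AP by (auto simp: f_def redirect_def P_def)
      have 1: "loose (f ` V) (contract f E)"
      proof (rule loose_contract[OF l])
        fix u assume u: "u \<in> V"
        show "f u \<in> V" using u hQ[of u] QV by (auto simp: f_def redirect_def)
        show "f (f u) = f u"
        proof (cases "u \<in> A")
          case True
          then show ?thesis using fA[OF True] fQ hQ[OF True] by simp
        next
          case False
          then show ?thesis by (simp add: f_def redirect_def)
        qed
        show "{u, f u} \<in> E" if "f u \<noteq> u"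
          using that hE[of u] by (auto simp: f_def redirect_def split: if_splits)
      qed
      show ?thesis
      proof (rule loose_subgraph[OF 1])
        show "Q \<subseteq> f ` V"
        proof
          fix q assume "q \<in> Q"
          then have "q = f q" "q \<in> V" using fQ QV by auto
          then show "q \<in> f ` V" by (rule image_eqI)
        qed
        show "G \<subseteq> contract f E"
        proof
          fix e assume "e \<in> G"
          then obtain a where a: "a \<in> A" "e = {fst (h a), snd (h a)}" by (auto simp: G_def pr_def)
          then have "e = f ` {a, snd (h a)}" using fA[OF a(1)] fQ hQ[OF a(1)] by simp
          moreover have "card e = 2" using a hQ[OF a(1)] by simp
          ultimately show "e \<in> contract f E" unfolding contract_def
            using hE[OF a(1)] by (intro CollectI bexI[of _ "{a, snd (h a)}"] conjI) auto
        qed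
        show "edges_on Q G" using hQ by (auto simp: edges_on_def G_def pr_def)
      qed
    qed
    have cA: "card A \<le> 6 * card Q"
    proof (cases "Q = {}")
      case True
      then have "A = {}" using hQ by auto
      then show ?thesis by simp
    next
      case False
      have "card A = card G" using card_image[OF injA] by (simp add: G_def)
      then show ?thesis using loose_card_edges[OF lG False] by simp
    qed
    define N where "N = (\<lambda>a. {w. {a, w} \<in> E})"
    define B where "B = P - A"
    have finB: "finite B" using fin by (auto simp: B_def P_def)
    have NC: "N a \<in> cliques Q G" if a: "a \<in> B" for a
    proof -
      have aP: "a \<in> P" "a \<notin> A" using a by (auto simp: B_def)
      have NQ: "N a \<subseteq> Q"
      proof
        fix w assume "w \<in> N a"
        then have "{a, w} \<in> E" by (simp add: N_def)
        then show "w \<in> Q" using ind[OF aP(1), of w] edges_on_pair[OF eo, of a w] by (auto simp: P_def)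
      qed
      have "{x, y} \<in> G" if xy: "x \<in> N a" "y \<in> N a" "x \<noteq> y" for x y
      proof (rule ccontr)
        \<comment> \<open>Otherwise \<open>a\<close> with the new pair \<open>{x, y}\<close> could
          be added to \<open>A\<close>, against maximality.\<close>
        assume nG: "{x, y} \<notin> G"
        let ?h = "h(a := (x, y))"
        have "inj_on (pr ?h) (insert a A)"
        proof -
          have "inj_on (pr ?h) A = inj_on (pr h) A"
            by (rule inj_on_cong) (use aP(2) in \<open>auto simp: pr_def\<close>)
          moreover have "pr ?h ` (A - {a}) = G"
            unfolding G_def by (rule image_cong) (use aP(2) in \<open>auto simp: pr_def\<close>)
          moreover have "pr ?h a = {x, y}" by (simp add: pr_def)
          ultimately show ?thesis using injA nG by simp
        qed
        moreover have "\<forall>b\<in>insert a A. fst (?h b) \<in> Q \<and> snd (?h b) \<in> Q \<and> fst (?h b) \<noteq> snd (?h b)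
            \<and> {b, fst (?h b)} \<in> E \<and> {b, snd (?h b)} \<in> E"
          using hQ hE xy NQ aP(2) by (auto simp: N_def)
        ultimately have "W (insert a A, ?h)" unfolding W_def using AP aP(1) by simp
        from maxA[OF this] show False using aP(2) finA by simp
      qed
      then show ?thesis using NQ by (auto simp: cliques_def)
    qed
    \<comment> \<open>\<open>g2\<close> selects one vertex of \<open>B\<close> for each
      neighbourhood; \<open>R2\<close> consists of the vertices that are not selected, all of which
      have a selected twin.\<close>
    define g2 where "g2 = (\<lambda>a. inv_into B N (N a))"
    define R2 where "R2 = {a \<in> B. g2 a \<noteq> a}"
    have g2B: "g2 a \<in> B" "N (g2 a) = N a" if "a \<in> B" for a
      unfolding g2_def using imageI[OF that, of N] inv_into_into[of "N a" N B] f_inv_into_f[of "N a" N B]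
      by simp_all
    have g2R: "g2 r \<in> V - R2" if "r \<in> R2" for r
    proof -
      have "r \<in> B" using that by (simp add: R2_def)
      then have "g2 (g2 r) = g2 r" using g2B(2)[of r] by (simp add: g2_def)
      then show ?thesis using g2B(1)[OF \<open>r \<in> B\<close>] by (auto simp: R2_def B_def P_def)
    qed
    have tw: "{r, w} \<in> E \<longleftrightarrow> {g2 r, w} \<in> E" if "r \<in> R2" for r w
    proof -
      have "N (g2 r) = N r" using g2B(2)[of r] that by (simp add: R2_def)
      then have "w \<in> N (g2 r) \<longleftrightarrow> w \<in> N r" by simp
      then show ?thesis by (simp add: N_def)
    qed
    have R2V: "R2 \<subseteq> V" by (auto simp: R2_def B_def P_def)
    have "E \<in> rebuilds V R2 g2 {e \<in> E. e \<subseteq> V - R2}"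
      using twin_reduction[OF eo g2R tw] by (simp add: rebuilds_def)
    moreover have "loose (V - R2) {e \<in> E. e \<subseteq> V - R2}" by (rule loose_restrict[OF l]) auto
    \<comment> \<open>At most 4110 * \<open>card R\<close> + 1 vertices are outside
      \<open>R2\<close>: 4096 * \<open>card R\<close> + 1 selected ones, 12 * \<open>card R\<close>
      in \<open>A\<close> and 2 * \<open>card R\<close> in \<open>Q\<close>. As \<open>R\<close> is
      a tiny part of \<open>V\<close>, the constant 100000 is far from tight.\<close>
    moreover have "card V \<le> 100000 * card R2"
    proof -
      have "inj_on N (B - R2)"
      proof (rule inj_onI)
        fix a b assume ab: "a \<in> B - R2" "b \<in> B - R2" "N a = N b"
        then have "g2 a = g2 b" by (simp add: g2_def)
        then show "a = b" using ab by (simp add: R2_def)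
      qed
      moreover have "N ` (B - R2) \<subseteq> cliques Q G" using NC by auto
      moreover have "finite (cliques Q G)"
        by (rule finite_subset[of _ "Pow Q"]) (use finQ in \<open>auto simp: cliques_def\<close>)
      ultimately have "card (B - R2) \<le> card (cliques Q G)" by (rule card_inj_on_le)
      also have "\<dots> \<le> 2048 * card Q + 1" using card_cliques[OF lG] by simp
      finally have "card (B - R2) \<le> 2048 * card Q + 1" .
      moreover have "card B = card (B - R2) + card R2"
        using card_Diff_subset[of R2 B] card_mono[OF finB, of R2] finB finite_subset[of R2 B]
        by (auto simp: R2_def)
      moreover have "card V \<le> card B + card A + card Q"
      proof -
        have "V \<subseteq> B \<union> A \<union> Q" by (auto simp: B_def P_def)
        then have "card V \<le> card (B \<union> A \<union> Q)" using finA finB finQ by (intro card_mono) auto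
        also have "\<dots> \<le> card B + card A + card Q"
          using card_Un_le[of "B \<union> A" Q] card_Un_le[of B A] by linarith
        finally show ?thesis .
      qed
      ultimately show ?thesis using cA cQ V2 False by linarith
    qed
    moreover have "g2 ` R2 \<subseteq> V" using g2R by auto
    ultimately show ?thesis using R2V by blast
  qed
qed

text \<open>Only the values on \<open>R\<close> matter, so \<open>g\<close> can be counted among the
  extensional functions from \<open>R\<close> to \<open>V\<close>.\<close>

lemma rebuilds_restrict: "rebuilds V R (restrict g R) E' = rebuilds V R g E'"
proof -
  have "redirect R (restrict g R) = redirect R g" by (auto simp: redirect_def)
  then show ?thesis by (simp add: rebuilds_def lift_edges_def pullback_def)
qed

lemma card_rebuilds:
  assumes "finite V" "V \<noteq> {}"
  shows "finite (rebuilds V R g E')" "card (rebuilds V R g E') \<le> 2 ^ (26 * card V)"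
proof -
  have fin: "finite (lift_edges V R g E')"
    unfolding lift_edges_def pullback_def using assms(1) by auto
  show "finite (rebuilds V R g E')" unfolding rebuilds_def using fin by auto
  have "card (rebuilds V R g E') \<le> Suc (2 ^ (25 * card V))"
    unfolding rebuilds_def
    by (rule order_trans[OF card_insert_le_m1[of "Suc (2 ^ (25 * card V))"]])
       (use fin in \<open>auto simp: card_Pow power_increasing\<close>)
  also have "\<dots> \<le> 2 * 2 ^ (25 * card V)" by simp
  also have "\<dots> = 2 ^ (25 * card V + 1)" by simp
  also have "\<dots> \<le> 2 ^ (26 * card V)"
    using assms by (intro power_increasing) (auto simp: Suc_le_eq card_gt_0_iff)
  finally show "card (rebuilds V R g E') \<le> 2 ^ (26 * card V)" .
qed

text \<open>The exponent is 26 \<open>n\<close> for the choice among the rebuilds and another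
  \<open>n\<close> for the choice of \<open>R\<close>.\<close>

lemma exists_power_bound: "\<exists>C::nat. \<forall>n m. n \<le> K * m \<longrightarrow> 2 ^ (27 * n) \<le> C ^ m"
proof (intro exI[of _ "2 ^ (27 * K)"] allI impI)
  fix n m :: nat assume "n \<le> K * m"
  then have "27 * n \<le> 27 * K * m" by simp
  then have "(2::nat) ^ (27 * n) \<le> 2 ^ (27 * K * m)" by (intro power_increasing) auto
  then show "(2::nat) ^ (27 * n) \<le> (2 ^ (27 * K)) ^ m" by (simp add: power_mult)
qed

text \<open>If \<open>m\<close> vertices are removed, there are n^m maps \<open>g\<close>, at most
  (C n)^(n-m) smaller graphs by induction and 2^(26 n) rebuilds. Since \<open>n \<le> K * m\<close>,
  one factor C^m pays for all exponential factors and turns n^m into (C n)^m.\<close>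

theorem card_loose_graphs:
  "\<exists>C::nat. \<forall>V :: 'a set. finite V \<longrightarrow> finite {E. loose V E} \<and> card {E. loose V E} \<le> (C * card V) ^ card V"
proof -
  define K :: nat where "K = 100000"
  obtain C :: nat where C: "\<And>n m. n \<le> K * m \<Longrightarrow> 2 ^ (27 * n) \<le> C ^ m"
    using exists_power_bound[of K] by auto
  have finL: "finite {E. loose V E}" if "finite V" for V :: "'a set"
    by (rule finite_subset[of _ "Pow (Pow V)"]) (use that in \<open>auto dest!: loose_edges_on edges_on_subset\<close>)
  have "card {E. loose V E} \<le> (C * card V) ^ card V" if "finite V" for V :: "'a set"
    using that
  proof (induction "card V" arbitrary: V rule: less_induct)
    case less
    have C1: "1 \<le> C" using C[of 0 1] by simp
    show ?case
    proof (cases "2 \<le> card V")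
      case False
      have "{E. loose V E} \<subseteq> {{}}"
      proof
        fix E assume "E \<in> {E. loose V E}"
        then have eo: "edges_on V E" using loose_edges_on by auto
        have "E = {}"
        proof (rule ccontr)
          assume "E \<noteq> {}"
          then obtain e where e: "e \<in> E" by auto
          have "card e \<le> card V" by (rule card_mono[OF less.prems edges_on_subset[OF eo e]])
          then show False using edges_on_card2[OF eo e] False by simp
        qed
        then show "E \<in> {{}}" by simp
      qed
      then have "card {E. loose V E} \<le> card {{} :: 'a set set}" by (intro card_mono) auto
      also have "\<dots> \<le> (C * card V) ^ card V" using C1 by (cases "card V") auto
      finally show ?thesis .
    next
      case True
      define n where "n = card V"
      define T where "T = (C * n) ^ n"
      define RR where "RR = {R \<in> Pow V. n \<le> K * card R}"
      define F where "F = (\<lambda>R. \<Union>g\<in>R \<rightarrow>\<^sub>E V. \<Union>E'\<in>{E'. loose (V - R) E'}. rebuilds V R g E')"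
      have fin: "finite V" by (rule less.prems)
      have ne: "V \<noteq> {}" using True by auto
      have "{E. loose V E} \<subseteq> (\<Union>R\<in>RR. F R)"
      proof
        fix E assume "E \<in> {E. loose V E}"
        then obtain R g E' where h: "R \<subseteq> V" "card V \<le> 100000 * card R" "g ` R \<subseteq> V"
          "loose (V - R) E'" "E \<in> rebuilds V R g E'" using loose_reduction[of V E] True by auto
        have "restrict g R \<in> R \<rightarrow>\<^sub>E V" using h(3) by auto
        moreover have "E \<in> rebuilds V R (restrict g R) E'" using h(5) by (simp add: rebuilds_restrict)
        ultimately have "E \<in> F R" unfolding F_def using h(4) by blast
        then show "E \<in> (\<Union>R\<in>RR. F R)" using h(1,2) by (auto simp: RR_def n_def K_def)
      qed
      moreover have finRR: "finite RR" using fin by (simp add: RR_def)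
      have finV: "finite R" if "R \<in> RR" for R using that fin finite_subset by (auto simp: RR_def)
      have finF: "finite (F R)" if R: "R \<in> RR" for R
        unfolding F_def using finV[OF R] fin ne finL[of "V - R"] card_rebuilds(1)[OF fin ne]
        by (auto intro!: finite_PiE)
      ultimately have "card {E. loose V E} \<le> card (\<Union>R\<in>RR. F R)"
        using finRR finF by (intro card_mono) auto
      also have "\<dots> \<le> (\<Sum>R\<in>RR. card (F R))" by (rule card_UN_le[OF finRR])
      finally have 1: "card {E. loose V E} \<le> (\<Sum>R\<in>RR. card (F R))" .
      \<comment> \<open>The factor 2^n anticipates the sum over at most 2^n sets
        \<open>R\<close>.\<close>
      have 2: "2 ^ n * card (F R) \<le> T" if R: "R \<in> RR" for R
      proof -
        define m where "m = card R"
        have RV: "R \<subseteq> V" and mn: "n \<le> K * m" using R by (auto simp: RR_def m_def)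
        have m0: "0 < m" using mn True by (cases m) (auto simp: n_def)
        have mle: "m \<le> n" unfolding m_def n_def by (rule card_mono[OF fin RV])
        have cVR: "card (V - R) = n - m" unfolding m_def n_def by (rule card_Diff_subset[OF finV[OF R] RV])
        have ih: "card {E'. loose (V - R) E'} \<le> (C * n) ^ (n - m)"
        proof -
          have "card {E'. loose (V - R) E'} \<le> (C * card (V - R)) ^ card (V - R)"
            by (rule less.hyps) (use cVR m0 mle fin in \<open>auto simp: n_def\<close>)
          also have "\<dots> \<le> (C * n) ^ (n - m)" unfolding cVR by (intro power_mono) auto
          finally show ?thesis .
        qed
        have inner: "card (\<Union>E'\<in>{E'. loose (V - R) E'}. rebuilds V R g E') \<le> (C * n) ^ (n - m) * 2 ^ (26 * n)" for g
        proof -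
          have "card (\<Union>E'\<in>{E'. loose (V - R) E'}. rebuilds V R g E')
              \<le> (\<Sum>E'\<in>{E'. loose (V - R) E'}. card (rebuilds V R g E'))"
            by (rule card_UN_le) (use finL[of "V - R"] fin in auto)
          also have "\<dots> \<le> (\<Sum>E'\<in>{E'. loose (V - R) E'}. 2 ^ (26 * n))"
            unfolding n_def by (intro sum_mono card_rebuilds(2)[OF fin ne])
          also have "\<dots> = card {E'. loose (V - R) E'} * 2 ^ (26 * n)" by simp
          finally show ?thesis using ih by (meson le_trans mult_le_mono1)
        qed
        have "card (F R) \<le> (\<Sum>g\<in>R \<rightarrow>\<^sub>E V. card (\<Union>E'\<in>{E'. loose (V - R) E'}. rebuilds V R g E'))"
          unfolding F_def by (rule card_UN_le) (use finV[OF R] fin in \<open>auto intro: finite_PiE\<close>)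
        also have "\<dots> \<le> (\<Sum>g\<in>R \<rightarrow>\<^sub>E V. (C * n) ^ (n - m) * 2 ^ (26 * n))"
          by (intro sum_mono inner)
        also have "\<dots> = n ^ m * ((C * n) ^ (n - m) * 2 ^ (26 * n))"
          by (simp add: card_PiE[OF finV[OF R]] m_def n_def)
        finally have "2 ^ n * card (F R) \<le> 2 ^ n * (n ^ m * ((C * n) ^ (n - m) * 2 ^ (26 * n)))" by simp
        also have "\<dots> = n ^ m * (C * n) ^ (n - m) * 2 ^ (27 * n)"
        proof -
          have "(2::nat) ^ (27 * n) = 2 ^ n * 2 ^ (26 * n)" by (simp flip: power_add)
          then show ?thesis by (simp add: mult_ac)
        qed
        also have "\<dots> \<le> n ^ m * (C * n) ^ (n - m) * C ^ m" by (intro mult_le_mono2 C mn)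
        also have "\<dots> = (C * n) ^ m * (C * n) ^ (n - m)" by (simp add: power_mult_distrib mult_ac)
        also have "\<dots> = T" unfolding T_def using mle by (simp flip: power_add)
        finally show ?thesis .
      qed
      have "2 ^ n * card {E. loose V E} \<le> 2 ^ n * (\<Sum>R\<in>RR. card (F R))" using 1 by simp
      also have "\<dots> = (\<Sum>R\<in>RR. 2 ^ n * card (F R))" by (rule sum_distrib_left)
      also have "\<dots> \<le> (\<Sum>R\<in>RR. T)" by (intro sum_mono 2)
      also have "\<dots> = card RR * T" by simp
      also have "\<dots> \<le> 2 ^ n * T"
      proof -
        have "card RR \<le> card (Pow V)" by (rule card_mono) (use fin in \<open>auto simp: RR_def\<close>)
        then show ?thesis using fin by (simp add: card_Pow n_def)
      qed
      finally have "card {E. loose V E} \<le> T" by simp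
      then show ?thesis by (simp add: T_def n_def)
    qed
  qed
  then show ?thesis using finL by blast
qed

section \<open>Random subsets and the Park--Pham theorem\<close>

text \<open>A finite sum with real weights: identities are proved by induction on \<open>A\<close>,
  without conditions on \<open>p\<close>; only inequalities need \<open>p\<close> between 0 and
  1.\<close>

definition expect :: "'a set \<Rightarrow> real \<Rightarrow> ('a set \<Rightarrow> real) \<Rightarrow> real" where
  "expect A p F = (\<Sum>E\<in>Pow A. p ^ card E * (1 - p) ^ card (A - E) * F E)"

lemma expect_empty [simp]: "expect {} p F = F {}"
  by (simp add: expect_def)

lemma expect_insert:
  assumes "finite A" "x \<notin> A"
  shows "expect (insert x A) p F = p * expect A p (\<lambda>E. F (insert x E)) + (1 - p) * expect A p F"
proof -
  let ?w = "\<lambda>E. p ^ card E * (1 - p) ^ card (insert x A - E) * F E"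
  have inj: "inj_on (insert x) (Pow A)"
    using assms(2) by (intro inj_onI) (metis PowD insert_ident subsetD)
  have disj: "Pow A \<inter> insert x ` Pow A = {}" using assms(2) by auto
  have "expect (insert x A) p F = (\<Sum>E\<in>Pow A. ?w E) + (\<Sum>E\<in>insert x ` Pow A. ?w E)"
    unfolding expect_def Pow_insert using assms(1) disj by (intro sum.union_disjoint) auto
  also have "(\<Sum>E\<in>insert x ` Pow A. ?w E) = (\<Sum>E\<in>Pow A. ?w (insert x E))"
    by (subst sum.reindex[OF inj]) (simp only: o_def)
  also have "\<dots> = (\<Sum>E\<in>Pow A. p * (p ^ card E * (1 - p) ^ card (A - E) * F (insert x E)))"
  proof (rule sum.cong[OF refl])
    fix E assume E: "E \<in> Pow A"
    then have "x \<notin> E" "finite E" using assms finite_subset[of E A] by auto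
    then have "card (insert x E) = Suc (card E)" "insert x A - insert x E = A - E"
      using assms(2) by auto
    then show "?w (insert x E) = p * (p ^ card E * (1 - p) ^ card (A - E) * F (insert x E))" by simp
  qed
  also have "(\<Sum>E\<in>Pow A. ?w E) = (\<Sum>E\<in>Pow A. (1 - p) * (p ^ card E * (1 - p) ^ card (A - E) * F E))"
  proof (rule sum.cong[OF refl])
    fix E assume "E \<in> Pow A"
    then have "insert x A - E = insert x (A - E)" using assms by auto
    then have "card (insert x A - E) = Suc (card (A - E))" using assms by simp
    then show "?w E = (1 - p) * (p ^ card E * (1 - p) ^ card (A - E) * F E)" by simp
  qed
  finally show ?thesis by (simp add: expect_def sum_distrib_left)
qed

lemma expect_add: "expect A p (\<lambda>E. F E + G E) = expect A p F + expect A p G"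
  by (simp add: expect_def distrib_left sum.distrib)

lemma expect_cmult: "expect A p (\<lambda>E. c * F E) = c * expect A p F"
  by (simp add: expect_def sum_distrib_left mult_ac)

lemma expect_mono:
  assumes "0 \<le> p" "p \<le> 1" "\<And>E. E \<subseteq> A \<Longrightarrow> F E \<le> G E"
  shows "expect A p F \<le> expect A p G"
  unfolding expect_def using assms by (intro sum_mono mult_left_mono) auto

lemma expect_nonneg: "0 \<le> p \<Longrightarrow> p \<le> 1 \<Longrightarrow> (\<And>E. E \<subseteq> A \<Longrightarrow> 0 \<le> F E) \<Longrightarrow> 0 \<le> expect A p F"
  unfolding expect_def by (intro sum_nonneg mult_nonneg_nonneg) auto

lemma expect_const: "finite A \<Longrightarrow> expect A p (\<lambda>E. c) = c"
  by (induction A rule: finite_induct) (simp_all add: expect_insert algebra_simps)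

lemma expect_superset:
  assumes "finite A"
  shows "H \<subseteq> A \<Longrightarrow> expect A p (\<lambda>E. of_bool (H \<subseteq> E)) = p ^ card H"
  using assms
proof (induction A arbitrary: H rule: finite_induct)
  case (insert x A)
  have finH: "finite H" using insert.prems insert.hyps(1) finite_subset by auto
  show ?case
  proof (cases "x \<in> H")
    case True
    have "(\<lambda>E. of_bool (H \<subseteq> insert x E) :: real) = (\<lambda>E. of_bool (H - {x} \<subseteq> E))"
      using True by (simp add: subset_insert_iff)
    moreover have "expect A p (\<lambda>E. of_bool (H \<subseteq> E)) = expect A p (\<lambda>E. 0)"
      unfolding expect_def using True insert.hyps(2) by (intro sum.cong) auto
    moreover have "card H = Suc (card (H - {x}))" using card.remove[OF finH True] .
    ultimately show ?thesis
      using insert.IH[of "H - {x}"] insert.prems insert.hyps by (auto simp: expect_insert expect_const)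
  next
    case False
    then have "(\<lambda>E. of_bool (H \<subseteq> insert x E) :: real) = (\<lambda>E. of_bool (H \<subseteq> E))"
      by (simp add: subset_insert_iff)
    then show ?thesis
      using insert.IH[of H] insert.prems insert.hyps False by (auto simp: expect_insert algebra_simps)
  qed
qed simp

text \<open>Two rounds of exposure: an element is missed by both with probability (1 - p) (1 -
  r).\<close>

lemma expect_union:
  assumes "finite A"
  shows "expect A p (\<lambda>W. expect A r (\<lambda>W'. F (W \<union> W'))) = expect A (p + r - p * r) F"
  using assms
proof (induction A arbitrary: F rule: finite_induct)
  case (insert x A)
  have IH1: "expect A p (\<lambda>W. expect A r (\<lambda>W'. F (insert x (W \<union> W')))) = expect A (p + r - p * r) (\<lambda>E. F (insert x E))"
    using insert.IH[of "\<lambda>E. F (insert x E)"] by simp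
  show ?case
    using insert.hyps IH1 insert.IH[of F]
    by (simp add: expect_insert expect_add expect_cmult) (simp add: algebra_simps)
qed simp

text \<open>After splitting on one element \<open>x\<close>, a larger probability shifts weight from
  \<open>F E\<close> to the larger value \<open>F (insert x E)\<close>.\<close>

lemma expect_mono_prob:
  assumes "finite A" "0 \<le> p" "p \<le> r" "r \<le> 1"
  shows "(\<And>E E'. E \<subseteq> E' \<Longrightarrow> F E \<le> F E') \<Longrightarrow> expect A p F \<le> expect A r F"
  using assms(1)
proof (induction A arbitrary: F rule: finite_induct)
  case (insert x A)
  let ?F1 = "\<lambda>E. F (insert x E)"
  have 1: "expect A p ?F1 \<le> expect A r ?F1" by (rule insert.IH) (rule insert.prems, auto)
  have 2: "expect A p F \<le> expect A r F" by (rule insert.IH) (rule insert.prems)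
  have 3: "expect A r F \<le> expect A r ?F1"
    using assms by (intro expect_mono insert.prems) auto
  have "p * expect A p ?F1 + (1 - p) * expect A p F \<le> p * expect A r ?F1 + (1 - p) * expect A r F"
    using 1 2 assms by (intro add_mono mult_left_mono) auto
  also have "\<dots> = expect A r F + p * (expect A r ?F1 - expect A r F)" by (simp add: algebra_simps)
  also have "\<dots> \<le> expect A r F + r * (expect A r ?F1 - expect A r F)"
    using 3 assms by (intro add_mono mult_right_mono) auto
  also have "\<dots> = r * expect A r ?F1 + (1 - r) * expect A r F" by (simp add: algebra_simps)
  finally show ?case using insert.hyps by (simp add: expect_insert)
qed simp

section \<open>Covers, minimum fragments and repeated exposure\<close>

definition covers :: "'a set set \<Rightarrow> 'a set set \<Rightarrow> bool" where
  "covers U H \<longleftrightarrow> (\<forall>S\<in>H. \<exists>T\<in>U. T \<subseteq> S)"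

text \<open>Spreadness enters with \<open>c\<close> = 1. Other values are needed because each round
  of exposure uses up part of the cost.\<close>

definition cost_ge :: "real \<Rightarrow> 'a set \<Rightarrow> 'a set set \<Rightarrow> real \<Rightarrow> bool" where
  "cost_ge q A H c \<longleftrightarrow> (\<forall>U \<subseteq> Pow A. covers U H \<longrightarrow> c \<le> (\<Sum>T\<in>U. q ^ card T))"

text \<open>A smallest set \<open>S' - W\<close> with \<open>S' \<in> H\<close> and \<open>S' \<subseteq> W \<union> S\<close> (the minimum fragments of
  Park and Pham).\<close>

definition fragment :: "'a set set \<Rightarrow> 'a set \<Rightarrow> 'a set \<Rightarrow> 'a set" where
  "fragment H W S = arg_min card (\<lambda>T. \<exists>S'\<in>H. S' \<subseteq> W \<union> S \<and> T = S' - W)"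

lemma fragment:
  assumes "S \<in> H"
  obtains S' where "S' \<in> H" "S' \<subseteq> W \<union> S" "fragment H W S = S' - W"
    "\<And>S''. S'' \<in> H \<Longrightarrow> S'' \<subseteq> W \<union> S \<Longrightarrow> card (S' - W) \<le> card (S'' - W)"
proof -
  let ?P = "\<lambda>T. \<exists>S'\<in>H. S' \<subseteq> W \<union> S \<and> T = S' - W"
  have "?P (S - W)" using assms by auto
  then have *: "?P (fragment H W S) \<and> (\<forall>T. ?P T \<longrightarrow> card (fragment H W S) \<le> card T)"
    unfolding fragment_def by (rule arg_min_nat_lemma)
  then obtain S' where S': "S' \<in> H" "S' \<subseteq> W \<union> S" "fragment H W S = S' - W" by auto
  have "card (S' - W) \<le> card (S'' - W)" if "S'' \<in> H" "S'' \<subseteq> W \<union> S" for S''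
    using *[THEN conjunct2, rule_format, of "S'' - W"] that S'(3) by auto
  then show thesis using that S' by metis
qed

text \<open>A pair of \<open>W\<close> and a fragment \<open>T\<close> is encoded by
  \<open>Z = W \<union> T\<close> and \<open>T\<close>. The set \<open>hat Z\<close> is a member of
  \<open>H\<close> inside \<open>Z\<close> that depends on \<open>Z\<close> alone, and minimality of
  the fragment forces \<open>T \<subseteq> hat Z\<close>; so each \<open>Z\<close> has at most 2^l
  partners \<open>T\<close>. Passing from \<open>W\<close> to \<open>Z\<close> changes the weight by
  the factor (p / (1 - p))^|T|, which turns q^|T| into at most (q / p)^|T|.\<close>

lemma sum_large_fragments_le:
  assumes fin: "finite A" and H: "H \<subseteq> Pow A" and l: "\<And>S. S \<in> H \<Longrightarrow> card S \<le> l"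
    and p: "0 < p" "p \<le> 1" and q: "0 \<le> q" "q \<le> p"
  shows "expect A p (\<lambda>W. \<Sum>T\<in>{T \<in> fragment H W ` H. t < card T}. q ^ card T) \<le> 2 ^ l * (q / p) ^ (t + 1)"
proof -
  define D where "D = (\<lambda>W. {T \<in> fragment H W ` H. t < card T})"
  define w where "w = (\<lambda>E. p ^ card E * (1 - p) ^ card (A - E))"
  define hat where "hat = (\<lambda>Z. SOME S. S \<in> H \<and> S \<subseteq> Z)"
  define TT where "TT = (\<lambda>Z. {T \<in> Pow (hat Z). t < card T \<and> hat Z \<in> H})"
  have finS: "finite S" if "S \<in> H" for S by (rule finite_subset[OF _ fin]) (use that H in auto)
  have finH: "finite H" by (rule finite_subset[OF H]) (use fin in simp)
  have D: "T \<inter> W = {} \<and> T \<subseteq> A \<and> T \<in> TT (W \<union> T)" if W: "W \<subseteq> A" and T: "T \<in> D W" for W T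
  proof -
    obtain S where S: "S \<in> H" "T = fragment H W S" and tT: "t < card T" using T by (auto simp: D_def)
    obtain S' where S': "S' \<in> H" "S' \<subseteq> W \<union> S" "T = S' - W"
      and min: "\<And>S''. S'' \<in> H \<Longrightarrow> S'' \<subseteq> W \<union> S \<Longrightarrow> card (S' - W) \<le> card (S'' - W)"
      by (rule fragment[OF S(1), of W]) (auto simp: S(2))
    have "S' \<in> H \<and> S' \<subseteq> W \<union> T" using S' by auto
    then have hat: "hat (W \<union> T) \<in> H \<and> hat (W \<union> T) \<subseteq> W \<union> T" unfolding hat_def by (rule someI)
    \<comment> \<open>\<open>hat (W \<union> T)\<close> competes with \<open>S'\<close> in the
      definition of the fragment, so its part outside \<open>W\<close>, a subset of
      \<open>T\<close>, has at least as many elements as \<open>T\<close>.\<close>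
    have "W \<union> T \<subseteq> W \<union> S" using S' by auto
    then have "card T \<le> card (hat (W \<union> T) - W)" using min[of "hat (W \<union> T)"] hat S'(3) by auto
    moreover have "hat (W \<union> T) - W \<subseteq> T" using hat by auto
    moreover have "finite T" using S'(3) finS[OF S'(1)] by auto
    ultimately have "hat (W \<union> T) - W = T" by (metis card_seteq)
    then have "T \<subseteq> hat (W \<union> T)" by auto
    then show ?thesis using S' H tT hat by (auto simp: TT_def)
  qed
  have w: "w W * q ^ card T \<le> w (W \<union> T) * (q / p) ^ (t + 1)" if W: "W \<subseteq> A" and T: "T \<in> D W" for W T
  proof -
    have fT: "finite T" "finite W" using D[OF W T] finite_subset[OF _ fin] W by auto
    have c1: "card (W \<union> T) = card W + card T" using D[OF W T] fT by (intro card_Un_disjoint) auto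
    have "A - W = (A - (W \<union> T)) \<union> T" using D[OF W T] by auto
    then have c2: "card (A - W) = card (A - (W \<union> T)) + card T"
      using card_Un_disjoint[of "A - (W \<union> T)" T] fT(1) fin by auto
    have tc: "t + 1 \<le> card T" using T by (auto simp: D_def)
    have "w W * q ^ card T = w (W \<union> T) * (((1 - p) * q) / p) ^ card T"
      using p by (simp add: w_def c1 c2 power_add power_mult_distrib power_divide)
    also have "\<dots> \<le> w (W \<union> T) * (q / p) ^ card T"
    proof (intro mult_left_mono power_mono)
      have "(1 - p) * q \<le> 1 * q" using p q by (intro mult_right_mono) auto
      then show "(1 - p) * q / p \<le> q / p" using p by (simp add: divide_right_mono)
    qed (use p q in \<open>auto simp: w_def\<close>)
    also have "\<dots> \<le> w (W \<union> T) * (q / p) ^ (t + 1)"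
      using p q tc by (intro mult_left_mono power_decreasing) (auto simp: w_def)
    finally show ?thesis .
  qed
  have finD: "finite (D W)" for W using finH by (simp add: D_def)
  have finT: "finite (TT Z)" if "Z \<subseteq> A" for Z
  proof (cases "hat Z \<in> H")
    case True
    then show ?thesis using finS[OF True] by (simp add: TT_def)
  qed (simp add: TT_def)
  have cT: "card (TT Z) \<le> 2 ^ l" if "Z \<subseteq> A" for Z
  proof (cases "hat Z \<in> H")
    case True
    have "card (TT Z) \<le> card (Pow (hat Z))" using finS[OF True] by (intro card_mono) (auto simp: TT_def)
    also have "\<dots> = 2 ^ card (hat Z)" using finS[OF True] by (simp add: card_Pow)
    also have "\<dots> \<le> 2 ^ l" using l[OF True] by (intro power_increasing) auto
    finally show ?thesis .
  qed (simp add: TT_def)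
  let ?x = "(q / p) ^ (t + 1)"
  have "expect A p (\<lambda>W. \<Sum>T\<in>D W. q ^ card T) = (\<Sum>(W, T)\<in>Sigma (Pow A) D. w W * q ^ card T)"
    unfolding expect_def w_def using fin finD by (simp add: sum_distrib_left sum.Sigma)
  also have "\<dots> \<le> (\<Sum>(W, T)\<in>Sigma (Pow A) D. w (W \<union> T) * ?x)"
    using w by (intro sum_mono) auto
  also have "\<dots> = (\<Sum>(Z, T)\<in>(\<lambda>(W, T). (W \<union> T, T)) ` Sigma (Pow A) D. w Z * ?x)"
  proof (subst sum.reindex)
    show "inj_on (\<lambda>(W, T). (W \<union> T, T)) (Sigma (Pow A) D)"
    proof (rule inj_onI, clarify)
      fix W T W' T' assume a: "W \<subseteq> A" "W' \<subseteq> A" "T' \<in> D W" "T' \<in> D W'" "W \<union> T' = W' \<union> T'"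
      then have "T' \<inter> W = {}" "T' \<inter> W' = {}" using D by auto
      then show "W = W' \<and> T' = T'" using a(5) by auto
    qed
  qed (auto intro!: sum.cong)
  also have "\<dots> \<le> (\<Sum>(Z, T)\<in>Sigma (Pow A) TT. w Z * ?x)"
  proof (rule sum_mono2)
    show "finite (Sigma (Pow A) TT)" using fin finT by auto
    show "(\<lambda>(W, T). (W \<union> T, T)) ` Sigma (Pow A) D \<subseteq> Sigma (Pow A) TT" using D by auto
    show "0 \<le> (case b of (Z, T) \<Rightarrow> w Z * ?x)" for b using p q by (auto simp: w_def split: prod.splits)
  qed
  also have "\<dots> = (\<Sum>Z\<in>Pow A. \<Sum>T\<in>TT Z. w Z * ?x)"
    by (rule sum.Sigma[symmetric]) (use fin finT in auto)
  also have "\<dots> \<le> (\<Sum>Z\<in>Pow A. w Z * (2 ^ l * ?x))"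
  proof (rule sum_mono)
    fix Z assume "Z \<in> Pow A"
    then have "real (card (TT Z)) \<le> 2 ^ l" using cT[of Z] by (metis PowD of_nat_le_iff of_nat_numeral of_nat_power)
    then have "real (card (TT Z)) * (w Z * ?x) \<le> 2 ^ l * (w Z * ?x)"
      using p q by (intro mult_right_mono) (auto simp: w_def)
    then show "(\<Sum>T\<in>TT Z. w Z * ?x) \<le> w Z * (2 ^ l * ?x)" by (simp add: mult_ac)
  qed
  also have "\<dots> = expect A p (\<lambda>Z. 2 ^ l * ?x)" by (simp add: expect_def w_def)
  also have "\<dots> = 2 ^ l * ?x" by (rule expect_const[OF fin])
  finally show ?thesis by (simp add: D_def)
qed

text \<open>Bounds the size of the sets that are left \<open>m\<close> rounds before the end.\<close>

definition round_size :: "nat \<Rightarrow> nat" where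
  "round_size m = (case m of 0 \<Rightarrow> 0 | Suc i \<Rightarrow> 2 ^ i)"

text \<open>The density of a union of \<open>m\<close> independent random sets of density
  \<open>p\<close>.\<close>

fun round_prob :: "real \<Rightarrow> nat \<Rightarrow> real" where
  "round_prob p 0 = 0" |
  "round_prob p (Suc m) = p + round_prob p m - p * round_prob p m"

lemma round_prob_bounds:
  assumes "0 \<le> p" "p \<le> 1"
  shows "0 \<le> round_prob p m \<and> round_prob p m \<le> 1 \<and> round_prob p m \<le> real m * p"
proof (induction m)
  case (Suc m)
  have IH: "0 \<le> round_prob p m" "round_prob p m \<le> 1" "round_prob p m \<le> real m * p" using Suc by auto
  have "p * round_prob p m \<le> round_prob p m" using IH assms by (simp add: mult_left_le_one_le)
  moreover have "0 \<le> p * round_prob p m" using IH assms by simp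
  moreover have "(1 - p) * (1 - round_prob p m) = 1 - p - round_prob p m + p * round_prob p m"
    by (simp add: algebra_simps)
  moreover have "0 \<le> (1 - p) * (1 - round_prob p m)" using IH assms by simp
  moreover have "real (Suc m) * p = p + real m * p" by (simp add: algebra_simps)
  ultimately show ?case unfolding round_prob.simps using IH assms by linarith
qed simp

text \<open>Expose a random \<open>W\<close> first. Large fragments are covered by themselves at
  cost \<open>u W\<close>, and the small ones form a family of cost at least \<open>c - u W\<close>,
  to which induction applies. Since the failure probability is multiplied by the cost, the bound is
  linear in \<open>u W\<close> and can be averaged over \<open>W\<close>, with no exceptional sets
  \<open>W\<close> to be treated apart.\<close>

lemma cost_failure_bound:
  assumes fin: "finite A" and p: "0 < p" "p \<le> 1" and q: "0 \<le> q" "q \<le> p"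
  shows "H \<subseteq> Pow A \<Longrightarrow> (\<And>S. S \<in> H \<Longrightarrow> card S \<le> round_size m) \<Longrightarrow> cost_ge q A H c \<Longrightarrow>
    c * expect A (round_prob p m) (\<lambda>E. of_bool (\<not> (\<exists>S\<in>H. S \<subseteq> E)))
      \<le> (\<Sum>i<m. 2 ^ round_size (Suc i) * (q / p) ^ (round_size i + 1))"
proof (induction m arbitrary: H c)
  case 0
  have "S = {}" if "S \<in> H" for S
  proof -
    have "finite S" by (rule finite_subset[OF _ fin]) (use that 0(1) in auto)
    then show ?thesis using 0(2)[OF that] by (simp add: round_size_def)
  qed
  then consider "H = {}" | "{} \<in> H" by auto
  then show ?case
  proof cases
    case 1
    \<comment> \<open>The empty cover has cost 0.\<close>
    then have "c \<le> 0" using 0(3) unfolding cost_ge_def by (auto simp: covers_def dest: spec[of _ "{}"])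
    moreover have "0 \<le> expect A (round_prob p 0) (\<lambda>E. of_bool (\<not> (\<exists>S\<in>H. S \<subseteq> E)))"
      by (intro expect_nonneg) auto
    ultimately show ?thesis by (simp add: mult_nonpos_nonneg)
  next
    case 2
    then have "(\<lambda>E. of_bool (\<not> (\<exists>S\<in>H. S \<subseteq> E)) :: real) = (\<lambda>E. 0)"
      by (auto simp: fun_eq_iff intro: bexI[of _ "{}"])
    then show ?thesis using expect_const[OF fin, of _ 0] by simp
  qed
next
  case (Suc m)
  define s where "s = (\<Sum>i<m. 2 ^ round_size (Suc i) * (q / p) ^ (round_size i + 1))"
  define H' where "H' = (\<lambda>W. {T \<in> fragment H W ` H. card T \<le> round_size m})"
  define D where "D = (\<lambda>W. {T \<in> fragment H W ` H. round_size m < card T})"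
  define u where "u = (\<lambda>W. \<Sum>T\<in>D W. q ^ card T)"
  define fl where "fl = (\<lambda>W. expect A (round_prob p m) (\<lambda>W'. of_bool (\<not> (\<exists>S\<in>H. S \<subseteq> W \<union> W'))))"
  have rp: "0 \<le> round_prob p m" "round_prob p m \<le> 1" using round_prob_bounds[of p m] p by auto
  have finH: "finite H" by (rule finite_subset[OF Suc.prems(1)]) (use fin in simp)
  have frag: "fragment H W S \<subseteq> S \<and> fragment H W S \<subseteq> A" if SH: "S \<in> H" for W S
  proof -
    obtain S' where "S' \<subseteq> W \<union> S" "fragment H W S = S' - W" using fragment[OF SH, of W] by metis
    then show ?thesis using Suc.prems(1) SH by auto
  qed
  have step: "c * fl W \<le> s + u W" if W: "W \<subseteq> A" for W
  proof -
    have fl: "fl W \<le> expect A (round_prob p m) (\<lambda>E. of_bool (\<not> (\<exists>S\<in>H' W. S \<subseteq> E)))"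
      unfolding fl_def
    proof (intro expect_mono rp)
      fix E
      have "\<exists>S\<in>H. S \<subseteq> W \<union> E" if ex: "\<exists>T\<in>H' W. T \<subseteq> E"
      proof -
        obtain S where S: "S \<in> H" "fragment H W S \<subseteq> E" using ex by (auto simp: H'_def)
        obtain S' where "S' \<in> H" "fragment H W S = S' - W" using fragment[OF S(1), of W] by metis
        then show ?thesis using S(2) by auto
      qed
      then show "of_bool (\<not> (\<exists>S\<in>H. S \<subseteq> W \<union> E)) \<le> (of_bool (\<not> (\<exists>S\<in>H' W. S \<subseteq> E)) :: real)" by auto
    qed
    have fl01: "0 \<le> fl W" "fl W \<le> 1"
    proof -
      show "0 \<le> fl W" unfolding fl_def by (intro expect_nonneg rp) auto
      have "fl W \<le> expect A (round_prob p m) (\<lambda>E. 1)" unfolding fl_def by (intro expect_mono rp) auto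
      then show "fl W \<le> 1" by (simp add: expect_const[OF fin])
    qed
    have u0: "0 \<le> u W" unfolding u_def using q by (intro sum_nonneg) auto
    have s0: "0 \<le> s" unfolding s_def using p q by (intro sum_nonneg) auto
    have "cost_ge q A (H' W) (c - u W)"
      unfolding cost_ge_def
    proof (intro allI impI)
      fix U assume U: "U \<subseteq> Pow A" "covers U (H' W)"
      \<comment> \<open>A set in \<open>H\<close> with a small fragment is covered through its
        fragment, and one with a large fragment by the fragment itself.\<close>
      have "covers (U \<union> D W) H"
        unfolding covers_def
      proof
        fix S assume S: "S \<in> H"
        show "\<exists>T\<in>U \<union> D W. T \<subseteq> S"
        proof (cases "card (fragment H W S) \<le> round_size m")
          case True
          then have "fragment H W S \<in> H' W" using S by (auto simp: H'_def)
          then obtain T where "T \<in> U" "T \<subseteq> fragment H W S" using U(2) by (auto simp: covers_def)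
          then show ?thesis using frag[OF S, of W] by auto
        next
          case False
          then have "fragment H W S \<in> D W" using S by (auto simp: D_def)
          then show ?thesis using frag[OF S, of W] by auto
        qed
      qed
      moreover have "D W \<subseteq> Pow A"
      proof
        fix T assume "T \<in> D W"
        then obtain S where "S \<in> H" "T = fragment H W S" by (auto simp: D_def)
        then show "T \<in> Pow A" using frag[of S W] by simp
      qed
      then have "U \<union> D W \<subseteq> Pow A" using U(1) by simp
      ultimately have "c \<le> (\<Sum>T\<in>U \<union> D W. q ^ card T)" using Suc.prems(3) unfolding cost_ge_def by auto
      also have "\<dots> \<le> (\<Sum>T\<in>U. q ^ card T) + u W"
      proof -
        have "finite U" by (rule finite_subset[OF U(1)]) (use fin in simp)
        moreover have "finite (D W)" using finH by (simp add: D_def)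
        moreover have "0 \<le> (\<Sum>T\<in>U \<inter> D W. q ^ card T)" using q by (intro sum_nonneg) auto
        ultimately show ?thesis unfolding u_def by (simp add: sum_Un)
      qed
      finally show "c - u W \<le> (\<Sum>T\<in>U. q ^ card T)" by simp
    qed
    then have "(c - u W) * expect A (round_prob p m) (\<lambda>E. of_bool (\<not> (\<exists>S\<in>H' W. S \<subseteq> E))) \<le> s"
      unfolding s_def by (intro Suc.IH) (use frag in \<open>auto simp: H'_def\<close>)
    \<comment> \<open>If \<open>u W\<close> exceeds the budget \<open>c\<close>, induction gives
      nothing, but then \<open>c * fl W \<le> u W\<close> holds because
      \<open>fl W \<le> 1\<close>.\<close>
    show ?thesis
    proof (cases "c - u W \<le> 0")
      case True
      then have "(c - u W) * fl W \<le> 0" using fl01 by (simp add: mult_nonpos_nonneg)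
      moreover have "u W * fl W \<le> u W" using u0 fl01 by (simp add: mult_left_le)
      ultimately show ?thesis using s0 by (simp add: algebra_simps)
    next
      case False
      then have "(c - u W) * fl W \<le> (c - u W) * expect A (round_prob p m) (\<lambda>E. of_bool (\<not> (\<exists>S\<in>H' W. S \<subseteq> E)))"
        using fl by (intro mult_left_mono) auto
      also have "\<dots> \<le> s" by fact
      finally have "(c - u W) * fl W \<le> s" .
      moreover have "u W * fl W \<le> u W" using u0 fl01 by (simp add: mult_left_le)
      ultimately show ?thesis by (simp add: algebra_simps)
    qed
  qed
  have "c * expect A (round_prob p (Suc m)) (\<lambda>E. of_bool (\<not> (\<exists>S\<in>H. S \<subseteq> E))) = expect A p (\<lambda>W. c * fl W)"
    unfolding fl_def expect_cmult
    by (simp only: expect_union[OF fin, of p "round_prob p m" "\<lambda>E. of_bool (\<not> (\<exists>S\<in>H. S \<subseteq> E))"] round_prob.simps)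
  also have "\<dots> \<le> expect A p (\<lambda>W. s + u W)" using p step by (intro expect_mono) auto
  also have "\<dots> = s + expect A p u" by (simp add: expect_add expect_const[OF fin])
  also have "expect A p u \<le> 2 ^ round_size (Suc m) * (q / p) ^ (round_size m + 1)"
    unfolding u_def D_def by (rule sum_large_fragments_le[OF fin Suc.prems(1,2) p q])
  finally show ?case by (simp add: s_def)
qed

text \<open>For i = j + 1 the term equals x (4 x)^(2^j), since 2^(2^i) = 4^(2^j); the bound 1/8
  makes the base at most 1/2, and a geometric series remains.\<close>

lemma sum_round_errors:
  assumes "0 \<le> x" "x \<le> 1 / 8"
  shows "(\<Sum>i<m. 2 ^ round_size (Suc i) * x ^ (round_size i + 1)) \<le> 4 * (x::real)"
proof -
  have "2 ^ round_size (Suc i) * x ^ (round_size i + 1) \<le> 2 * x * (1 / 2) ^ i" for i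
  proof (cases i)
    case 0
    then show ?thesis by (simp add: round_size_def)
  next
    case (Suc j)
    have "(2::real) ^ (2 ^ i) = 4 ^ (2 ^ j)" by (simp add: Suc power_mult)
    then have "2 ^ round_size (Suc i) * x ^ (round_size i + 1) = x * (4 * x) ^ (2 ^ j)"
      by (simp add: round_size_def Suc power_mult_distrib)
    also have "\<dots> \<le> x * (1 / 2) ^ (2 ^ j)" using assms by (intro mult_left_mono power_mono) auto
    also have "\<dots> \<le> x * (1 / 2) ^ j"
    proof -
      have "j \<le> 2 ^ j" using less_exp[of j] by linarith
      then show ?thesis using assms by (intro mult_left_mono power_decreasing) auto
    qed
    also have "\<dots> = 2 * x * (1 / 2) ^ i" by (simp add: Suc)
    finally show ?thesis .
  qed
  then have "(\<Sum>i<m. 2 ^ round_size (Suc i) * x ^ (round_size i + 1)) \<le> (\<Sum>i<m. 2 * x * (1 / 2) ^ i)"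
    by (rule sum_mono)
  also have "\<dots> = 2 * x * (\<Sum>i<m. (1 / 2) ^ i)" by (simp add: sum_distrib_left)
  also have "(\<Sum>i<m. (1 / 2 :: real) ^ i) \<le> 2"
    by (simp add: sum_gp_strict)
  finally show ?thesis using assms by (simp add: mult_left_mono)
qed

text \<open>The probability \<open>P\<close> is spread evenly over m + 1 rounds, in which the bound
  on the sizes goes from 2^m down to 1 by halving and finally to 0.\<close>

theorem spread_family_failure_bound:
  assumes fin: "finite A" and H: "H \<subseteq> Pow A" and size: "\<And>S. S \<in> H \<Longrightarrow> card S \<le> 2 ^ m"
    and cost: "cost_ge q A H 1" and q: "0 \<le> q" and P: "P \<le> 1" "0 < P" "8 * q * real (Suc m) \<le> P"
  shows "expect A P (\<lambda>E. of_bool (\<not> (\<exists>S\<in>H. S \<subseteq> E))) \<le> 4 * q * real (Suc m) / P"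
proof -
  define p where "p = P / real (Suc m)"
  have p: "0 < p" "p \<le> 1"
  proof -
    show "0 < p" using P by (simp add: p_def)
    have "P \<le> 1 * real (Suc m)" using P by simp
    then show "p \<le> 1" unfolding p_def by (simp add: divide_le_eq)
  qed
  have "8 * q \<le> p" using P(3) by (simp add: p_def pos_le_divide_eq)
  then have qp: "q \<le> p" "q / p \<le> 1 / 8" using p q by (auto simp: divide_le_eq)
  let ?fail = "\<lambda>E. of_bool (\<not> (\<exists>S\<in>H. S \<subseteq> E)) :: real"
  have rp: "0 \<le> round_prob p (Suc m)" "round_prob p (Suc m) \<le> P"
    using round_prob_bounds[of p "Suc m"] p by (auto simp: p_def)
  have "expect A (round_prob p (Suc m)) (\<lambda>E. - ?fail E) \<le> expect A P (\<lambda>E. - ?fail E)"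
    by (rule expect_mono_prob[OF fin rp P(1)]) (auto; blast)
  moreover have neg: "expect A r (\<lambda>E. - ?fail E) = - expect A r ?fail" for r
    using expect_cmult[of A r "-1" ?fail] by simp
  ultimately have "expect A P ?fail \<le> expect A (round_prob p (Suc m)) ?fail" by simp
  also have "\<dots> \<le> (\<Sum>i<Suc m. 2 ^ round_size (Suc i) * (q / p) ^ (round_size i + 1))"
    using cost_failure_bound[OF fin p q qp(1) H _ cost, of "Suc m"] size by (simp add: round_size_def)
  also have "\<dots> \<le> 4 * (q / p)" using q p qp by (intro sum_round_errors) auto
  also have "\<dots> = 4 * q * real (Suc m) / P" by (simp add: p_def)
  finally show ?thesis .
qed

section \<open>The first moment\<close>

lemma finite_all_edges: "finite (all_edges N)"
  by (rule finite_subset[of _ "Pow {0..<N}"]) (auto simp: all_edges_def)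

lemma prob_Gnp_eq_expect: "prob_Gnp N p P = expect (all_edges N) p (\<lambda>E. of_bool (P E))"
proof -
  have "expect (all_edges N) p (\<lambda>E. of_bool (P E))
      = (\<Sum>E\<in>{E \<in> Pow (all_edges N). P E}. p ^ card E * (1 - p) ^ card (all_edges N - E))"
    unfolding expect_def sum.inter_filter[OF finite_Pow_iff[THEN iffD2, OF finite_all_edges]]
    by (intro sum.cong) auto
  also have "\<dots> = prob_Gnp N p P"
    unfolding prob_Gnp_def
    by (intro sum.cong) (auto simp: card_Diff_subset finite_subset[OF _ finite_all_edges])
  finally show ?thesis by simp
qed

lemma prob_Gnp_bounds: "0 \<le> p \<Longrightarrow> p \<le> 1 \<Longrightarrow> 0 \<le> prob_Gnp N p P \<and> prob_Gnp N p P \<le> 1"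
  using expect_nonneg[of p "all_edges N" "\<lambda>E. of_bool (P E)"]
    expect_mono[of p "all_edges N" "\<lambda>E. of_bool (P E)" "\<lambda>E. 1"]
  by (simp add: prob_Gnp_eq_expect expect_const[OF finite_all_edges])

lemma expect_sum: "finite I \<Longrightarrow> expect A p (\<lambda>E. \<Sum>i\<in>I. F i E) = (\<Sum>i\<in>I. expect A p (F i))"
proof (induction I rule: finite_induct)
  case empty
  then show ?case by (simp add: expect_def)
qed (simp add: expect_add)

lemma prob_has_spanning_mpg_le:
  assumes p: "0 \<le> p" "p \<le> 1"
  shows "prob_Gnp N p (has_spanning_mpg g N)
    \<le> (\<Sum>H\<in>{H. H \<subseteq> all_edges N \<and> maximal_planar_girth g {0..<N} H}. p ^ card H)"
proof -
  let ?M = "{H. H \<subseteq> all_edges N \<and> maximal_planar_girth g {0..<N} H}"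
  have fin: "finite ?M" by (rule finite_subset[of _ "Pow (all_edges N)"]) (auto simp: finite_all_edges)
  have "prob_Gnp N p (has_spanning_mpg g N) \<le> expect (all_edges N) p (\<lambda>E. \<Sum>H\<in>?M. of_bool (H \<subseteq> E))"
    unfolding prob_Gnp_eq_expect
  proof (intro expect_mono p)
    fix E assume E: "E \<subseteq> all_edges N"
    show "of_bool (has_spanning_mpg g N E) \<le> (\<Sum>H\<in>?M. of_bool (H \<subseteq> E) :: real)"
    proof (cases "has_spanning_mpg g N E")
      case True
      then obtain H where H: "H \<in> ?M" "H \<subseteq> E" using E by (auto simp: has_spanning_mpg_def)
      have "of_bool (H \<subseteq> E) \<le> (\<Sum>H\<in>?M. of_bool (H \<subseteq> E) :: real)"
        by (rule member_le_sum) (use H(1) fin in auto)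
      then show ?thesis using H True by simp
    qed (simp add: sum_nonneg)
  qed
  also have "\<dots> = (\<Sum>H\<in>?M. p ^ card H)"
    unfolding expect_sum[OF fin] by (intro sum.cong refl expect_superset finite_all_edges) auto
  finally show ?thesis .
qed

lemma edges_on_all_edges: "E \<subseteq> all_edges N \<Longrightarrow> edges_on {0..<N} E"
  by (auto simp: edges_on_def all_edges_def)

theorem lower_threshold:
  fixes k :: nat
  assumes k: "k \<ge> 3"
  shows "\<exists>c1 :: real. c1 > 0 \<and> (\<forall>p :: nat \<Rightarrow> real. (\<forall>n. 0 \<le> p n \<and> p n \<le> 1) \<longrightarrow>
     eventually (\<lambda>n. p n \<le> (c1 / real n) powr ((real (2*k) - 2) / real (2*k))) sequentially \<longrightarrow>
     (\<lambda>n. prob_Gnp ((k - 1) * n + 2) (p n) (has_spanning_mpg (2*k) ((k - 1) * n + 2))) \<longlonglongrightarrow> 0)"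
proof -
  obtain C0 :: nat where C0: "\<And>V :: nat set. finite V \<Longrightarrow>
      finite {E. loose V E} \<and> card {E. loose V E} \<le> (C0 * card V) ^ card V"
    using card_loose_graphs[where 'a = nat] by auto
  \<comment> \<open>Chosen so that \<open>D * n\<close> dominates C0 N, using N \<le> (k + 1)
    n.\<close>
  define D where "D = real ((C0 + 1) * (k + 1))"
  have D: "D \<ge> 1" by (simp add: D_def)
  \<comment> \<open>Half of what would make \<open>D * n * (c1 / n)\<close> equal to 1; the
    resulting factor 2^(-n) beats the quadratic one.\<close>
  define c1 where "c1 = 1 / (2 * D)"
  have c1: "c1 > 0" using D by (simp add: c1_def)
  let ?N = "\<lambda>n. (k - 1) * n + 2"
  have main: "prob_Gnp (?N n) p (has_spanning_mpg (2*k) (?N n)) \<le> (D * real n)\<^sup>2 * (1 / 2) ^ n"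
    if n: "n \<ge> 1" and p: "0 \<le> p" "p \<le> 1"
      and ple: "p \<le> (c1 / real n) powr ((real (2*k) - 2) / real (2*k))" for n p
  proof -
    let ?M = "{H. H \<subseteq> all_edges (?N n) \<and> maximal_planar_girth (2*k) {0..<?N n} H}"
    have cardH: "card H = k * n" if "H \<in> ?M" for H
    proof -
      have "real (card H) = real (2*k) / (real (2*k) - 2) * (real (card {0..<?N n}) - 2)"
        using that by (simp add: maximal_planar_girth_def)
      also have "real (card {0..<?N n}) - 2 = (real k - 1) * real n" using k by (simp add: of_nat_diff)
      also have "real (2*k) / (real (2*k) - 2) = real k / (real k - 1)"
      proof -
        have "real k - 1 \<noteq> 0" "2 * real k - 2 \<noteq> 0" using k by auto
        then show ?thesis by (simp add: frac_eq_eq algebra_simps)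
      qed
      also have "real k / (real k - 1) * ((real k - 1) * real n) = real (k * n)" using k by simp
      finally show ?thesis by (simp only: of_nat_eq_iff)
    qed
    have "?M \<subseteq> {E. loose {0..<?N n} E}"
      using planar_imp_loose edges_on_all_edges by (auto simp: maximal_planar_girth_def)
    then have "card ?M \<le> card {E. loose {0..<?N n} E}" using C0[of "{0..<?N n}"] by (intro card_mono) auto
    also have "\<dots> \<le> (C0 * ?N n) ^ ?N n" using C0[of "{0..<?N n}"] by simp
    also have "\<dots> \<le> ((C0 + 1) * ((k + 1) * n)) ^ ?N n"
    proof (intro power_mono mult_le_mono)
      have "?N n \<le> (k - 1) * n + 2 * n" using n by simp
      also have "\<dots> = (k + 1) * n" using k by (simp flip: add_mult_distrib)
      finally show "?N n \<le> (k + 1) * n" .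
    qed auto
    finally have "real (card ?M) \<le> real (((C0 + 1) * ((k + 1) * n)) ^ ?N n)" by (simp only: of_nat_le_iff)
    also have "\<dots> = (D * real n) ^ ?N n"
    proof -
      have "real ((C0 + 1) * ((k + 1) * n)) = D * real n" by (simp only: D_def of_nat_mult mult.assoc)
      then show ?thesis by (simp only: of_nat_power)
    qed
    finally have cM: "real (card ?M) \<le> (D * real n) ^ ?N n" .
    have cn: "0 < c1 / real n" using c1 n by simp
    have "p ^ (k * n) \<le> ((c1 / real n) powr ((real (2*k) - 2) / real (2*k))) ^ (k * n)"
      using ple p by (intro power_mono) auto
    also have "\<dots> = (c1 / real n) powr ((real (2*k) - 2) / real (2*k) * real (k * n))"
    proof -
      have "0 < (c1 / real n) powr ((real (2*k) - 2) / real (2*k))"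
        using c1 n by (simp add: powr_gt_zero)
      from powr_realpow[OF this, of "k * n"] show ?thesis by (simp only: powr_powr)
    qed
    also have "(real (2*k) - 2) / real (2*k) * real (k * n) = real ((k - 1) * n)"
      using k by (simp add: of_nat_diff field_simps)
    also have "(c1 / real n) powr real ((k - 1) * n) = (c1 / real n) ^ ((k - 1) * n)"
      using cn by (simp only: powr_realpow)
    finally have pk: "p ^ (k * n) \<le> (c1 / real n) ^ ((k - 1) * n)" .
    have "prob_Gnp (?N n) p (has_spanning_mpg (2*k) (?N n)) \<le> (\<Sum>H\<in>?M. p ^ card H)"
      by (rule prob_has_spanning_mpg_le[OF p])
    also have "\<dots> = real (card ?M) * p ^ (k * n)" using cardH by simp
    also have "\<dots> \<le> (D * real n) ^ ?N n * (c1 / real n) ^ ((k - 1) * n)"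
      using cM pk p by (intro mult_mono) auto
    \<comment> \<open>The count has exponent (k - 1) n + 2, the probability only (k - 1) n; the
      square is what is left over.\<close>
    also have "\<dots> = (D * real n)\<^sup>2 * (D * real n * (c1 / real n)) ^ ((k - 1) * n)"
    proof -
      have "x ^ (m + 2) * y ^ m = x\<^sup>2 * (x * y) ^ m" for x y :: real and m :: nat
        by (simp add: power_add power_mult_distrib power2_eq_square)
      then show ?thesis .
    qed
    also have "D * real n * (c1 / real n) = 1 / 2" using D n by (simp add: c1_def)
    also have "(D * real n)\<^sup>2 * (1 / 2) ^ ((k - 1) * n) \<le> (D * real n)\<^sup>2 * (1 / 2) ^ n"
      using k by (intro mult_left_mono power_decreasing) auto
    finally show ?thesis .
  qed
  have lim: "(\<lambda>n. (D * real n)\<^sup>2 * (1 / 2) ^ n) \<longlonglongrightarrow> 0"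
    using D by real_asymp
  show ?thesis
  proof (intro exI[of _ c1] conjI c1 allI impI)
    fix p :: "nat \<Rightarrow> real"
    assume p: "\<forall>n. 0 \<le> p n \<and> p n \<le> 1"
      and ev: "eventually (\<lambda>n. p n \<le> (c1 / real n) powr ((real (2*k) - 2) / real (2*k))) sequentially"
    show "(\<lambda>n. prob_Gnp (?N n) (p n) (has_spanning_mpg (2*k) (?N n))) \<longlonglongrightarrow> 0"
    proof (rule tendsto_sandwich[OF _ _ tendsto_const lim])
      show "eventually (\<lambda>n. 0 \<le> prob_Gnp (?N n) (p n) (has_spanning_mpg (2*k) (?N n))) sequentially"
        using p prob_Gnp_bounds by auto
      show "eventually (\<lambda>n. prob_Gnp (?N n) (p n) (has_spanning_mpg (2*k) (?N n))
          \<le> (D * real n)\<^sup>2 * (1 / 2) ^ n) sequentially"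
        using ev eventually_ge_at_top[of 1] by eventually_elim (use p main in auto)
    qed
  qed
qed

section \<open>Copies of a graph that contain a given forest\<close>

text \<open>The index set \<open>I\<close> describes a forest: distinct edges have distinct upper
  ends, and the rank \<open>\<rho>\<close> rules out cycles. A vertex of largest rank is never a
  lower end; once the other images are fixed, its image has at most \<open>d\<close> values if it is
  an upper end, and \<open>card B\<close> otherwise.\<close>

lemma card_forest_maps_le:
  fixes top low :: "'i \<Rightarrow> 'a" and \<rho> :: "'a \<Rightarrow> nat" and B :: "'b set"
  assumes finB: "finite B" and deg: "\<And>x. card {y \<in> B. adj x y} \<le> d"
    and finW: "finite W"
  shows "finite I \<Longrightarrow> inj_on top I \<Longrightarrow> (\<And>i. i \<in> I \<Longrightarrow> top i \<in> W \<and> low i \<in> W \<and> \<rho> (low i) < \<rho> (top i)) \<Longrightarrow>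
    card {g \<in> W \<rightarrow>\<^sub>E B. \<forall>i\<in>I. adj (g (low i)) (g (top i))} \<le> d ^ card I * card B ^ (card W - card I)"
  using finW
proof (induction "card W" arbitrary: W I)
  case 0
  then have "W = {}" by simp
  then have "I = {}" using 0 by auto
  have "card {g \<in> W \<rightarrow>\<^sub>E B. \<forall>i\<in>I. adj (g (low i)) (g (top i))} \<le> card {\<lambda>x::'a. undefined :: 'b}"
    using \<open>W = {}\<close> by (intro card_mono) auto
  then show ?case using \<open>I = {}\<close> \<open>W = {}\<close> by simp
next
  case (Suc n)
  have Wne: "W \<noteq> {}" using Suc.hyps(2) by auto
  have "Max (\<rho> ` W) \<in> \<rho> ` W" using Suc.prems(4) Wne by (intro Max_in) auto
  then obtain v where "v \<in> W" "Max (\<rho> ` W) = \<rho> v" by auto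
  then have v: "v \<in> W" "\<And>w. w \<in> W \<Longrightarrow> \<rho> w \<le> \<rho> v"
    using Max_ge[of "\<rho> ` W"] Suc.prems(4) by auto
  let ?G = "\<lambda>W I. {g \<in> W \<rightarrow>\<^sub>E B. \<forall>i\<in>I. adj (g (low i)) (g (top i))}"
  have lowv: "low i \<noteq> v" if "i \<in> I" for i using Suc.prems(3)[OF that] v(2) by fastforce
  have cW: "card (W - {v}) = n" using Suc.hyps(2) v(1) Suc.prems(4) by simp
  have finG: "finite (?G (W - {v}) I')" for I'
    using Suc.prems(4) finB by (auto intro!: finite_subset[OF _ finite_PiE[of "W - {v}" "\<lambda>_. B"]])
  have inj: "inj_on (\<lambda>g. (restrict g (W - {v}), g v)) (?G W I)"
  proof (rule inj_onI)
    fix g h assume g: "g \<in> ?G W I" and h: "h \<in> ?G W I"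
      and eq: "(restrict g (W - {v}), g v) = (restrict h (W - {v}), h v)"
    show "g = h"
    proof (rule PiE_ext[of g W "\<lambda>_. B" h])
      fix x assume x: "x \<in> W"
      show "g x = h x"
      proof (cases "x = v")
        case False
        have "restrict g (W - {v}) x = restrict h (W - {v}) x" using eq by simp
        then show ?thesis using x False by simp
      qed (use eq in simp)
    qed (use g h in auto)
  qed
  show ?case
  proof (cases "v \<in> top ` I")
    case True
    then obtain i where i: "i \<in> I" "top i = v" by auto
    let ?I = "I - {i}"
    have topv: "top i' \<noteq> v" if "i' \<in> ?I" for i' using that i inj_onD[OF Suc.prems(2), of i' i] by auto
    have cI: "card I = Suc (card ?I)" using card.remove[OF Suc.prems(1) i(1)] .
    have IH: "card (?G (W - {v}) ?I) \<le> d ^ card ?I * card B ^ (card (W - {v}) - card ?I)"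
      by (rule Suc.hyps(1)) (use cW Suc.prems topv lowv in \<open>auto intro: inj_on_subset\<close>)
    let ?T = "Sigma (?G (W - {v}) ?I) (\<lambda>g. {y \<in> B. adj (g (low i)) y})"
    have "(\<lambda>g. (restrict g (W - {v}), g v)) ` ?G W I \<subseteq> ?T"
    proof clarify
      fix g assume g: "g \<in> W \<rightarrow>\<^sub>E B" "\<forall>i\<in>I. adj (g (low i)) (g (top i))"
      have "low i \<in> W - {v}" using Suc.prems(3)[OF i(1)] lowv[OF i(1)] by auto
      moreover have "adj (g (low i)) (g v)" using g(2) i by auto
      moreover have "adj (restrict g (W - {v}) (low i')) (restrict g (W - {v}) (top i'))" if "i' \<in> ?I" for i'
        using g(2) that Suc.prems(3)[of i'] lowv[of i'] topv[OF that] by auto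
      ultimately show "restrict g (W - {v}) \<in> ?G (W - {v}) ?I \<and> g v \<in> {y \<in> B. adj (restrict g (W - {v}) (low i)) y}"
        using g(1) v(1) by auto
    qed
    moreover have "finite ?T" using finG[of ?I] finB by auto
    ultimately have "card (?G W I) \<le> card ?T" using inj by (meson card_inj_on_le)
    also have "\<dots> = (\<Sum>g\<in>?G (W - {v}) ?I. card {y \<in> B. adj (g (low i)) y})"
      using finG[of ?I] finB by (intro card_SigmaI) auto
    also have "\<dots> \<le> (\<Sum>g\<in>?G (W - {v}) ?I. d)" by (intro sum_mono deg)
    also have "\<dots> \<le> d * (d ^ card ?I * card B ^ (card (W - {v}) - card ?I))" using IH by simp
    also have "\<dots> = d ^ card I * card B ^ (card W - card I)"
      using cI cW Suc.hyps(2)[symmetric] by simp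
    finally show ?thesis .
  next
    case False
    have IH: "card (?G (W - {v}) I) \<le> d ^ card I * card B ^ (card (W - {v}) - card I)"
      by (rule Suc.hyps(1)) (use cW Suc.prems False lowv in auto)
    let ?T = "?G (W - {v}) I \<times> B"
    have "(\<lambda>g. (restrict g (W - {v}), g v)) ` ?G W I \<subseteq> ?T"
    proof clarify
      fix g assume g: "g \<in> W \<rightarrow>\<^sub>E B" "\<forall>i\<in>I. adj (g (low i)) (g (top i))"
      have "adj (restrict g (W - {v}) (low i')) (restrict g (W - {v}) (top i'))" if "i' \<in> I" for i'
        using g(2) that Suc.prems(3)[of i'] lowv[of i'] False by auto
      then show "restrict g (W - {v}) \<in> ?G (W - {v}) I \<and> g v \<in> B" using g(1) v(1) by auto
    qed
    moreover have "finite ?T" using finG[of I] finB by auto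
    ultimately have "card (?G W I) \<le> card ?T" using inj by (meson card_inj_on_le)
    also have "\<dots> = card (?G (W - {v}) I) * card B" by (rule card_cartesian_product)
    also have "\<dots> \<le> d ^ card I * card B ^ (card (W - {v}) - card I) * card B" using IH by (rule mult_le_mono1)
    also have "\<dots> = d ^ card I * card B ^ (card W - card I)"
    proof -
      have "card (top ` I) \<le> card (W - {v})"
        using Suc.prems False by (intro card_mono) auto
      then have "card I \<le> n" using card_image[OF Suc.prems(2)] cW by simp
      then have "card W - card I = Suc (card (W - {v}) - card I)" using cW Suc.hyps(2) by simp
      then show ?thesis by simp
    qed
    finally show ?thesis .
  qed
qed

text \<open>Composing with the inverse of one such permutation gives permutations that fix
  \<open>W\<close> pointwise.\<close>

lemma card_permutations_extending_le:
  assumes fin: "finite X" and W: "W \<subseteq> X"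
  shows "card {\<psi>. \<psi> permutes X \<and> restrict \<psi> W = g} \<le> fact (card X - card W)"
proof (cases "{\<psi>. \<psi> permutes X \<and> restrict \<psi> W = g} = {}")
  case True
  show ?thesis unfolding True by simp
next
  case False
  let ?P = "{\<psi>. \<psi> permutes X \<and> restrict \<psi> W = g}"
  obtain \<psi>0 where \<psi>0: "\<psi>0 permutes X" "restrict \<psi>0 W = g" using False by auto
  have "(\<lambda>\<psi>. inv \<psi>0 \<circ> \<psi>) ` ?P \<subseteq> {\<sigma>. \<sigma> permutes (X - W)}"
  proof clarify
    fix \<psi> assume \<psi>: "\<psi> permutes X" "g = restrict \<psi> W"
    have fx: "inv \<psi>0 (\<psi> w) = w" if "w \<in> W" for w
    proof -
      have "restrict \<psi>0 W w = restrict \<psi> W w" using \<psi>0(2) \<psi>(2) by simp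
      then have "\<psi> w = \<psi>0 w" using that by simp
      then show ?thesis using permutes_inverses(2)[OF \<psi>0(1)] by simp
    qed
    have "inv \<psi>0 \<circ> \<psi> permutes X" by (rule permutes_compose[OF \<psi>(1) permutes_inv[OF \<psi>0(1)]])
    then show "inv \<psi>0 \<circ> \<psi> permutes (X - W)"
      by (rule permutes_superset) (use fx in auto)
  qed
  moreover have "inj_on (\<lambda>\<psi>. inv \<psi>0 \<circ> \<psi>) ?P"
  proof (rule inj_onI)
    fix \<psi> \<psi>' assume "inv \<psi>0 \<circ> \<psi> = inv \<psi>0 \<circ> \<psi>'"
    then have "\<psi>0 \<circ> (inv \<psi>0 \<circ> \<psi>) = \<psi>0 \<circ> (inv \<psi>0 \<circ> \<psi>')" by simp
    then show "\<psi> = \<psi>'" using permutes_inv_o(1)[OF \<psi>0(1)] by (simp flip: o_assoc add: o_assoc)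
  qed
  ultimately have "card ?P \<le> card {\<sigma>. \<sigma> permutes (X - W)}"
    using finite_permutations[of "X - W"] fin by (intro card_inj_on_le) auto
  also have "\<dots> = fact (card X - card W)"
    using card_permutations[of "X - W"] fin W by (simp add: card_Diff_subset finite_subset)
  finally show ?thesis .
qed

text \<open>This trades the falling factorial N (N-1) ... (N-v+1) for N^v at a cost of e per factor;
  one step rests on (m + 1)^u \<le> e m^u for u \<le> m.\<close>

lemma power_fact_le_exp_fact: "v \<le> N \<Longrightarrow> real N ^ v * fact (N - v) \<le> exp (real v) * fact N"
proof (induction N arbitrary: v)
  case (Suc m)
  show ?case
  proof (cases v)
    case (Suc u)
    then have um: "u \<le> m" using Suc.prems by simp
    have "real (Suc m) ^ u \<le> exp 1 * real m ^ u"
    proof (cases "m = 0")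
      case False
      have "(real (Suc m) / real m) ^ u = (1 + 1 / real m) ^ u" using False by (simp add: field_simps)
      also have "\<dots> \<le> exp (1 / real m) ^ u" by (intro power_mono exp_ge_add_one_self) auto
      also have "\<dots> = exp (real u / real m)" by (simp flip: exp_of_nat_mult)
      also have "\<dots> \<le> exp 1" using um False by simp
      finally show ?thesis using False by (simp add: power_divide divide_le_eq)
    qed (use um in simp)
    then have "real (Suc m) ^ v * fact (Suc m - v) \<le> real (Suc m) * (exp 1 * real m ^ u) * fact (m - u)"
      unfolding Suc by (intro mult_mono) (auto intro!: mult_left_mono)
    also have "\<dots> = real (Suc m) * exp 1 * (real m ^ u * fact (m - u))" by simp
    also have "\<dots> \<le> real (Suc m) * exp 1 * (exp (real u) * fact m)"
      by (intro mult_left_mono Suc.IH um) auto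
    also have "\<dots> = exp (real v) * fact (Suc m)"
      unfolding Suc by (simp add: exp_add algebra_simps)
    finally show ?thesis .
  qed simp
qed simp

text \<open>A permutation is counted through its restriction to the set \<open>W\<close> of ends of
  the forest edges. The number v of these ends is at most 2 f, so replacing N^v (N - v)! by e^v N!
  costs at most exp 2 for each edge.\<close>

lemma card_permutations_forest_le:
  fixes top low :: "'i \<Rightarrow> 'a" and \<rho> :: "'a \<Rightarrow> nat"
  assumes fin: "finite X" and X0: "X \<noteq> {}" and deg: "\<And>x. card {y \<in> X. adj x y} \<le> d"
    and I: "finite I" "inj_on top I"
      "\<And>i. i \<in> I \<Longrightarrow> top i \<in> X \<and> low i \<in> X \<and> \<rho> (low i) < \<rho> (top i)"
  shows "real (card {\<psi>. \<psi> permutes X \<and> (\<forall>i\<in>I. adj (\<psi> (low i)) (\<psi> (top i)))})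
    \<le> (real d * exp 2 / real (card X)) ^ card I * fact (card X)"
proof -
  define W where "W = top ` I \<union> low ` I"
  define N v f where "N = card X" "v = card W" "f = card I"
  define G where "G = {g \<in> W \<rightarrow>\<^sub>E X. \<forall>i\<in>I. adj (g (low i)) (g (top i))}"
  let ?P = "{\<psi>. \<psi> permutes X \<and> (\<forall>i\<in>I. adj (\<psi> (low i)) (\<psi> (top i)))}"
  have WX: "W \<subseteq> X" using I(3) by (auto simp: W_def)
  have finW: "finite W" using I(1) by (simp add: W_def)
  have finG: "finite G"
    unfolding G_def using finW fin by (auto intro!: finite_subset[OF _ finite_PiE[of W "\<lambda>_. X"]])
  have cG: "card G \<le> d ^ f * N ^ (v - f)"
    unfolding G_def N_v_f_def
    by (rule card_forest_maps_le[OF fin deg finW I(1,2), where \<rho> = \<rho>]) (use I(3) in \<open>auto simp: W_def\<close>)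
  have N: "0 < N" using fin X0 by (simp add: N_v_f_def card_gt_0_iff)
  have vN: "v \<le> N" unfolding N_v_f_def by (rule card_mono[OF fin WX])
  have fv: "f \<le> v" unfolding N_v_f_def card_image[OF I(2), symmetric]
    by (rule card_mono[OF finW]) (auto simp: W_def)
  have v2f: "v \<le> 2 * f"
    using card_Un_le[of "top ` I" "low ` I"] card_image_le[OF I(1), of top] card_image_le[OF I(1), of low]
    by (simp add: N_v_f_def W_def)
  have "?P \<subseteq> (\<Union>g\<in>G. {\<psi>. \<psi> permutes X \<and> restrict \<psi> W = g})"
  proof
    fix \<psi> assume \<psi>: "\<psi> \<in> ?P"
    have "restrict \<psi> W \<in> W \<rightarrow>\<^sub>E X"
      using \<psi> WX permutes_in_image[of \<psi> X] by (auto simp: subset_iff)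
    moreover have "adj (restrict \<psi> W (low i)) (restrict \<psi> W (top i))" if "i \<in> I" for i
      using \<psi> that by (auto simp: W_def)
    ultimately have "restrict \<psi> W \<in> G" by (auto simp: G_def)
    then show "\<psi> \<in> (\<Union>g\<in>G. {\<psi>. \<psi> permutes X \<and> restrict \<psi> W = g})" using \<psi> by auto
  qed
  moreover have "finite (\<Union>g\<in>G. {\<psi>. \<psi> permutes X \<and> restrict \<psi> W = g})"
    by (rule finite_subset[OF _ finite_permutations[OF fin]]) auto
  ultimately have "card ?P \<le> card (\<Union>g\<in>G. {\<psi>. \<psi> permutes X \<and> restrict \<psi> W = g})"
    by (rule card_mono[rotated])
  also have "\<dots> \<le> (\<Sum>g\<in>G. card {\<psi>. \<psi> permutes X \<and> restrict \<psi> W = g})" by (rule card_UN_le[OF finG])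
  also have "\<dots> \<le> (\<Sum>g\<in>G. fact (N - v))"
    unfolding N_v_f_def by (intro sum_mono card_permutations_extending_le[OF fin WX])
  also have "\<dots> \<le> d ^ f * N ^ (v - f) * fact (N - v)" using cG by simp
  finally have "real (card ?P) \<le> real (d ^ f * N ^ (v - f) * fact (N - v))" by (simp only: of_nat_le_iff)
  also have "\<dots> = real d ^ f * (real N ^ v * fact (N - v)) / real N ^ f"
  proof -
    have "real N ^ (v - f) = real N ^ v / real N ^ f" using N fv by (intro power_diff) auto
    then show ?thesis by simp
  qed
  also have "\<dots> \<le> real d ^ f * (exp (real v) * fact N) / real N ^ f"
    by (intro divide_right_mono mult_left_mono power_fact_le_exp_fact vN) auto
  also have "\<dots> \<le> real d ^ f * (exp (2 * real f) * fact N) / real N ^ f"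
    using v2f by (intro divide_right_mono mult_left_mono mult_right_mono) auto
  also have "exp (2 * real f) = exp 2 ^ f" by (simp add: exp_of_nat2_mult)
  also have "real d ^ f * (exp 2 ^ f * fact N) / real N ^ f = (real d * exp 2 / real N) ^ f * fact N"
    by (simp add: power_mult_distrib power_divide)
  finally show ?thesis by (simp add: N_v_f_def)
qed

section \<open>The spiral graph\<close>

text \<open>The extremal graph: a path \<open>(0,0), (1,0), \<dots>\<close> (the spine) wound into a spiral with \<open>k + 1\<close>
  steps per turn; each \<open>(t,0)\<close> with \<open>t > k\<close> is joined to \<open>(t - (k+1), 0)\<close>, its neighbour on the
  previous turn, by an ear with \<open>k - 1\<close> edges through \<open>(t,1), \<dots>, (t,k-2)\<close>.
  Edges are indexed by \<open>(t,c)\<close>: \<open>c = 0\<close> is the spine edge leaving \<open>(t,0)\<close>, and \<open>c > 0\<close> is the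
  \<open>c\<close>-th edge of the ear at \<open>t\<close>.\<close>

definition ear_vertex :: "nat \<Rightarrow> nat \<Rightarrow> nat \<Rightarrow> nat \<times> nat" where
  "ear_vertex k t j = (if j = k - 1 then (t - (k + 1), 0) else (t, j))"

definition spiral_edge :: "nat \<Rightarrow> nat \<times> nat \<Rightarrow> (nat \<times> nat) set" where
  "spiral_edge k = (\<lambda>(t, c). if c = 0 then {(t, 0), (t + 1, 0)} else {(t, c - 1), ear_vertex k t c})"

definition spiral_index :: "nat \<Rightarrow> nat \<Rightarrow> (nat \<times> nat) set" where
  "spiral_index k n = {0..<n + k - 1} \<times> {0} \<union> {k + 1..<n + k} \<times> {1..k - 1}"

definition spiral_verts :: "nat \<Rightarrow> nat \<Rightarrow> (nat \<times> nat) set" where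
  "spiral_verts k n = {0..<n + k} \<times> {0} \<union> {k + 1..<n + k} \<times> {1..k - 2}"

definition spiral_edges :: "nat \<Rightarrow> nat \<Rightarrow> (nat \<times> nat) set set" where
  "spiral_edges k n = spiral_edge k ` spiral_index k n"

section \<open>Size and degrees of the spiral graph\<close>

lemma spiral_index_cases:
  assumes "i \<in> spiral_index k n"
  obtains t where "i = (t, 0)" "t + 1 < n + k"
  | t c where "i = (t, c)" "k + 1 \<le> t" "t < n + k" "1 \<le> c" "c \<le> k - 1"
  using assms unfolding spiral_index_def by force

lemma card_spiral_verts:
  assumes "k \<ge> 3" "n \<ge> 1"
  shows "card (spiral_verts k n) = (k - 1) * n + 2"
proof -
  have "card (spiral_verts k n) = card ({0..<n + k} \<times> {0::nat}) + card ({k + 1..<n + k} \<times> {1..k - 2})"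
    unfolding spiral_verts_def by (intro card_Un_disjoint) auto
  also have "\<dots> = (n + k) + (n - 1) * (k - 2)" by (simp add: card_cartesian_product)
  also have "\<dots> = (k - 1) * n + 2"
  proof -
    obtain a b where "k = a + 3" "n = b + 1" using assms by (metis add.commute le_Suc_ex)
    then show ?thesis by (simp add: algebra_simps)
  qed
  finally show ?thesis .
qed

lemma finite_spiral_verts: "finite (spiral_verts k n)"
  by (simp add: spiral_verts_def)

lemma finite_spiral_index: "finite (spiral_index k n)"
  by (simp add: spiral_index_def)

lemma card_spiral_index:
  assumes "k \<ge> 3" "n \<ge> 1"
  shows "card (spiral_index k n) = k * n"
proof -
  have "card (spiral_index k n) = card ({0..<n + k - 1} \<times> {0::nat}) + card ({k + 1..<n + k} \<times> {1..k - 1})"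
    unfolding spiral_index_def by (intro card_Un_disjoint) auto
  also have "\<dots> = (n + k - 1) + (n - 1) * (k - 1)" by (simp add: card_cartesian_product)
  also have "\<dots> = k * n"
  proof -
    obtain a b where "k = a + 3" "n = b + 1" using assms by (metis add.commute le_Suc_ex)
    then show ?thesis by (simp add: algebra_simps)
  qed
  finally show ?thesis .
qed

lemma inj_on_spiral_edge:
  assumes k: "k \<ge> 3"
  shows "inj_on (spiral_edge k) (spiral_index k n)"
proof (rule inj_onI)
  fix i i' assume i: "i \<in> spiral_index k n" and i': "i' \<in> spiral_index k n"
    and eq: "spiral_edge k i = spiral_edge k i'"
  from i i' show "i = i'"
    by (elim spiral_index_cases; use eq k in
      \<open>force simp: spiral_edge_def ear_vertex_def doubleton_eq_iff split: if_splits\<close>)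
qed

lemma card_spiral_edges: "k \<ge> 3 \<Longrightarrow> n \<ge> 1 \<Longrightarrow> card (spiral_edges k n) = k * n"
  unfolding spiral_edges_def by (simp add: card_image inj_on_spiral_edge card_spiral_index)

lemma edges_on_spiral:
  assumes k: "k \<ge> 3"
  shows "edges_on (spiral_verts k n) (spiral_edges k n)"
  unfolding edges_on_def
proof
  fix e assume "e \<in> spiral_edges k n"
  then obtain i where i: "i \<in> spiral_index k n" "e = spiral_edge k i" by (auto simp: spiral_edges_def)
  from i(1) show "\<exists>u v. u \<in> spiral_verts k n \<and> v \<in> spiral_verts k n \<and> u \<noteq> v \<and> e = {u, v}"
  proof (cases rule: spiral_index_cases)
    case (1 t)
    then show ?thesis
      by (intro exI[of _ "(t, 0)"] exI[of _ "(t + 1, 0)"])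
        (auto simp: i(2) spiral_edge_def spiral_verts_def)
  next
    case (2 t c)
    then show ?thesis using k
      by (intro exI[of _ "(t, c - 1)"] exI[of _ "ear_vertex k t c"])
        (auto simp: i(2) spiral_edge_def spiral_verts_def ear_vertex_def)
  qed
qed

text \<open>A superset of the neighbours that ignores the ends of the index ranges; at (0,0) the
  truncated subtraction puts the vertex itself in it.\<close>

definition spiral_nbrs :: "nat \<Rightarrow> nat \<times> nat \<Rightarrow> (nat \<times> nat) set" where
  "spiral_nbrs k = (\<lambda>(t, j). if j = 0 then {(t + 1, 0), (t - 1, 0), (t, 1), (t + k + 1, k - 2)}
     else {(t, j - 1), ear_vertex k t (j + 1)})"

lemma spiral_nbrs:
  assumes k: "k \<ge> 3" and e: "{x, y} \<in> spiral_edges k n"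
  shows "y \<in> spiral_nbrs k x"
proof -
  obtain i where i: "i \<in> spiral_index k n" "{x, y} = spiral_edge k i" using e by (auto simp: spiral_edges_def)
  from i(1) show ?thesis
  proof (cases rule: spiral_index_cases)
    case (1 t)
    then have "{x, y} = {(t, 0), (t + 1, 0)}" using i(2) by (simp add: spiral_edge_def)
    then consider "x = (t, 0)" "y = (t + 1, 0)" | "x = (t + 1, 0)" "y = (t, 0)"
      by (auto simp: doubleton_eq_iff)
    then show ?thesis by cases (auto simp: spiral_nbrs_def)
  next
    case (2 t c)
    then have "{x, y} = {(t, c - 1), ear_vertex k t c}" using i(2) by (simp add: spiral_edge_def)
    then consider "x = (t, c - 1)" "y = ear_vertex k t c" | "x = ear_vertex k t c" "y = (t, c - 1)"
      by (auto simp: doubleton_eq_iff)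
    then show ?thesis
    proof cases
      case 1
      then show ?thesis using 2 k by (cases "c = 1") (auto simp: spiral_nbrs_def ear_vertex_def)
    next
      case b: 2
      then show ?thesis using 2 k by (cases "c = k - 1") (auto simp: spiral_nbrs_def ear_vertex_def)
    qed
  qed
qed

lemma card_spiral_nbrs: "card (spiral_nbrs k x) \<le> 4"
proof -
  have "card {a, b, c, d} \<le> 4" for a b c d :: "nat \<times> nat"
    using card_length[of "[a, b, c, d]"] by simp
  moreover have "card {a, b} \<le> 4" for a b :: "nat \<times> nat"
    using card_length[of "[a, b]"] by simp
  ultimately show ?thesis by (auto simp: spiral_nbrs_def split: prod.splits)
qed

text \<open>Deleting one of the \<open>k\<close> colour classes leaves a forest: each remaining edge is charged to its
  upper end, and no vertex is charged twice.\<close>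

lemma spiral_forest:
  assumes k: "k \<ge> 3" and c: "c < k"
  obtains top low :: "nat \<times> nat \<Rightarrow> nat \<times> nat" and \<rho> :: "nat \<times> nat \<Rightarrow> nat"
  where "inj_on top {i \<in> spiral_index k n. snd i \<noteq> c}"
    "\<forall>i\<in>spiral_index k n. snd i \<noteq> c \<longrightarrow>
       spiral_edge k i = {low i, top i} \<and> \<rho> (low i) < \<rho> (top i)"
proof (cases "c = 0")
  case True
  \<comment> \<open>With the spine deleted, the ear at t leads from (t,0) to an earlier turn. Its
    edges are charged to the end nearer to (t,0), so every vertex (t,j) pays for the edge that
    leaves it; the rank falls along the ear.\<close>
  show thesis
  proof (rule that[of "\<lambda>(t, d). (t, d - 1)" "\<lambda>(t, d). ear_vertex k t d" "\<lambda>(t, j). t * k + (k - 1 - j)"],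
      goal_cases inj charge)
    case inj
    show "inj_on (\<lambda>(t, d). (t, d - 1)) {i \<in> spiral_index k n. snd i \<noteq> c}"
      using True by (auto simp: inj_on_def)
  next
    case charge
    show ?case
    proof (intro ballI impI)
      fix i assume i: "i \<in> spiral_index k n" "snd i \<noteq> c"
      from i(1) show "spiral_edge k i = {case i of (t, d) \<Rightarrow> ear_vertex k t d, case i of (t, d) \<Rightarrow> (t, d - 1)} \<and>
         (case case i of (t, d) \<Rightarrow> ear_vertex k t d of (t, j) \<Rightarrow> t * k + (k - 1 - j))
         < (case case i of (t, d) \<Rightarrow> (t, d - 1) of (t, j) \<Rightarrow> t * k + (k - 1 - j))"
      proof (cases rule: spiral_index_cases)
        case (2 t d)
        have "(t - (k + 1)) * k + k \<le> t * k"
        proof -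
          obtain s where "t = s + (k + 1)" using 2(2) by (metis le_Suc_ex add.commute)
          then show ?thesis by (simp add: algebra_simps)
        qed
        then show ?thesis using 2 k by (auto simp: spiral_edge_def ear_vertex_def)
      qed (use i True in auto)
    qed
  qed
next
  case False
  \<comment> \<open>Deleting edge \<open>c\<close> of each ear leaves two paths that hang from the
    spine. Their edges are charged to the end away from the spine, and n + k puts all inner ear
    vertices above the spine in rank.\<close>
  let ?top = "\<lambda>(t, d). if d = 0 then (t + 1, 0) else if d < c then (t, d) else (t, d - 1)"
  let ?low = "\<lambda>(t, d). if d = 0 then (t, 0) else if d < c then (t, d - 1) else ear_vertex k t d"
  let ?\<rho> = "\<lambda>(t, j). if j = 0 then t else if j < c then n + k + j else n + k + (k - j)"
  show thesis
  proof (rule that[of ?top ?low ?\<rho>], goal_cases inj charge)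
    case inj
    show "inj_on ?top {i \<in> spiral_index k n. snd i \<noteq> c}"
      using False by (auto simp: inj_on_def split: if_splits)
  next
    case charge
    show ?case
    proof (intro ballI impI)
      fix i assume i: "i \<in> spiral_index k n" "snd i \<noteq> c"
      from i(1) show "spiral_edge k i = {?low i, ?top i} \<and> ?\<rho> (?low i) < ?\<rho> (?top i)"
      proof (cases rule: spiral_index_cases)
        case (1 t)
        then show ?thesis by (simp add: spiral_edge_def)
      next
        case (2 t d)
        show ?thesis
        proof (cases "d < c")
          case True
          then show ?thesis using 2 c by (auto simp: spiral_edge_def ear_vertex_def)
        next
          case dc: False
          then have "d > c" using i(2) 2 by auto
          then show ?thesis using 2 c False by (auto simp: spiral_edge_def ear_vertex_def)
        qed
      qed
    qed
  qed
qed

text \<open>A potential on the vertices below level \<open>\<tau>\<close> that changes by at most one along every edge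
  other than the first edge of the ear at \<open>\<tau>\<close>, across which it jumps by \<open>2 k - 1\<close>.\<close>

definition spine_height :: "nat \<Rightarrow> nat \<Rightarrow> nat \<Rightarrow> int" where
  "spine_height k \<tau> s = (let x = int s - (int \<tau> - int (k + 1)) in if 0 \<le> x then x else min (- x) (int k - 1))"

definition height :: "nat \<Rightarrow> nat \<Rightarrow> nat \<times> nat \<Rightarrow> int" where
  "height k \<tau> = (\<lambda>(t, j). if j = 0 then spine_height k \<tau> t else if t = \<tau> then int j - (int k - 1)
     else max (spine_height k \<tau> t - int j) (min (spine_height k \<tau> t + int j) (spine_height k \<tau> (t - (k + 1)))))"

lemma height_Lipschitz:
  assumes k: "k \<ge> 3" and e: "{u, v} \<in> spiral_edges k n" and le: "fst u \<le> \<tau>" "fst v \<le> \<tau>"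
    and ne: "{u, v} \<noteq> {(\<tau>, 0), (\<tau>, 1)}"
  shows "\<bar>height k \<tau> u - height k \<tau> v\<bar> \<le> 1"
proof -
  obtain i where i: "i \<in> spiral_index k n" "{u, v} = spiral_edge k i" using e by (auto simp: spiral_edges_def)
  have sym: ?thesis if "{u, v} = {a, b}" "\<bar>height k \<tau> a - height k \<tau> b\<bar> \<le> 1" for a b
    using that by (auto simp: doubleton_eq_iff)
  from i(1) show ?thesis
  proof (cases rule: spiral_index_cases)
    case (1 t)
    have uv: "{u, v} = {(t, 0), (t + 1, 0)}" using 1 i(2) by (simp add: spiral_edge_def)
    have "\<bar>height k \<tau> (t, 0) - height k \<tau> (t + 1, 0)\<bar> \<le> 1"
      using k by (auto simp: height_def spine_height_def Let_def min_def)
    then show ?thesis by (rule sym[OF uv])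
  next
    case (2 t c)
    have uv: "{u, v} = {(t, c - 1), ear_vertex k t c}" using 2 i(2) by (simp add: spiral_edge_def)
    have t: "t \<le> \<tau>" using uv le by (auto simp: doubleton_eq_iff)
    have h0: "spine_height k \<tau> (t - (k + 1)) = (let x = int t - int \<tau> in if 0 \<le> x then x else min (- x) (int k - 1))"
      using 2(2) by (simp add: spine_height_def of_nat_diff)
    have "\<bar>height k \<tau> (t, c - 1) - height k \<tau> (ear_vertex k t c)\<bar> \<le> 1"
    proof (cases "t = \<tau>")
      case True
      have "c \<noteq> 1"
      proof
        assume "c = 1"
        moreover have "ear_vertex k \<tau> 1 = (\<tau>, 1)" using k by (auto simp: ear_vertex_def)
        ultimately show False using uv ne True by simp
      qed
      then show ?thesis using 2 True k h0 by (auto simp: height_def ear_vertex_def of_nat_diff)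
    next
      case False
      let ?b = "spine_height k \<tau> t" and ?b' = "spine_height k \<tau> (t - (k + 1))"
      \<comment> \<open>On other ears the height moves at unit speed from the value at one end to
        the value at the other. The cap \<open>int k - 1\<close> in \<open>spine_height\<close>
        keeps the two values within \<open>int k - 1\<close> of each other, so that k - 1 edges
        suffice.\<close>
      have bb: "\<bar>?b - ?b'\<bar> \<le> int k - 1"
        using h0 t False k by (auto simp: spine_height_def Let_def min_def)
      let ?F = "\<lambda>j::nat. max (?b - int j) (min (?b + int j) ?b')"
      have "height k \<tau> (t, c - 1) = ?F (c - 1)"
        using False by (auto simp: height_def)
      moreover have "height k \<tau> (ear_vertex k t c) = ?F c"
      proof (cases "c = k - 1")
        case True
        then show ?thesis using bb 2 k by (auto simp: height_def ear_vertex_def of_nat_diff)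
      next
        case c: False
        then show ?thesis using False 2 by (auto simp: height_def ear_vertex_def)
      qed
      moreover have "\<bar>?F (c - 1) - ?F c\<bar> \<le> 1"
      proof -
        have "int c = int (c - 1) + 1" using 2 by simp
        then show ?thesis by linarith
      qed
      ultimately show ?thesis by (simp only:)
    qed
    from sym[OF uv this] show ?thesis .
  qed
qed

lemma abs_diff_le_telescope:
  fixes h :: "nat \<Rightarrow> int"
  assumes "\<And>i. a \<le> i \<Longrightarrow> i < b \<Longrightarrow> \<bar>h (Suc i) - h i\<bar> \<le> 1" "a \<le> b"
  shows "\<bar>h b - h a\<bar> \<le> int b - int a"
  using assms(2,1)
proof (induction b rule: dec_induct)
  case (step m)
  have "\<bar>h m - h a\<bar> \<le> int m - int a" by (rule step.IH) (use step.prems in auto)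
  moreover have "\<bar>h (Suc m) - h m\<bar> \<le> 1" using step by auto
  ultimately show ?case by linarith
qed simp

text \<open>The cycle starts at its highest level, with the smallest second coordinate there. Inside
  an ear both neighbours on the cycle would be the same vertex, so the start is (\<tau>,0) and the
  cycle contains the first edge of the ear at \<tau>. The potential jumps by 2 k - 1 across this
  edge and changes by at most 1 across each of the other L - 1.\<close>

lemma spiral_cycle_from_top:
  assumes k: "k \<ge> 3" and L: "length vs = L" "L \<ge> 3" and dist: "distinct vs"
    and E: "\<And>i. i < L \<Longrightarrow> {vs ! i, vs ! ((i + 1) mod L)} \<in> spiral_edges k n"
    and v0: "vs ! 0 = (\<tau>, j)" and top: "\<And>v. v \<in> set vs \<Longrightarrow> fst v \<le> \<tau> \<and> (fst v = \<tau> \<longrightarrow> j \<le> snd v)"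
  shows "2 * k \<le> L"
proof -
  have E': "{vs ! i, vs ! Suc i} \<in> spiral_edges k n" if "Suc i < L" for i using E[of i] that by simp
  have Elast: "{vs ! 0, vs ! (L - 1)} \<in> spiral_edges k n"
    using E[of "L - 1"] L by (simp add: insert_commute)
  have mem: "vs ! i \<in> set vs" if "i < L" for i using that L by simp
  have le: "fst (vs ! i) \<le> \<tau>" if "i < L" for i using top[OF mem[OF that]] by simp
  have neq: "vs ! i = vs ! i' \<longleftrightarrow> i = i'" if "i < L" "i' < L" for i i'
    using nth_eq_iff_index_eq[OF dist] that L by simp
  have E0: "{vs ! 0, vs ! 1} \<in> spiral_edges k n" using E'[of 0] L by simp
  have nb1: "vs ! 1 \<in> spiral_nbrs k (\<tau>, j)" using spiral_nbrs[OF k E0] v0 by simp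
  have nbl: "vs ! (L - 1) \<in> spiral_nbrs k (\<tau>, j)" using spiral_nbrs[OF k Elast] v0 by simp
  have ne1: "vs ! 1 \<noteq> vs ! (L - 1)" using neq[of 1 "L - 1"] L by simp
  have j0: "j = 0"
  proof (rule ccontr)
    assume j: "j \<noteq> 0"
    have ear: "v = ear_vertex k \<tau> (j + 1)" if "v \<in> spiral_nbrs k (\<tau>, j)" "v \<in> set vs" for v
    proof -
      have "v = (\<tau>, j - 1) \<or> v = ear_vertex k \<tau> (j + 1)" using that(1) j by (simp add: spiral_nbrs_def)
      moreover have "v \<noteq> (\<tau>, j - 1)" using top[OF that(2)] j by auto
      ultimately show ?thesis by simp
    qed
    have "vs ! 1 = vs ! (L - 1)" using ear[OF nb1 mem] ear[OF nbl mem] L by simp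
    then show False using ne1 by simp
  qed
  have nb: "v = (\<tau> - 1, 0) \<or> v = (\<tau>, 1)" if "v \<in> spiral_nbrs k (\<tau>, j)" "v \<in> set vs" for v
    using that(1) top[OF that(2)] j0 by (auto simp: spiral_nbrs_def)
  have "vs ! 1 = (\<tau>, 1) \<or> vs ! (L - 1) = (\<tau>, 1)"
    using nb[OF nb1 mem] nb[OF nbl mem] ne1 L by auto
  define h where "h = (\<lambda>i. height k \<tau> (vs ! i))"
  have h0: "h 0 = int k + 1" by (simp add: h_def v0 j0 height_def spine_height_def)
  have h1: "height k \<tau> (\<tau>, 1) = 2 - int k" by (simp add: height_def)
  have step: "\<bar>h (Suc i) - h i\<bar> \<le> 1" if i: "Suc i < L" and ne: "{vs ! i, vs ! Suc i} \<noteq> {(\<tau>, 0), (\<tau>, 1)}" for i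
    using height_Lipschitz[OF k E'[OF i] le le ne] i by (simp add: h_def abs_minus_commute)
  have step': "\<bar>h (Suc i) - h i\<bar> \<le> 1" if i: "Suc i < L" "0 < i" for i
  proof (rule step[OF i(1)])
    show "{vs ! i, vs ! Suc i} \<noteq> {(\<tau>, 0), (\<tau>, 1)}"
      using neq[of i 0] neq[of "Suc i" 0] i v0 j0 by (auto simp: doubleton_eq_iff)
  qed
  from \<open>vs ! 1 = (\<tau>, 1) \<or> vs ! (L - 1) = (\<tau>, 1)\<close> show ?thesis
  proof
    assume v1: "vs ! 1 = (\<tau>, 1)"
    have "\<bar>h (L - 1) - h 1\<bar> \<le> int (L - 1) - int 1"
      by (rule abs_diff_le_telescope) (use step' L in auto)
    moreover have "\<bar>h 0 - h (L - 1)\<bar> \<le> 1"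
    proof -
      have "{vs ! 0, vs ! (L - 1)} \<noteq> {(\<tau>, 0), (\<tau>, 1)}"
        using v1 ne1 v0 j0 by (auto simp: doubleton_eq_iff)
      then show ?thesis
        using height_Lipschitz[OF k Elast le le] L by (simp add: h_def)
    qed
    moreover have "h 1 = 2 - int k" using v1 h1 by (simp add: h_def)
    ultimately show ?thesis using h0 L by (simp add: of_nat_diff)
  next
    assume vl: "vs ! (L - 1) = (\<tau>, 1)"
    have "\<bar>h (Suc i) - h i\<bar> \<le> 1" if i: "i < L - 1" for i
    proof (cases "i = 0")
      case True
      have "vs ! 1 \<noteq> (\<tau>, 1)" using vl ne1 by simp
      then have "{vs ! 0, vs ! Suc 0} \<noteq> {(\<tau>, 0), (\<tau>, 1)}" using v0 j0 by (auto simp: doubleton_eq_iff)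
      then show ?thesis using step[of 0] True L by simp
    next
      case False
      then show ?thesis using step' i by simp
    qed
    then have "\<bar>h (L - 1) - h 0\<bar> \<le> int (L - 1) - int 0"
      by (intro abs_diff_le_telescope) auto
    moreover have "h (L - 1) = 2 - int k" using vl h1 by (simp add: h_def)
    ultimately show ?thesis using h0 L by (simp add: of_nat_diff)
  qed
qed

lemma spiral_cycle_length:
  assumes k: "k \<ge> 3" and L: "length vs = L" "L \<ge> 3" and dist: "distinct vs"
    and E: "\<And>i. i < L \<Longrightarrow> {vs ! i, vs ! ((i + 1) mod L)} \<in> spiral_edges k n"
  shows "2 * k \<le> L"
proof -
  have ne: "set vs \<noteq> {}" using L by auto
  define \<tau> where "\<tau> = Max (fst ` set vs)"
  define J where "J = {j. (\<tau>, j) \<in> set vs}"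
  have "\<tau> \<in> fst ` set vs" unfolding \<tau>_def by (rule Max_in) (use ne in auto)
  then have Jne: "J \<noteq> {}" by (auto simp: J_def)
  define j where "j = (LEAST j. j \<in> J)"
  have j: "j \<in> J" "\<And>i. i \<in> J \<Longrightarrow> j \<le> i" unfolding j_def using Jne by (auto intro: LeastI Least_le)
  have le: "fst v \<le> \<tau>" if "v \<in> set vs" for v unfolding \<tau>_def using that by (intro Max_ge) auto
  have "(\<tau>, j) \<in> set vs" using j(1) by (simp add: J_def)
  then obtain m where m: "m < L" "vs ! m = (\<tau>, j)" using L(1) by (metis in_set_conv_nth)
  define ws where "ws = rotate m vs"
  have ws: "ws ! i = vs ! ((m + i) mod L)" if "i < L" for i
    unfolding ws_def using nth_rotate[of i vs m] that L(1) by simp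
  show ?thesis
  proof (rule spiral_cycle_from_top[OF k _ L(2), of ws])
    show "length ws = L" "distinct ws" using L dist by (auto simp: ws_def)
    show "ws ! 0 = (\<tau>, j)" using ws[of 0] m L by simp
    show "fst v \<le> \<tau> \<and> (fst v = \<tau> \<longrightarrow> j \<le> snd v)" if "v \<in> set ws" for v
      using le[of v] j(2)[of "snd v"] that by (cases v) (auto simp: ws_def J_def)
    show "{ws ! i, ws ! ((i + 1) mod L)} \<in> spiral_edges k n" if i: "i < L" for i
    proof -
      have "(m + (i + 1) mod L) mod L = ((m + i) mod L + 1) mod L" by presburger
      moreover have "(i + 1) mod L < L" using L by simp
      ultimately have "ws ! ((i + 1) mod L) = vs ! (((m + i) mod L + 1) mod L)"
        using ws[of "(i + 1) mod L"] by simp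
      then show ?thesis using E[of "(m + i) mod L"] ws[OF i] L by simp
    qed
  qed
qed

text \<open>One turn of the spine, k + 1 edges, is closed by the first ear, k - 1 edges;
  \<open>n \<ge> 2\<close> provides that ear.\<close>

lemma spiral_has_cycle:
  assumes k: "k \<ge> 3" and n: "n \<ge> 2"
  obtains vs where "length vs = 2 * k" "distinct vs" "set vs \<subseteq> spiral_verts k n"
    "\<forall>i<2 * k. {vs ! i, vs ! ((i + 1) mod (2 * k))} \<in> spiral_edges k n"
proof -
  define w where "w = (\<lambda>i. if i \<le> k + 1 then (i, 0::nat) else (k + 1, i - (k + 1)))"
  define vs where "vs = map w [0..<2 * k]"
  have nth: "vs ! i = w i" if "i < 2 * k" for i using that by (simp add: vs_def)
  show thesis
  proof (rule that[of vs])
    show "length vs = 2 * k" by (simp add: vs_def)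
    show "distinct vs" by (auto simp: vs_def distinct_map inj_on_def w_def split: if_splits)
    show "set vs \<subseteq> spiral_verts k n" using k n by (auto simp: vs_def w_def spiral_verts_def)
    show "\<forall>i<2 * k. {vs ! i, vs ! ((i + 1) mod (2 * k))} \<in> spiral_edges k n"
    proof (intro allI impI)
      fix i assume i: "i < 2 * k"
      have mem: "spiral_edge k p \<in> spiral_edges k n" if "p \<in> spiral_index k n" for p
        using that by (simp add: spiral_edges_def)
      consider "i \<le> k" | "k < i" "i + 1 < 2 * k" | "i = 2 * k - 1" using i k by linarith
      then show "{vs ! i, vs ! ((i + 1) mod (2 * k))} \<in> spiral_edges k n"
      proof cases
        case 1
        then have "{vs ! i, vs ! ((i + 1) mod (2 * k))} = spiral_edge k (i, 0)"
          using nth[of i] nth[of "i + 1"] k by (simp add: w_def spiral_edge_def)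
        then show ?thesis using mem[of "(i, 0)"] 1 n by (simp add: spiral_index_def)
      next
        case 2
        then have "{vs ! i, vs ! ((i + 1) mod (2 * k))} = spiral_edge k (k + 1, i - k)"
          using nth[of i] nth[of "i + 1"] k
          by (cases "i = k + 1") (auto simp: w_def spiral_edge_def ear_vertex_def)
        moreover have "1 \<le> i - k" "i - k \<le> k - 1" using 2 by linarith+
        then have "(k + 1, i - k) \<in> spiral_index k n" using n by (auto simp: spiral_index_def)
        ultimately show ?thesis using mem by simp
      next
        case 3
        then have "{vs ! i, vs ! ((i + 1) mod (2 * k))} = spiral_edge k (k + 1, k - 1)"
          using nth[of i] nth[of 0] k
          by (cases "k = 3") (auto simp: w_def spiral_edge_def ear_vertex_def)
        then show ?thesis using mem[of "(k + 1, k - 1)"] n k by (auto simp: spiral_index_def)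
      qed
    qed
  qed
qed

lemma girth_spiral:
  assumes k: "k \<ge> 3" and n: "n \<ge> 2" and inj: "inj_on \<phi> (spiral_verts k n)"
  shows "girth ((`) \<phi> ` spiral_edges k n) = enat (2 * k)"
proof -
  let ?V = "spiral_verts k n" and ?E = "(`) \<phi> ` spiral_edges k n"
  have eo: "edges_on ?V (spiral_edges k n)" by (rule edges_on_spiral[OF k])
  have "has_cycle_of_length ?E (2 * k)"
  proof -
    obtain vs where vs: "length vs = 2 * k" "distinct vs" "set vs \<subseteq> ?V"
      "\<forall>i<2 * k. {vs ! i, vs ! ((i + 1) mod (2 * k))} \<in> spiral_edges k n"
      by (rule spiral_has_cycle[OF k n])
    have "{map \<phi> vs ! i, map \<phi> vs ! ((i + 1) mod (2 * k))} \<in> ?E" if "i < 2 * k" for i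
    proof -
      have "(i + 1) mod (2 * k) < 2 * k" using k by simp
      then have "{map \<phi> vs ! i, map \<phi> vs ! ((i + 1) mod (2 * k))} = \<phi> ` {vs ! i, vs ! ((i + 1) mod (2 * k))}"
        using vs(1) that by simp
      moreover have "{vs ! i, vs ! ((i + 1) mod (2 * k))} \<in> spiral_edges k n" using vs(4) that by blast
      ultimately show ?thesis by (metis imageI)
    qed
    moreover have "distinct (map \<phi> vs)" using vs(2,3) inj by (simp add: distinct_map inj_on_subset)
    ultimately show ?thesis unfolding has_cycle_of_length_def using k vs(1)
      by (intro conjI exI[of _ "map \<phi> vs"]) auto
  qed
  moreover have "2 * k \<le> L" if cyc: "has_cycle_of_length ?E L" for L
  proof -
    obtain vs where L: "L \<ge> 3" and vs: "length vs = L" "distinct vs"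
      "\<And>i. i < L \<Longrightarrow> {vs ! i, vs ! ((i + 1) mod L)} \<in> ?E"
      using cyc unfolding has_cycle_of_length_def by auto
    define \<psi> where "\<psi> = inv_into ?V \<phi>"
    have pull: "{\<psi> x, \<psi> y} \<in> spiral_edges k n \<and> x \<in> \<phi> ` ?V" if xy: "{x, y} \<in> ?E" for x y
    proof -
      obtain e where e: "e \<in> spiral_edges k n" "{x, y} = \<phi> ` e" using xy by auto
      have eV: "e \<subseteq> ?V" by (rule edges_on_subset[OF eo e(1)])
      have "\<psi> ` \<phi> ` e = e" unfolding \<psi>_def using inv_into_image_cancel[OF inj eV] .
      then have "{\<psi> x, \<psi> y} = e" using e(2) by (metis image_empty image_insert)
      moreover have "x \<in> \<phi> ` e" using e(2) by auto
      ultimately show ?thesis using e(1) eV by auto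
    qed
    have "set vs \<subseteq> \<phi> ` ?V"
    proof
      fix x assume "x \<in> set vs"
      then obtain i where "i < L" "x = vs ! i" using vs(1) by (metis in_set_conv_nth)
      then show "x \<in> \<phi> ` ?V" using pull[OF vs(3)[of i]] by simp
    qed
    then have "distinct (map \<psi> vs)"
      using vs(2) unfolding \<psi>_def by (simp add: distinct_map inj_on_inv_into)
    moreover have "{map \<psi> vs ! i, map \<psi> vs ! ((i + 1) mod L)} \<in> spiral_edges k n" if "i < L" for i
    proof -
      have "(i + 1) mod L < L" using L by simp
      then show ?thesis using pull[OF vs(3)[OF that]] that vs(1) by simp
    qed
    ultimately show ?thesis using spiral_cycle_length[OF k _ L, of "map \<psi> vs" n] vs(1) by simp
  qed
  ultimately show ?thesis
    unfolding girth_def by (intro antisym Inf_lower Inf_greatest) auto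
qed

section \<open>Drawing the spiral graph\<close>

text \<open>Polar coordinates with radius \<open>exp u\<close> and the angle measured in spine steps.  The spine is
  \<open>u = \<theta>\<close>, and the ears are radial segments between consecutive turns.\<close>

definition cyl :: "nat \<Rightarrow> real \<Rightarrow> real \<Rightarrow> complex" where
  "cyl k u \<theta> = exp (Complex u (2 * pi * \<theta> / real (k + 1)))"

lemma cyl_eq: "cyl k u \<theta> = cyl k u' \<theta>' \<longleftrightarrow> u = u' \<and> (\<exists>m::int. \<theta> - \<theta>' = real (k + 1) * of_int m)"
proof -
  have "2 * pi * \<theta> / real (k + 1) = 2 * pi * \<theta>' / real (k + 1) + of_int (2 * m) * pi
      \<longleftrightarrow> \<theta> - \<theta>' = real (k + 1) * of_int m" for m :: int
  proof -
    have "2 * pi * \<theta> / real (k + 1) = 2 * pi * \<theta>' / real (k + 1) + of_int (2 * m) * pi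
      \<longleftrightarrow> 2 * pi * \<theta> = 2 * pi * (\<theta>' + real (k + 1) * of_int m)"
      by (simp add: field_simps)
    also have "\<dots> \<longleftrightarrow> \<theta> = \<theta>' + real (k + 1) * of_int m"
      by (subst mult_cancel_left) simp
    finally show ?thesis by auto
  qed
  then show ?thesis unfolding cyl_def exp_eq by (simp add: complex_eq_iff)
qed

text \<open>One turn raises the logarithmic radius by k + 1, and an ear covers this distance in k -
  1 equal edges.\<close>

definition ear_step :: "nat \<Rightarrow> real" where
  "ear_step k = real (k + 1) / real (k - 1)"

definition vertex_pos :: "nat \<Rightarrow> nat \<times> nat \<Rightarrow> complex" where
  "vertex_pos k = (\<lambda>(t, j). cyl k (real t - real j * ear_step k) (real t))"

definition edge_radius :: "nat \<Rightarrow> nat \<times> nat \<Rightarrow> real \<Rightarrow> real" where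
  "edge_radius k = (\<lambda>(t, c) s. if c = 0 then real t + s else real t - (real c - 1 + s) * ear_step k)"

definition edge_path :: "nat \<Rightarrow> nat \<times> nat \<Rightarrow> real \<Rightarrow> complex" where
  "edge_path k = (\<lambda>(t, c) s. cyl k (edge_radius k (t, c) s) (if c = 0 then real t + s else real t))"

lemma ear_step: "k \<ge> 3 \<Longrightarrow> 0 < ear_step k" "k \<ge> 3 \<Longrightarrow> real (k - 1) * ear_step k = real (k + 1)"
  by (auto simp: ear_step_def)

lemma ear_step_le_iff: "k \<ge> 3 \<Longrightarrow> x * ear_step k \<le> y * ear_step k \<longleftrightarrow> x \<le> y"
  using ear_step(1)[of k] by (simp add: mult_le_cancel_right)

text \<open>The far end of the ear is exactly one turn earlier, so it is on the same ray as
  (t,0).\<close>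

lemma vertex_pos_ear_vertex:
  assumes k: "k \<ge> 3" and t: "k + 1 \<le> t"
  shows "vertex_pos k (ear_vertex k t j) = cyl k (real t - real j * ear_step k) (real t)"
proof (cases "j = k - 1")
  case True
  have "real (t - (k + 1)) - real t = real (k + 1) * of_int (-1)" using t by (simp add: of_nat_diff)
  moreover have "real (t - (k + 1)) = real t - real j * ear_step k"
  proof -
    have "real (t - (k + 1)) = real t - real (k + 1)" using t by (simp add: of_nat_diff)
    then show ?thesis unfolding True ear_step(2)[OF k] .
  qed
  ultimately have "cyl k (real (t - (k + 1))) (real (t - (k + 1))) = cyl k (real t - real j * ear_step k) (real t)"
    unfolding cyl_eq by blast
  then show ?thesis using True by (simp add: ear_vertex_def vertex_pos_def)
qed (simp add: ear_vertex_def vertex_pos_def)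

text \<open>On one ray distinct levels t differ by at least k + 1, while the inner vertices of an
  ear are shifted radially by less than k + 1.\<close>

lemma inj_on_vertex_pos:
  assumes k: "k \<ge> 3"
  shows "inj_on (vertex_pos k) (spiral_verts k n)"
proof (rule inj_onI)
  fix v v' assume v: "v \<in> spiral_verts k n" "v' \<in> spiral_verts k n" "vertex_pos k v = vertex_pos k v'"
  obtain t j t' j' where tj: "v = (t, j)" "v' = (t', j')" by (cases v, cases v')
  have j: "j \<le> k - 2" "j' \<le> k - 2" using v tj by (auto simp: spiral_verts_def)
  obtain m :: int where m: "real t - real t' = real (k + 1) * of_int m"
    and u: "real t - real j * ear_step k = real t' - real j' * ear_step k"
    using v(3) tj by (auto simp: vertex_pos_def cyl_eq)
  have small: "0 \<le> real i * ear_step k \<and> real i * ear_step k < real (k + 1)" if "i \<le> k - 2" for i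
  proof -
    have "real i < real (k - 1)" using that k by simp
    then have "real i * ear_step k < real (k - 1) * ear_step k"
      using ear_step(1)[OF k] by (intro mult_strict_right_mono) auto
    then show ?thesis unfolding ear_step(2)[OF k] using ear_step(1)[OF k] by simp
  qed
  have "\<bar>real (k + 1) * of_int m\<bar> < real (k + 1)"
    using m u small[OF j(1)] small[OF j(2)] by linarith
  then have "real (k + 1) * \<bar>of_int m\<bar> < real (k + 1) * 1" by (simp add: abs_mult)
  then have "\<bar>of_int m :: real\<bar> < 1" by (subst (asm) mult_less_cancel_left_pos) auto
  then have "m = 0" by linarith
  then have "t = t'" using m by simp
  moreover have "j = j'" using u calculation ear_step(1)[OF k] by simp
  ultimately show "v = v'" using tj by simp
qed

lemma edge_path_arc:
  assumes k: "k \<ge> 3" and i: "i \<in> spiral_index k n"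
  shows "arc (edge_path k i)"
    and "{pathstart (edge_path k i), pathfinish (edge_path k i)} = vertex_pos k ` spiral_edge k i"
proof -
  obtain t c where tc: "i = (t, c)" by (cases i)
  have "continuous_on {0..1} (edge_path k i)"
    unfolding edge_path_def cyl_def edge_radius_def tc
    by (cases "c = 0") (auto intro!: continuous_intros)
  moreover have "inj_on (edge_path k i) {0..1}"
  proof (rule inj_onI)
    fix x y :: real assume "edge_path k i x = edge_path k i y"
    then have "edge_radius k (t, c) x = edge_radius k (t, c) y"
      by (simp add: edge_path_def tc cyl_eq)
    then show "x = y" using ear_step(1)[OF k] by (auto simp: edge_radius_def split: if_splits)
  qed
  ultimately show "arc (edge_path k i)" by (simp add: arc_def path_def)
  from i show "{pathstart (edge_path k i), pathfinish (edge_path k i)} = vertex_pos k ` spiral_edge k i"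
  proof (cases rule: spiral_index_cases)
    case (1 t)
    then show ?thesis
      by (simp add: pathstart_def pathfinish_def edge_path_def edge_radius_def spiral_edge_def vertex_pos_def add.commute)
  next
    case (2 t c)
    have "real c - 1 = real (c - 1)" using 2 by (simp add: of_nat_diff)
    then have "pathstart (edge_path k i) = vertex_pos k (t, c - 1)"
      using 2 by (simp add: pathstart_def edge_path_def edge_radius_def vertex_pos_def)
    moreover have "pathfinish (edge_path k i) = vertex_pos k (ear_vertex k t c)"
      using 2 vertex_pos_ear_vertex[OF k 2(2)] by (simp add: pathfinish_def edge_path_def edge_radius_def)
    ultimately show ?thesis using 2 by (simp add: spiral_edge_def)
  qed
qed

text \<open>The edges before the angle is wrapped around. They are segments there, and an
  intersection in the plane becomes a system of linear inequalities with an unknown number of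
  turns.\<close>

definition on_edge :: "nat \<Rightarrow> nat \<times> nat \<Rightarrow> real \<Rightarrow> real \<Rightarrow> bool" where
  "on_edge k = (\<lambda>(t, c) u \<theta>. if c = 0 then \<theta> = u \<and> real t \<le> u \<and> u \<le> real t + 1
     else \<theta> = real t \<and> real t - real c * ear_step k \<le> u \<and> u \<le> real t - (real c - 1) * ear_step k)"

lemma on_edge_if_in_path_image:
  assumes k: "k \<ge> 3" and z: "z \<in> path_image (edge_path k i)"
  obtains u \<theta> where "on_edge k i u \<theta>" "z = cyl k u \<theta>"
proof -
  obtain t c where tc: "i = (t, c)" by (cases i)
  obtain s where s: "0 \<le> s" "s \<le> 1" "z = edge_path k i s" using z by (auto simp: path_image_def)
  have "0 \<le> s * ear_step k" "s * ear_step k \<le> ear_step k"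
    using s ear_step(1)[OF k] by (auto simp: mult_left_le_one_le)
  then have "on_edge k i (edge_radius k (t, c) s) (if c = 0 then real t + s else real t)"
    using s by (auto simp: on_edge_def edge_radius_def tc algebra_simps)
  then show thesis using that s(3) by (simp add: edge_path_def tc)
qed

text \<open>The last hypothesis fixes one order for each pair of distinct edges, which leaves four
  cases. Common points are forced to be ends because an ear spans exactly the gap between two turns
  of the spine.\<close>

lemma edges_meet_ordered:
  assumes k: "k \<ge> 3" and i: "i \<in> spiral_index k n" "i' \<in> spiral_index k n"
    and on: "on_edge k i u \<theta>" "on_edge k i' u \<theta>'" and m: "\<theta> - \<theta>' = real (k + 1) * of_int m"
    and ord: "snd i = 0 \<and> snd i' > 0 \<or> snd i = 0 \<and> snd i' = 0 \<and> fst i < fst i' \<or>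
      snd i > 0 \<and> snd i' > 0 \<and> (fst i' < fst i \<or> fst i = fst i' \<and> snd i < snd i')"
  shows "\<exists>v \<in> spiral_edge k i \<inter> spiral_edge k i'. cyl k u \<theta> = vertex_pos k v"
proof -
  obtain t c t' c' where tc: "i = (t, c)" "i' = (t', c')" by (cases i, cases i')
  have ci: "c > 0 \<Longrightarrow> k + 1 \<le> t \<and> c \<le> k - 1" "c' > 0 \<Longrightarrow> k + 1 \<le> t' \<and> c' \<le> k - 1"
    using i tc by (auto simp: spiral_index_def)
  note es = ear_step[OF k]
  have K: "0 < real (k + 1)" by simp
  consider (spine_ear) "c = 0" "c' > 0" | (spine) "c = 0" "c' = 0" "t < t'"
    | (ears) "c > 0" "c' > 0" "t' < t" | (ear) "c > 0" "c' > 0" "t = t'" "c < c'"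
    using ord tc by auto
  then show ?thesis
  proof cases
    case spine
    then have "real t + 1 = real t'" "u = real t'" "\<theta> = u" using on tc by (auto simp: on_edge_def)
    then have "t' = t + 1" "cyl k u \<theta> = vertex_pos k (t', 0)" by (auto simp: vertex_pos_def)
    then show ?thesis using spine tc by (intro bexI[of _ "(t', 0)"]) (auto simp: spiral_edge_def)
  next
    case spine_ear
    have u: "\<theta> = u" "real t \<le> u" "u \<le> real t + 1" "\<theta>' = real t'"
      "real t' - real c' * ear_step k \<le> u" "u \<le> real t' - (real c' - 1) * ear_step k"
      using on spine_ear tc by (auto simp: on_edge_def)
    have c': "k + 1 \<le> t'" "c' \<le> k - 1" using ci(2) spine_ear by auto
    have "real c' * ear_step k \<le> real (k - 1) * ear_step k" unfolding ear_step_le_iff[OF k] using c' by simp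
    then have lo: "- real (k + 1) \<le> real (k + 1) * of_int m" using u m es by linarith
    have "0 \<le> (real c' - 1) * ear_step k" using spine_ear es by simp
    then have hi: "real (k + 1) * of_int m \<le> 0" using u m by linarith
    have "real (k + 1) * (- 1) \<le> real (k + 1) * of_int m" using lo by simp
    then have "- 1 \<le> (of_int m :: real)" using K by (subst (asm) mult_le_cancel_left_pos) auto
    moreover have "(of_int m :: real) \<le> 0" using hi K by (simp add: mult_le_0_iff)
    \<comment> \<open>With no turn in between, the spine edge meets the ear at its start; one turn
      lower, at its far end.\<close>
    ultimately have "m = 0 \<or> m = -1" by linarith
    then show ?thesis
    proof
      assume "m = 0"
      then have ut: "u = real t'" using m u by simp
      then have "(real c' - 1) * ear_step k \<le> 0 * ear_step k" using u by simp
      then have "c' = 1" unfolding ear_step_le_iff[OF k] using spine_ear by linarith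
      moreover have "t' = t \<or> t' = t + 1" using u ut by linarith
      ultimately show ?thesis using ut u spine_ear tc
        by (intro bexI[of _ "(t', 0)"]) (auto simp: spiral_edge_def vertex_pos_def)
    next
      assume "m = -1"
      then have ut: "u = real t' - real (k + 1)" using m u by simp
      then have "real (k - 1) * ear_step k \<le> real c' * ear_step k" using u es by linarith
      then have cc: "c' = k - 1" unfolding ear_step_le_iff[OF k] using c' by simp
      have ut2: "u = real (t' - (k + 1))" using ut c' by (simp add: of_nat_diff)
      then have "t' - (k + 1) = t \<or> t' - (k + 1) = t + 1" using u by linarith
      then have "(t' - (k + 1), 0) \<in> spiral_edge k i" using tc spine_ear by (auto simp: spiral_edge_def)
      moreover have "(t' - (k + 1), 0) \<in> spiral_edge k i'"
        using tc spine_ear cc by (simp add: spiral_edge_def ear_vertex_def)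
      moreover have "cyl k u \<theta> = vertex_pos k (t' - (k + 1), 0)"
        using ut2 u(1) by (simp add: vertex_pos_def)
      ultimately show ?thesis by blast
    qed
  next
    case ear
    have u: "\<theta> = real t" "real t - real c * ear_step k \<le> u" "u \<le> real t - (real c' - 1) * ear_step k"
      using on ear tc by (auto simp: on_edge_def)
    have "(real c' - 1) * ear_step k \<le> real c * ear_step k" using u by linarith
    then have cc: "c' = c + 1" unfolding ear_step_le_iff[OF k] using ear by linarith
    then have "u = real t - real c * ear_step k" using u by simp
    then have "cyl k u \<theta> = vertex_pos k (t, c)" using u(1) by (simp add: vertex_pos_def)
    moreover have "ear_vertex k t c = (t, c)" using cc ci(2) ear by (auto simp: ear_vertex_def)
    ultimately show ?thesis using ear cc tc by (intro bexI[of _ "(t, c)"]) (auto simp: spiral_edge_def)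
  next
    case ears
    have u: "\<theta> = real t" "\<theta>' = real t'" "real t - real c * ear_step k \<le> u" "u \<le> real t' - (real c' - 1) * ear_step k"
      using on ears tc by (auto simp: on_edge_def)
    have c: "k + 1 \<le> t" "c \<le> k - 1" using ci(1) ears by auto
    have c1: "real c * ear_step k \<le> real (k - 1) * ear_step k" unfolding ear_step_le_iff[OF k] using c by simp
    have c2: "0 \<le> (real c' - 1) * ear_step k" using ears es by simp
    have "0 < real (k + 1) * of_int m" using m u ears by simp
    then have "0 < (of_int m :: real)" using K by (simp add: zero_less_mult_iff)
    then have "1 \<le> m" by simp
    then have "1 \<le> (of_int m :: real)" by simp
    then have "real (k + 1) * 1 \<le> real (k + 1) * of_int m" by (intro mult_left_mono) auto
    then have tt: "real (k + 1) \<le> real t - real t'" using m u by simp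
    \<comment> \<open>The bounds u \<ge> t - (k + 1) and u \<le> t' leave no slack against the
      previous inequality, so all of them are equalities.\<close>
    have eqs: "real t - real t' = real (k + 1)" "real (k - 1) * ear_step k \<le> real c * ear_step k"
      "(real c' - 1) * ear_step k \<le> 0 * ear_step k" "u = real t'"
      using tt u c1 c2 es by linarith+
    have "c = k - 1" using eqs(2) c unfolding ear_step_le_iff[OF k] by simp
    moreover have "c' = 1" using eqs(3) ears unfolding ear_step_le_iff[OF k] by linarith
    moreover have tt': "t - (k + 1) = t'" using eqs(1) c by linarith
    moreover have "cyl k u \<theta> = vertex_pos k (t', 0)"
      using cyl_eq[of k u \<theta> u "real t'"] eqs u by (auto simp: vertex_pos_def intro!: exI[of _ "1::int"])
    ultimately show ?thesis using ears tc
      by (intro bexI[of _ "(t', 0)"]) (auto simp: spiral_edge_def ear_vertex_def)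
  qed
qed

lemma edges_meet:
  assumes k: "k \<ge> 3" and i: "i \<in> spiral_index k n" "i' \<in> spiral_index k n" "i \<noteq> i'"
    and z: "z \<in> path_image (edge_path k i)" "z \<in> path_image (edge_path k i')"
  shows "\<exists>v \<in> spiral_edge k i \<inter> spiral_edge k i'. z = vertex_pos k v"
proof -
  obtain u \<theta> where o1: "on_edge k i u \<theta>" "z = cyl k u \<theta>" by (rule on_edge_if_in_path_image[OF k z(1)])
  obtain u' \<theta>' where o2: "on_edge k i' u' \<theta>'" "z = cyl k u' \<theta>'" by (rule on_edge_if_in_path_image[OF k z(2)])
  have "cyl k u \<theta> = cyl k u' \<theta>'" using o1(2) o2(2) by simp
  then obtain m :: int where m: "\<theta> - \<theta>' = real (k + 1) * of_int m" and uu: "u' = u"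
    unfolding cyl_eq by blast
  have m': "\<theta>' - \<theta> = real (k + 1) * of_int (- m)" using m by (simp add: algebra_simps)
  have o2': "on_edge k i' u \<theta>'" "z = cyl k u \<theta>'" using o2 uu by auto
  define ord where "ord = (\<lambda>i i' :: nat \<times> nat. snd i = 0 \<and> snd i' > 0 \<or> snd i = 0 \<and> snd i' = 0 \<and> fst i < fst i' \<or>
      snd i > 0 \<and> snd i' > 0 \<and> (fst i' < fst i \<or> fst i = fst i' \<and> snd i < snd i'))"
  have "ord i i' \<or> ord i' i" using i(3) by (auto simp: ord_def prod_eq_iff)
  then show ?thesis
  proof
    assume "ord i i'"
    from edges_meet_ordered[OF k i(1,2) o1(1) o2'(1) m this[unfolded ord_def]]
    show ?thesis using o1(2) by simp
  next
    assume "ord i' i"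
    from edges_meet_ordered[OF k i(2,1) o2'(1) o1(1) m' this[unfolded ord_def]]
    show ?thesis using o2'(2) by auto
  qed
qed

text \<open>Every vertex is an end of some edge, so a vertex on another edge is a common point of
  two edges, and \<open>edges_meet\<close> applies.\<close>

lemma vertex_on_edge:
  assumes k: "k \<ge> 3" and i: "i \<in> spiral_index k n" and v: "v \<in> spiral_verts k n"
    and z: "vertex_pos k v \<in> path_image (edge_path k i)"
  shows "v \<in> spiral_edge k i"
proof -
  obtain t j where tj: "v = (t, j)" by (cases v)
  have "\<exists>i'\<in>spiral_index k n. v \<in> spiral_edge k i'"
  proof (cases "j = 0")
    case True
    then have "t < n + k" using v tj by (auto simp: spiral_verts_def)
    then have "(t, 0) \<in> spiral_index k n \<or> (t - 1, 0) \<in> spiral_index k n \<and> t = t - 1 + 1"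
      using k by (auto simp: spiral_index_def)
    then show ?thesis
    proof (elim disjE conjE)
      assume "(t, 0) \<in> spiral_index k n"
      then show ?thesis using tj True by (intro bexI[of _ "(t, 0)"]) (auto simp: spiral_edge_def)
    next
      assume "(t - 1, 0) \<in> spiral_index k n" "t = t - 1 + 1"
      then show ?thesis using tj True by (intro bexI[of _ "(t - 1, 0)"]) (auto simp: spiral_edge_def)
    qed
  next
    case False
    then have "(t, j + 1) \<in> spiral_index k n" using v tj k by (auto simp: spiral_verts_def spiral_index_def)
    then show ?thesis using tj by (intro bexI[of _ "(t, j + 1)"]) (auto simp: spiral_edge_def)
  qed
  then obtain i' where i': "i' \<in> spiral_index k n" "v \<in> spiral_edge k i'" by blast
  show ?thesis
  proof (cases "i' = i")
    case False
    have "vertex_pos k v \<in> {pathstart (edge_path k i'), pathfinish (edge_path k i')}"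
      unfolding edge_path_arc(2)[OF k i'(1)] using i'(2) by (rule imageI)
    then have z': "vertex_pos k v \<in> path_image (edge_path k i')" by auto
    obtain w where w: "w \<in> spiral_edge k i" "w \<in> spiral_edge k i'" "vertex_pos k v = vertex_pos k w"
      using edges_meet[OF k i i'(1) False[symmetric] z z'] by blast
    have "w \<in> spiral_verts k n"
      using edges_on_subset[OF edges_on_spiral[OF k], of "spiral_edge k i" n] i w(1) by (auto simp: spiral_edges_def)
    then have "v = w" using inj_onD[OF inj_on_vertex_pos[OF k] w(3) v] by simp
    then show ?thesis using w by simp
  qed (use i' in simp)
qed

lemma planar_spiral:
  fixes \<phi> :: "nat \<times> nat \<Rightarrow> nat"
  assumes k: "k \<ge> 3" and inj: "inj_on \<phi> (spiral_verts k n)"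
  shows "planar (\<phi> ` spiral_verts k n) ((`) \<phi> ` spiral_edges k n)"
proof -
  let ?V = "spiral_verts k n" and ?I = "spiral_index k n"
  define \<psi> where "\<psi> = inv_into ?V \<phi>"
  have \<psi>: "\<psi> (\<phi> v) = v" if "v \<in> ?V" for v unfolding \<psi>_def by (rule inv_into_f_f[OF inj that])
  define J where "J = (\<lambda>e. SOME i. i \<in> ?I \<and> e = \<phi> ` spiral_edge k i)"
  have J: "J e \<in> ?I \<and> e = \<phi> ` spiral_edge k (J e)" if "e \<in> (`) \<phi> ` spiral_edges k n" for e
    unfolding J_def by (rule someI_ex) (use that in \<open>auto simp: spiral_edges_def\<close>)
  have sub: "spiral_edge k i \<subseteq> ?V" if "i \<in> ?I" for i
    by (rule edges_on_subset[OF edges_on_spiral[OF k]]) (use that in \<open>simp add: spiral_edges_def\<close>)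
  have \<psi>e: "\<psi> ` \<phi> ` spiral_edge k i = spiral_edge k i" if "i \<in> ?I" for i
    unfolding \<psi>_def by (rule inv_into_image_cancel[OF inj sub[OF that]])
  show ?thesis
    unfolding planar_def
  proof (intro exI[of _ "\<lambda>v. vertex_pos k (\<psi> v)"] exI[of _ "\<lambda>e. edge_path k (J e)"] conjI ballI impI)
    have "inj_on (vertex_pos k \<circ> \<psi>) (\<phi> ` ?V)"
    proof (rule comp_inj_on)
      show "inj_on \<psi> (\<phi> ` ?V)" unfolding \<psi>_def by (rule inj_on_inv_into) simp
      have "\<psi> ` \<phi> ` ?V = ?V" unfolding \<psi>_def by (rule inv_into_image_cancel[OF inj order_refl])
      then show "inj_on (vertex_pos k) (\<psi> ` \<phi> ` ?V)" using inj_on_vertex_pos[OF k] by simp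
    qed
    then show "inj_on (\<lambda>v. vertex_pos k (\<psi> v)) (\<phi> ` ?V)" by (simp add: comp_def)
  next
    fix e assume e: "e \<in> (`) \<phi> ` spiral_edges k n"
    have Je: "J e \<in> ?I" "e = \<phi> ` spiral_edge k (J e)" using J[OF e] by auto
    show "arc (edge_path k (J e))" by (rule edge_path_arc(1)[OF k Je(1)])
    have "(\<lambda>v. vertex_pos k (\<psi> v)) ` e = vertex_pos k ` \<psi> ` e" by (simp add: image_image)
    also have "\<psi> ` e = spiral_edge k (J e)" using \<psi>e[OF Je(1)] Je(2) by simp
    finally show "{pathstart (edge_path k (J e)), pathfinish (edge_path k (J e))} = (\<lambda>v. vertex_pos k (\<psi> v)) ` e"
      using edge_path_arc(2)[OF k Je(1)] by simp
  next
    fix e x assume e: "e \<in> (`) \<phi> ` spiral_edges k n" and x: "x \<in> \<phi> ` ?V"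
      and on: "vertex_pos k (\<psi> x) \<in> path_image (edge_path k (J e))"
    have Je: "J e \<in> ?I" "e = \<phi> ` spiral_edge k (J e)" using J[OF e] by auto
    obtain v where v: "v \<in> ?V" "x = \<phi> v" using x by auto
    have "v \<in> spiral_edge k (J e)" using vertex_on_edge[OF k Je(1) v(1)] on \<psi>[OF v(1)] v(2) by simp
    then have "\<phi> v \<in> \<phi> ` spiral_edge k (J e)" by (rule imageI)
    then show "x \<in> e" using v(2) Je(2) by simp
  next
    fix e e' assume e: "e \<in> (`) \<phi> ` spiral_edges k n" "e' \<in> (`) \<phi> ` spiral_edges k n" "e \<noteq> e'"
    have Je: "J e \<in> ?I" "e = \<phi> ` spiral_edge k (J e)" using J[OF e(1)] by auto
    have Je': "J e' \<in> ?I" "e' = \<phi> ` spiral_edge k (J e')" using J[OF e(2)] by auto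
    have ne: "J e \<noteq> J e'" using Je(2) Je'(2) e(3) by metis
    show "path_image (edge_path k (J e)) \<inter> path_image (edge_path k (J e'))
        \<subseteq> (\<lambda>v. vertex_pos k (\<psi> v)) ` (e \<inter> e')"
    proof
      fix z assume "z \<in> path_image (edge_path k (J e)) \<inter> path_image (edge_path k (J e'))"
      then have "\<exists>v\<in>spiral_edge k (J e) \<inter> spiral_edge k (J e'). z = vertex_pos k v"
        by (intro edges_meet[OF k Je(1) Je'(1) ne]) auto
      then obtain v where v: "v \<in> spiral_edge k (J e)" "v \<in> spiral_edge k (J e')" "z = vertex_pos k v"
        by auto
      have "\<phi> v \<in> e" using imageI[OF v(1), of \<phi>] Je(2) by simp
      moreover have "\<phi> v \<in> e'" using imageI[OF v(2), of \<phi>] Je'(2) by simp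
      moreover have "z = vertex_pos k (\<psi> (\<phi> v))" using v(3) \<psi>[OF subsetD[OF sub[OF Je(1)] v(1)]] by simp
      ultimately show "z \<in> (\<lambda>v. vertex_pos k (\<psi> v)) ` (e \<inter> e')" by (intro image_eqI[of _ _ "\<phi> v"]) auto
    qed
  qed
qed

section \<open>The threshold\<close>

text \<open>Indexed by permutations, so that a random copy is given by a uniform random permutation
  and probabilities are counts.\<close>

definition spiral_copies :: "nat \<Rightarrow> nat \<Rightarrow> (nat \<times> nat \<Rightarrow> nat) \<Rightarrow> nat set set set" where
  "spiral_copies k n \<phi> = {(`) \<pi> ` (`) \<phi> ` spiral_edges k n | \<pi>. \<pi> permutes \<phi> ` spiral_verts k n}"

lemma spiral_copy_maximal:
  assumes k: "k \<ge> 3" and n: "n \<ge> 2" and \<phi>: "bij_betw \<phi> (spiral_verts k n) {0..<(k - 1) * n + 2}"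
    and S: "S \<in> spiral_copies k n \<phi>"
  shows "maximal_planar_girth (2 * k) {0..<(k - 1) * n + 2} S" "S \<subseteq> all_edges ((k - 1) * n + 2)"
    "card S = k * n"
proof -
  let ?V = "spiral_verts k n" and ?N = "(k - 1) * n + 2"
  have im: "\<phi> ` ?V = {0..<?N}" and inj: "inj_on \<phi> ?V" using \<phi> by (auto simp: bij_betw_def)
  obtain \<pi> where \<pi>: "\<pi> permutes {0..<?N}" and S': "S = (`) \<pi> ` (`) \<phi> ` spiral_edges k n"
    using S unfolding spiral_copies_def im by auto
  define \<beta> where "\<beta> = \<pi> \<circ> \<phi>"
  have S\<beta>: "S = (`) \<beta> ` spiral_edges k n" unfolding S' \<beta>_def by (simp add: image_image image_comp)
  have inj\<beta>: "inj_on \<beta> ?V"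
    unfolding \<beta>_def by (rule comp_inj_on[OF inj]) (use permutes_inj_on[OF \<pi>] in blast)
  have im\<beta>: "\<beta> ` ?V = {0..<?N}"
    unfolding \<beta>_def image_comp[symmetric] im using permutes_image[OF \<pi>] .
  have eo: "edges_on ?V (spiral_edges k n)" by (rule edges_on_spiral[OF k])
  have "inj_on ((`) \<beta>) (spiral_edges k n)"
    by (rule inj_on_subset[OF inj_on_image_Pow[OF inj\<beta>]]) (use edges_on_subset[OF eo] in auto)
  then show cS: "card S = k * n" unfolding S\<beta> using card_spiral_edges[OF k, of n] n by (simp add: card_image)
  show "S \<subseteq> all_edges ?N"
  proof
    fix e assume "e \<in> S"
    then obtain e0 where e0: "e0 \<in> spiral_edges k n" "e = \<beta> ` e0" by (auto simp: S\<beta>)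
    obtain u v where uv: "u \<in> ?V" "v \<in> ?V" "u \<noteq> v" "e0 = {u, v}" by (rule edges_onE[OF eo e0(1)])
    have "\<beta> u \<in> {0..<?N}" "\<beta> v \<in> {0..<?N}" using uv im\<beta> by auto
    moreover have "\<beta> u \<noteq> \<beta> v" using uv inj_onD[OF inj\<beta>, of u v] by auto
    ultimately show "e \<in> all_edges ?N" using uv(4) e0(2) by (auto simp: all_edges_def)
  qed
  show "maximal_planar_girth (2 * k) {0..<?N} S"
    unfolding maximal_planar_girth_def
  proof (intro conjI)
    show "planar {0..<?N} S" unfolding S\<beta> im\<beta>[symmetric] by (rule planar_spiral[OF k inj\<beta>])
    show "girth S = enat (2 * k)" unfolding S\<beta> by (rule girth_spiral[OF k n inj\<beta>])
    have "real (2 * k) / (real (2 * k) - 2) * (real (card {0..<?N}) - 2)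
        = real (2 * k) / (2 * (real k - 1)) * ((real k - 1) * real n)"
      using k by (simp add: of_nat_diff)
    also have "\<dots> = real (k * n)"
    proof -
      have gen: "2 * y / (2 * x) * (x * z) = y * z" if "x \<noteq> 0" for x y z :: real using that by simp
      have "real k - 1 \<noteq> 0" using k by simp
      from gen[OF this, of "real k" "real n"] show ?thesis by (simp only: of_nat_mult of_nat_numeral)
    qed
    finally show "real (card S) = real (2 * k) / (real (2 * k) - 2) * (real (card {0..<?N}) - 2)"
      using cS by simp
  qed
qed

lemma exists_small_class:
  fixes f :: "'a \<Rightarrow> nat"
  assumes fin: "finite T" and f: "\<And>i. i \<in> T \<Longrightarrow> f i < k" and k: "k > 0"
  shows "\<exists>c<k. k * card {i \<in> T. f i = c} \<le> card T"
proof (rule ccontr)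
  assume "\<not> ?thesis"
  then have lt: "card T < k * card {i \<in> T. f i = c}" if "c < k" for c using that by (auto simp: not_le)
  have "T = (\<Union>c\<in>{..<k}. {i \<in> T. f i = c})" using f by auto
  then have "card T = (\<Sum>c<k. card {i \<in> T. f i = c})"
    using card_UN_disjoint[of "{..<k}" "\<lambda>c. {i \<in> T. f i = c}"] fin by auto
  then have "k * card T = (\<Sum>c<k. k * card {i \<in> T. f i = c})" by (simp add: sum_distrib_left)
  also have "\<dots> > (\<Sum>c<k. card T)"
    by (rule sum_strict_mono) (use lt k in auto)
  finally show False by simp
qed

text \<open>If some copy contains \<open>S\<close>, then \<open>S\<close> without its smallest
  colour class is a forest with at least (k-1)/k |S| edges. The inverses of the permutations to be
  counted map the forest edges to edges of a graph of maximum degree at most 4, which gives the base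
  4 exp 2 / |X|. The assumption on |X| makes this base at most 1, so the lower bound on the forest
  size can be used in the exponent.\<close>

lemma spiral_spread:
  fixes \<phi> :: "nat \<times> nat \<Rightarrow> nat"
  assumes k: "k \<ge> 3" and n: "n \<ge> 1" and \<phi>: "bij_betw \<phi> (spiral_verts k n) X"
    and N: "4 * exp 2 \<le> real (card X)"
  shows "real (card {\<pi>. \<pi> permutes X \<and> S \<subseteq> (`) \<pi> ` (`) \<phi> ` spiral_edges k n})
    \<le> ((4 * exp 2 / real (card X)) powr ((real k - 1) / real k)) ^ card S * fact (card X)"
proof (cases "\<exists>\<pi>. \<pi> permutes X \<and> S \<subseteq> (`) \<pi> ` (`) \<phi> ` spiral_edges k n")
  case False
  then have e: "{\<pi>. \<pi> permutes X \<and> S \<subseteq> (`) \<pi> ` (`) \<phi> ` spiral_edges k n} = {}" by auto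
  show ?thesis unfolding e by simp
next
  case True
  let ?V = "spiral_verts k n" and ?I = "spiral_index k n"
  define E where "E = (`) \<phi> ` spiral_edges k n"
  define b where "b = 4 * exp 2 / real (card X)"
  obtain \<pi>0 where \<pi>0: "\<pi>0 permutes X" "S \<subseteq> (`) \<pi>0 ` E" using True by (auto simp: E_def)
  have im: "\<phi> ` ?V = X" and inj: "inj_on \<phi> ?V" using \<phi> by (auto simp: bij_betw_def)
  have finX: "finite X" using im finite_spiral_verts by auto
  have N0: "0 < real (card X)" using N exp_gt_zero[of "2::real"] by linarith
  have Xne: "X \<noteq> {}" using N0 by auto
  have b: "0 < b" "b \<le> 1" using N N0 by (auto simp: b_def)
  define \<beta> where "\<beta> = \<pi>0 \<circ> \<phi>"
  have inj\<beta>: "inj_on \<beta> ?V"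
    unfolding \<beta>_def by (rule comp_inj_on[OF inj]) (use permutes_inj_on[OF \<pi>0(1)] in blast)
  have im\<beta>: "\<beta> ` ?V = X"
    unfolding \<beta>_def image_comp[symmetric] im using permutes_image[OF \<pi>0(1)] .
  have eo: "edges_on ?V (spiral_edges k n)" by (rule edges_on_spiral[OF k])
  have sub: "spiral_edge k i \<subseteq> ?V" if "i \<in> ?I" for i
    by (rule edges_on_subset[OF eo]) (use that in \<open>simp add: spiral_edges_def\<close>)
  define T where "T = {i \<in> ?I. \<beta> ` spiral_edge k i \<in> S}"
  have finT: "finite T" using finite_spiral_index by (auto simp: T_def)
  have SE: "S \<subseteq> (\<lambda>i. \<beta> ` spiral_edge k i) ` ?I"
    using \<pi>0(2) unfolding E_def spiral_edges_def \<beta>_def by (simp add: image_image image_comp comp_def)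
  have "S = (\<lambda>i. \<beta> ` spiral_edge k i) ` T" using SE by (auto simp: T_def)
  moreover have "inj_on (\<lambda>i. \<beta> ` spiral_edge k i) T"
  proof (rule inj_onI)
    fix i i' assume i: "i \<in> T" "i' \<in> T" "\<beta> ` spiral_edge k i = \<beta> ` spiral_edge k i'"
    then have I: "i \<in> ?I" "i' \<in> ?I" by (auto simp: T_def)
    have "spiral_edge k i = spiral_edge k i'"
      using i(3) inj_on_image_eq_iff[OF inj\<beta> sub[OF I(1)] sub[OF I(2)]] by simp
    then show "i = i'" using inj_onD[OF inj_on_spiral_edge[OF k] _ I] by simp
  qed
  ultimately have cT: "card T = card S" by (simp add: card_image)
  have "snd i < k" if "i \<in> T" for i using that k by (auto simp: T_def spiral_index_def)
  then obtain c where c: "c < k" "k * card {i \<in> T. snd i = c} \<le> card T"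
    using exists_small_class[OF finT, of snd k] k by auto
  define I where "I = {i \<in> T. snd i \<noteq> c}"
  have finI: "finite I" using finT by (simp add: I_def)
  have "card T = card {i \<in> T. snd i = c} + card I"
  proof -
    have "T = {i \<in> T. snd i = c} \<union> I" by (auto simp: I_def)
    then show ?thesis using card_Un_disjoint[of "{i \<in> T. snd i = c}" I] finT by (auto simp: I_def)
  qed
  then have "k * card T = k * card {i \<in> T. snd i = c} + k * card I" by (simp add: add_mult_distrib2)
  then have "k * card T \<le> card T + k * card I" using c(2) by linarith
  then have "real k * real (card T) \<le> real (card T) + real k * real (card I)"
    by (metis of_nat_add of_nat_le_iff of_nat_mult)
  then have cI: "(real k - 1) / real k * real (card S) \<le> real (card I)"
    using k cT by (simp add: field_simps)
  obtain top low and \<rho> :: "nat \<times> nat \<Rightarrow> nat" where inj_top: "inj_on top {i \<in> ?I. snd i \<noteq> c}"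
    and tl': "\<forall>i\<in>?I. snd i \<noteq> c \<longrightarrow> spiral_edge k i = {low i, top i} \<and> \<rho> (low i) < \<rho> (top i)"
    by (rule spiral_forest[OF k c(1), of n])
  note tl = tl'[rule_format]
  have II: "i \<in> ?I" "snd i \<noteq> c" "\<beta> ` spiral_edge k i \<in> S" if "i \<in> I" for i using that by (auto simp: I_def T_def)
  have tV: "top i \<in> ?V" "low i \<in> ?V" if "i \<in> I" for i using tl[OF II(1,2)[OF that]] sub[OF II(1)[OF that]] by auto
  define adj where "adj = (\<lambda>x y. {x, y} \<in> E)"
  have deg: "card {y \<in> X. adj x y} \<le> 4" for x
  proof -
    have "{y \<in> X. adj x y} \<subseteq> \<phi> ` spiral_nbrs k (inv_into ?V \<phi> x)"
    proof
      fix y assume "y \<in> {y \<in> X. adj x y}"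
      then obtain e where e: "e \<in> spiral_edges k n" "{x, y} = \<phi> ` e" by (auto simp: adj_def E_def)
      have e': "inv_into ?V \<phi> ` \<phi> ` e = e" by (rule inv_into_image_cancel[OF inj edges_on_subset[OF eo e(1)]])
      then have "{inv_into ?V \<phi> x, inv_into ?V \<phi> y} = e" using e(2) by (metis image_empty image_insert)
      then have nb: "inv_into ?V \<phi> y \<in> spiral_nbrs k (inv_into ?V \<phi> x)" using spiral_nbrs[OF k] e(1) by metis
      have "y \<in> \<phi> ` e" using e(2) by auto
      then have "y \<in> \<phi> ` ?V" using edges_on_subset[OF eo e(1)] by auto
      then have "y = \<phi> (inv_into ?V \<phi> y)" by (simp add: f_inv_into_f)
      then show "y \<in> \<phi> ` spiral_nbrs k (inv_into ?V \<phi> x)" using nb by (rule image_eqI)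
    qed
    moreover have finnb: "finite (spiral_nbrs k v)" for v by (simp add: spiral_nbrs_def split: prod.splits)
    ultimately have "card {y \<in> X. adj x y} \<le> card (\<phi> ` spiral_nbrs k (inv_into ?V \<phi> x))"
      by (intro card_mono) auto
    also have "\<dots> \<le> card (spiral_nbrs k (inv_into ?V \<phi> x))" by (rule card_image_le[OF finnb])
    also have "\<dots> \<le> 4" by (rule card_spiral_nbrs)
    finally show ?thesis .
  qed
  let ?P = "{\<pi>. \<pi> permutes X \<and> S \<subseteq> (`) \<pi> ` E}"
  let ?Q = "{\<psi>. \<psi> permutes X \<and> (\<forall>i\<in>I. adj (\<psi> ((\<beta> \<circ> low) i)) (\<psi> ((\<beta> \<circ> top) i)))}"
  \<comment> \<open>Inverting turns the condition that the copy contains \<open>S\<close> into one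
    on the images of the fixed forest.\<close>
  have "inv ` ?P \<subseteq> ?Q"
  proof clarify
    fix \<pi> assume \<pi>: "\<pi> permutes X" "S \<subseteq> (`) \<pi> ` E"
    have "adj (inv \<pi> (\<beta> (low i))) (inv \<pi> (\<beta> (top i)))" if i: "i \<in> I" for i
    proof -
      obtain e where e: "e \<in> E" "\<beta> ` spiral_edge k i = \<pi> ` e" using II(3)[OF i] \<pi>(2) by auto
      have "inv \<pi> ` \<pi> ` e = e" using permutes_inv_o(2)[OF \<pi>(1)] by (simp add: image_comp)
      then have "inv \<pi> ` \<beta> ` {low i, top i} = e" using e(2) tl[OF II(1,2)[OF i]] by simp
      then show ?thesis using e(1) by (simp add: adj_def)
    qed
    then show "inv \<pi> permutes X \<and> (\<forall>i\<in>I. adj (inv \<pi> ((\<beta> \<circ> low) i)) (inv \<pi> ((\<beta> \<circ> top) i)))"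
      using permutes_inv[OF \<pi>(1)] by simp
  qed
  moreover have "inj_on inv ?P"
  proof (rule inj_onI)
    fix \<pi> \<pi>' assume "\<pi> \<in> ?P" "\<pi>' \<in> ?P" "inv \<pi> = inv \<pi>'"
    then show "\<pi> = \<pi>'" by (metis (no_types, lifting) mem_Collect_eq permutes_inv_inv)
  qed
  moreover have "finite ?Q" by (rule finite_subset[OF _ finite_permutations[OF finX]]) auto
  ultimately have "card ?P \<le> card ?Q" by (meson card_inj_on_le)
  then have "real (card ?P) \<le> real (card ?Q)" by simp
  also have "\<dots> \<le> (real 4 * exp 2 / real (card X)) ^ card I * fact (card X)"
  proof (rule card_permutations_forest_le[OF finX Xne deg finI, where \<rho> = "\<lambda>x. \<rho> (inv_into ?V \<beta> x)"])
    have "inj_on top I" by (rule inj_on_subset[OF inj_top]) (auto simp: I_def T_def)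
    then show "inj_on (\<beta> \<circ> top) I" by (rule comp_inj_on) (rule inj_on_subset[OF inj\<beta>], use tV in auto)
    fix i assume i: "i \<in> I"
    show "(\<beta> \<circ> top) i \<in> X \<and> (\<beta> \<circ> low) i \<in> X \<and> \<rho> (inv_into ?V \<beta> ((\<beta> \<circ> low) i)) < \<rho> (inv_into ?V \<beta> ((\<beta> \<circ> top) i))"
      using tV[OF i] im\<beta> tl[OF II(1,2)[OF i]] inv_into_f_f[OF inj\<beta>] by auto
  qed
  also have "\<dots> = b ^ card I * fact (card X)" by (simp add: b_def)
  also have "b ^ card I \<le> (b powr ((real k - 1) / real k)) ^ card S"
  proof -
    have "b ^ card I = b powr real (card I)" using b by (simp add: powr_realpow)
    also have "\<dots> \<le> b powr ((real k - 1) / real k * real (card S))"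
      using cI b by (intro powr_mono') auto
    also have "\<dots> = (b powr ((real k - 1) / real k)) ^ card S"
    proof -
      have "0 < b powr ((real k - 1) / real k)" using b by simp
      from powr_realpow[OF this, of "card S"] show ?thesis by (simp only: powr_powr)
    qed
    finally show ?thesis .
  qed
  finally show ?thesis by (simp add: b_def E_def mult_right_mono)
qed

text \<open>A union bound over permutations: every copy contains a member of the cover
  \<open>U\<close>, and each \<open>T \<in> U\<close> lies in the copies of at most a fraction q^|T|
  of the permutations, so these fractions sum to at least 1.\<close>

lemma spiral_cost:
  fixes \<phi> :: "nat \<times> nat \<Rightarrow> nat"
  assumes k: "k \<ge> 3" and n: "n \<ge> 1" and \<phi>: "bij_betw \<phi> (spiral_verts k n) X"
    and N: "4 * exp 2 \<le> real (card X)" and finA: "finite A"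
  shows "cost_ge ((4 * exp 2 / real (card X)) powr ((real k - 1) / real k)) A (spiral_copies k n \<phi>) 1"
  unfolding cost_ge_def
proof (intro allI impI)
  let ?q = "(4 * exp 2 / real (card X)) powr ((real k - 1) / real k)"
  fix U assume U: "U \<subseteq> Pow A" "covers U (spiral_copies k n \<phi>)"
  have im: "\<phi> ` spiral_verts k n = X" using \<phi> by (auto simp: bij_betw_def)
  have finX: "finite X" using im finite_spiral_verts by auto
  have finU: "finite U" by (rule finite_subset[OF U(1)]) (use finA in simp)
  let ?P = "\<lambda>T. {\<pi>. \<pi> permutes X \<and> T \<subseteq> (`) \<pi> ` (`) \<phi> ` spiral_edges k n}"
  have fP: "finite (?P T)" for T by (rule finite_subset[OF _ finite_permutations[OF finX]]) auto
  have "{\<pi>. \<pi> permutes X} \<subseteq> (\<Union>T\<in>U. ?P T)"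
  proof
    fix \<pi> assume \<pi>: "\<pi> \<in> {\<pi>. \<pi> permutes X}"
    then have "(`) \<pi> ` (`) \<phi> ` spiral_edges k n \<in> spiral_copies k n \<phi>" unfolding spiral_copies_def im by auto
    then obtain T where "T \<in> U" "T \<subseteq> (`) \<pi> ` (`) \<phi> ` spiral_edges k n" using U(2) unfolding covers_def by blast
    then show "\<pi> \<in> (\<Union>T\<in>U. ?P T)" using \<pi> by auto
  qed
  then have "card {\<pi>. \<pi> permutes X} \<le> card (\<Union>T\<in>U. ?P T)" using finU fP by (intro card_mono) auto
  also have "\<dots> \<le> (\<Sum>T\<in>U. card (?P T))" by (rule card_UN_le[OF finU])
  finally have "fact (card X) \<le> (\<Sum>T\<in>U. card (?P T))" using card_permutations[OF refl finX] by simp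
  then have "real (fact (card X)) \<le> real (\<Sum>T\<in>U. card (?P T))" by (simp only: of_nat_le_iff)
  also have "\<dots> = (\<Sum>T\<in>U. real (card (?P T)))" by simp
  also have "\<dots> \<le> (\<Sum>T\<in>U. ?q ^ card T * fact (card X))"
    by (intro sum_mono spiral_spread[OF k n \<phi> N])
  also have "\<dots> = (\<Sum>T\<in>U. ?q ^ card T) * fact (card X)" by (simp add: sum_distrib_right)
  finally have "1 * fact (card X) \<le> (\<Sum>T\<in>U. ?q ^ card T) * (fact (card X) :: real)" by simp
  then show "1 \<le> (\<Sum>T\<in>U. ?q ^ card T)" by (subst (asm) mult_le_cancel_right_pos) auto
qed

lemma prob_has_spanning_mpg_ge:
  fixes k n m :: nat and P :: real
  defines "N \<equiv> (k - 1) * n + 2"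
  defines "q \<equiv> (4 * exp 2 / real N) powr ((real k - 1) / real k)"
  assumes k: "k \<ge> 3" and n: "n \<ge> 2" and m: "k * n \<le> 2 ^ m" and N: "4 * exp 2 \<le> real N"
    and P: "P \<le> 1" "0 < P" "8 * q * real (Suc m) \<le> P"
  shows "1 - 4 * q * real (Suc m) / P \<le> prob_Gnp N P (has_spanning_mpg (2 * k) N)"
proof -
  have "card (spiral_verts k n) = card {0..<N}" using card_spiral_verts[OF k, of n] n by (simp add: N_def)
  then obtain \<phi> where \<phi>: "bij_betw \<phi> (spiral_verts k n) {0..<N}"
    using finite_same_card_bij[OF finite_spiral_verts, of "{0..<N}" k n] by auto
  let ?H = "spiral_copies k n \<phi>" and ?A = "all_edges N"
  note copy = spiral_copy_maximal[OF k n \<phi>[unfolded N_def], folded N_def]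
  let ?fail = "\<lambda>E. of_bool (\<not> (\<exists>S\<in>?H. S \<subseteq> E)) :: real"
  have "expect ?A P ?fail \<le> 4 * q * real (Suc m) / P"
  proof (rule spread_family_failure_bound[OF finite_all_edges _ _ _ _ P])
    show "?H \<subseteq> Pow ?A" using copy(2) by auto
    show "card S \<le> 2 ^ m" if "S \<in> ?H" for S using copy(3)[OF that] m by simp
    show "cost_ge q ?A ?H 1"
      unfolding q_def using spiral_cost[OF k _ \<phi> _ finite_all_edges, of N] n N by simp
    show "0 \<le> q" by (simp add: q_def)
  qed
  moreover have "expect ?A P (\<lambda>E. 1 + (- 1) * ?fail E) \<le> prob_Gnp N P (has_spanning_mpg (2 * k) N)"
    unfolding prob_Gnp_eq_expect
  proof (intro expect_mono)
    fix E
    show "1 + (- 1) * ?fail E \<le> of_bool (has_spanning_mpg (2 * k) N E)"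
      using copy(1) by (auto simp: has_spanning_mpg_def)
  qed (use P in auto)
  moreover have "expect ?A P (\<lambda>E. 1 + (- 1) * ?fail E) = 1 - expect ?A P ?fail"
    unfolding expect_add expect_cmult expect_const[OF finite_all_edges] by simp
  ultimately show ?thesis by simp
qed

text \<open>Here q has order n^(-a) and there are about log2 (k n) rounds, so the failure
  probability is at most of order log n / (log n)^(1 + 1/k). It tends to 0 whatever the constants,
  hence c2 = 1 is possible.\<close>

theorem upper_threshold:
  fixes k :: nat
  assumes k: "k \<ge> 3"
  shows "\<forall>p :: nat \<Rightarrow> real. (\<forall>n. 0 \<le> p n \<and> p n \<le> 1) \<longrightarrow>
     eventually (\<lambda>n. p n \<ge> 1 * ln (real n) powr ((real (2*k) + 2) / real (2*k))
                          / real n powr ((real (2*k) - 2) / real (2*k))) sequentially \<longrightarrow>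
     (\<lambda>n. prob_Gnp ((k - 1) * n + 2) (p n) (has_spanning_mpg (2*k) ((k - 1) * n + 2))) \<longlonglongrightarrow> 1"
proof (intro allI impI)
  fix p :: "nat \<Rightarrow> real"
  let ?N = "\<lambda>n. (k - 1) * n + 2"
  let ?pr = "\<lambda>n. prob_Gnp (?N n) (p n) (has_spanning_mpg (2*k) (?N n))"
  define a where "a = (real k - 1) / real k"
  define \<delta> where "\<delta> = 1 / real k"
  define C where "C = (4 * exp 2 :: real) powr a"
  define r where "r = (\<lambda>n. 4 * C * (log 2 (real k * real n) + 2) / ln (real n) powr (1 + \<delta>))"
  define lb where "lb = (\<lambda>n. ln (real n) powr (1 + \<delta>) / real n powr a)"
  assume p: "\<forall>n. 0 \<le> p n \<and> p n \<le> 1"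
    and ev: "eventually (\<lambda>n. p n \<ge> 1 * ln (real n) powr ((real (2*k) + 2) / real (2*k))
                          / real n powr ((real (2*k) - 2) / real (2*k))) sequentially"
  have exps: "(real (2*k) + 2) / real (2*k) = 1 + \<delta>" "(real (2*k) - 2) / real (2*k) = a"
    using k by (auto simp: a_def \<delta>_def field_simps)
  have a: "0 < a" using k by (simp add: a_def)
  have \<delta>: "0 < \<delta>" using k by (simp add: \<delta>_def)
  have C: "0 < C" by (simp add: C_def)
  have kpos: "real k > 0" using k by simp
  have r0: "r \<longlonglongrightarrow> 0"
    unfolding r_def log_def using \<delta> kpos by real_asymp
  have ev_r: "eventually (\<lambda>n. r n < 1 / 2) sequentially"
    using r0 by (rule order_tendstoD) simp
  have ev_N: "eventually (\<lambda>n. 4 * exp 2 \<le> real n) sequentially" by real_asymp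
  have bound: "1 - r n \<le> ?pr n"
    if n: "n \<ge> 2" and rn: "r n < 1 / 2" and nC: "4 * exp 2 \<le> real n" and pn: "p n \<ge> lb n" for n
  proof -
    define q where "q = (4 * exp 2 / real (?N n)) powr ((real k - 1) / real k)"
    define m where "m = nat \<lceil>log 2 (real k * real n)\<rceil>"
    have kn: "real k * real n \<ge> 1"
    proof -
      have "Suc 0 \<le> k * n" using k n by (intro Suc_leI) simp
      then have "real (Suc 0) \<le> real (k * n)" by (simp only: of_nat_le_iff)
      then show ?thesis by simp
    qed
    have lg: "0 \<le> log 2 (real k * real n)" using kn by simp
    have mle: "real m \<le> log 2 (real k * real n) + 1"
      unfolding m_def using lg by linarith
    have "log 2 (real k * real n) \<le> real m" unfolding m_def by linarith
    then have "real k * real n \<le> 2 powr real m" using kn by (simp add: log_le_iff)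
    then have "real (k * n) \<le> real (2 ^ m)" by (simp add: powr_realpow)
    then have m: "k * n \<le> 2 ^ m" by (simp only: of_nat_le_iff)
    have Nn: "real n \<le> real (?N n)"
    proof -
      have "1 * n \<le> (k - 1) * n" using k by (intro mult_le_mono1) simp
      then have "n \<le> ?N n" by linarith
      then show ?thesis by (simp only: of_nat_le_iff)
    qed
    have q: "q \<le> C / real n powr a"
    proof -
      have "q \<le> (4 * exp 2 / real n) powr a"
        unfolding q_def a_def using Nn n k by (intro powr_mono2 divide_left_mono) auto
      also have "\<dots> = C / real n powr a" unfolding C_def using n by (simp add: powr_divide)
      finally show ?thesis .
    qed
    have lnn: "0 < ln (real n)" using n by simp
    have lb: "0 < lb n" unfolding lb_def using lnn n by simp
    have p0: "0 < p n" using lb pn by simp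
    have sm: "real (Suc m) \<le> log 2 (real k * real n) + 2" using mle by simp
    have "4 * q * real (Suc m) \<le> 4 * (C / real n powr a) * (log 2 (real k * real n) + 2)"
      using q sm C by (intro mult_mono) (auto simp: q_def)
    also have "\<dots> = r n * lb n" unfolding r_def lb_def using lnn by simp
    also have "\<dots> \<le> r n * p n"
    proof (rule mult_left_mono[OF pn])
      show "0 \<le> r n" unfolding r_def using C lg by simp
    qed
    finally have qr: "4 * q * real (Suc m) \<le> r n * p n" .
    then have "8 * q * real (Suc m) \<le> 2 * r n * p n" by linarith
    also have "\<dots> \<le> 1 * p n" using rn p0 by (intro mult_right_mono) auto
    finally have q8: "8 * q * real (Suc m) \<le> p n" by simp
    have "1 - 4 * q * real (Suc m) / p n \<le> ?pr n"
      unfolding q_def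
      by (rule prob_has_spanning_mpg_ge[OF k n m])
        (use nC Nn p p0 q8 in \<open>auto simp: q_def\<close>)
    moreover have "4 * q * real (Suc m) / p n \<le> r n"
      using qr unfolding pos_divide_le_eq[OF p0] .
    ultimately show ?thesis by linarith
  qed
  show "?pr \<longlonglongrightarrow> 1"
  proof (rule tendsto_sandwich[OF _ _ _ tendsto_const])
    show "eventually (\<lambda>n. 1 - r n \<le> ?pr n) sequentially"
      using ev[unfolded exps] ev_r ev_N eventually_ge_at_top[of 2]
      by eventually_elim (rule bound, auto simp: lb_def)
    show "eventually (\<lambda>n. ?pr n \<le> 1) sequentially" using p prob_Gnp_bounds by auto
    show "(\<lambda>n. 1 - r n) \<longlonglongrightarrow> 1" using tendsto_diff[OF tendsto_const r0, of 1] by simp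
  qed
qed

theorem theorem2:
  fixes k :: nat
  assumes "k \<ge> 3"
  shows "\<exists>c1 c2 :: real. c1 > 0 \<and> c2 > 0 \<and>
    (\<forall>p :: nat \<Rightarrow> real. (\<forall>n. 0 \<le> p n \<and> p n \<le> 1) \<longrightarrow>
       eventually (\<lambda>n. p n \<le> (c1 / real n) powr ((real (2*k) - 2) / real (2*k))) sequentially \<longrightarrow>
       (\<lambda>n. prob_Gnp ((k - 1) * n + 2) (p n) (has_spanning_mpg (2*k) ((k - 1) * n + 2)))
         \<longlonglongrightarrow> 0) \<and>
    (\<forall>p :: nat \<Rightarrow> real. (\<forall>n. 0 \<le> p n \<and> p n \<le> 1) \<longrightarrow>
       eventually (\<lambda>n. p n \<ge> c2 * ln (real n) powr ((real (2*k) + 2) / real (2*k))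
                          / real n powr ((real (2*k) - 2) / real (2*k))) sequentially \<longrightarrow>
       (\<lambda>n. prob_Gnp ((k - 1) * n + 2) (p n) (has_spanning_mpg (2*k) ((k - 1) * n + 2)))
         \<longlonglongrightarrow> 1)"
proof -
  obtain c1 :: real where "c1 > 0" and "\<forall>p :: nat \<Rightarrow> real. (\<forall>n. 0 \<le> p n \<and> p n \<le> 1) \<longrightarrow>
     eventually (\<lambda>n. p n \<le> (c1 / real n) powr ((real (2*k) - 2) / real (2*k))) sequentially \<longrightarrow>
     (\<lambda>n. prob_Gnp ((k - 1) * n + 2) (p n) (has_spanning_mpg (2*k) ((k - 1) * n + 2))) \<longlonglongrightarrow> 0"
    using lower_threshold[OF assms] by (elim exE conjE)
  then show ?thesis
    using upper_threshold[OF assms] by (intro exI[of _ c1] exI[of _ 1] conjI zero_less_one)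
qed

end
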